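(* Let $\Omega=\{(z,w)\in\mathbb{C}^2: z\in D,\ |w|<e^{-\phi(z)}\}$ be a smooth bounded complete pseudoconvex Hartogs domain in $\mathbb{C}^2$. Assume that the boundary $b\Omega$ is strictly pseudoconvex at the base, i.e. at all points of $b\Omega\cap\{w=0\}$. Then $b\Omega$ satisfies property $(P)$ if and only if it satisfies property $(\tilde P)$.
   Context: Hartogs domain: $D\subset\mathbb{C}$ is a bounded domain and $\phi$ is a real-valued $C^2$ function on $D$. "Complete" means that $(z,w)\in\Omega$ and $|w'|\le|w|$ imply $(z,w')\in\Omega$. "Smooth" means that $b\Omega$ is $C^\infty$. Property $(P)$: a compact set $K\subset\mathbb{C}^n$ satisfies property $(P)$ if for every $M>0$ there exist a neighborhood $U$ of $K$ and a $C^2$-smooth function $\lambda$ on $U$ with $0\le\lambda\le1$ such that for all $z\in K$ the smallest eigenvalue of the Hermitian form $\left(\partial^2\lambda(z)/\partial z_j\partial\bar z_k\right)_{j,k=1}^n$ is at least $M$. Property $(\tilde P)$: a compact set $K\subset\mathbb{C}^n$ satisfies property $(\tilde P)$ if for every $M>0$ there exist a neighborhood $U$ of $K$ and a real-valued $g\in C^2(U)$ such that, at all points of $U$ and for all $X\in\mathbb{C}^n$, (i) $|\langle\partial g,X\rangle|^2\le L_g(X)$ and (ii) $L_g(X)\ge M|X|^2$. Here $\langle\partial g,X\rangle=\sum_j\frac{\partial g}{\partial z_j}X_j$ and $L_g(X)=\sum_{j,k}\frac{\partial^2 g}{\partial z_j\partial\bar z_k}X_j\overline{X_k}$. *)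

theory Defs
  imports "HOL-Analysis.Analysis"
begin

text \<open>
  Real \<open>C\<^sup>k\<close> regularity, intended for open sets \<open>U\<close>: derivatives of order up to \<open>k\<close>
  in all directions exist and are continuous on \<open>U\<close>.
\<close>

fun Ck_on :: "nat \<Rightarrow> 'a::real_normed_vector set \<Rightarrow> ('a \<Rightarrow> 'b::real_normed_vector) \<Rightarrow> bool" where
  "Ck_on 0 U f \<longleftrightarrow> continuous_on U f"
| "Ck_on (Suc k) U f \<longleftrightarrow>
     (\<forall>x\<in>U. f differentiable (at x)) \<and>
     (\<forall>v. Ck_on k U (\<lambda>x. frechet_derivative f (at x) v))"

definition Cinf_on :: "'a::real_normed_vector set \<Rightarrow> ('a \<Rightarrow> 'b::real_normed_vector) \<Rightarrow> bool" where
  "Cinf_on U f \<longleftrightarrow> (\<forall>k. Ck_on k U f)"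

text \<open>
  With \<open>z\<^sub>j = x\<^sub>j + i y\<^sub>j\<close>, the vectors \<open>axis j 1\<close> and \<open>axis j \<i>\<close> are the real coordinate
  directions of \<open>x\<^sub>j\<close> and \<open>y\<^sub>j\<close>.
\<close>

definition d_z :: "'n::finite \<Rightarrow> (complex^'n \<Rightarrow> complex) \<Rightarrow> complex^'n \<Rightarrow> complex" where
  "d_z j f p =
     (frechet_derivative f (at p) (axis j 1) - \<i> * frechet_derivative f (at p) (axis j \<i>)) / 2"

definition d_zbar :: "'n::finite \<Rightarrow> (complex^'n \<Rightarrow> complex) \<Rightarrow> complex^'n \<Rightarrow> complex" where
  "d_zbar j f p =
     (frechet_derivative f (at p) (axis j 1) + \<i> * frechet_derivative f (at p) (axis j \<i>)) / 2"

definition complex_hessian :: "(complex^'n \<Rightarrow> real) \<Rightarrow> complex^'n::finite \<Rightarrow> complex^'n^'n" where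
  "complex_hessian g p = (\<chi> j k. d_z j (d_zbar k (\<lambda>q. complex_of_real (g q))) p)"

definition del_pairing :: "(complex^'n \<Rightarrow> real) \<Rightarrow> complex^'n::finite \<Rightarrow> complex^'n \<Rightarrow> complex" where
  "del_pairing g p X = (\<Sum>j\<in>UNIV. d_z j (\<lambda>q. complex_of_real (g q)) p * X $ j)"

text \<open>For \<open>C\<^sup>2\<close> functions the complex Hessian is Hermitian, so the double sum below is already real.\<close>

definition levi_form :: "(complex^'n \<Rightarrow> real) \<Rightarrow> complex^'n::finite \<Rightarrow> complex^'n \<Rightarrow> real" where
  "levi_form g p X =
     Re (\<Sum>j\<in>UNIV. \<Sum>k\<in>UNIV. complex_hessian g p $ j $ k * X $ j * cnj (X $ k))"

text \<open>
  For a Hermitian matrix all eigenvalues are real and there are finitely many (at least one),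
  so the least element below exists.
\<close>

definition smallest_eigenvalue :: "complex^'n^'n::finite \<Rightarrow> real" where
  "smallest_eigenvalue A = (LEAST c::real. \<exists>v. v \<noteq> 0 \<and> A *v v = complex_of_real c *s v)"

definition property_P :: "(complex^'n::finite) set \<Rightarrow> bool" where
  "property_P K \<longleftrightarrow> compact K \<and>
     (\<forall>M>0. \<exists>U u. open U \<and> K \<subseteq> U \<and> Ck_on 2 U u \<and>
        (\<forall>z\<in>U. 0 \<le> u z \<and> u z \<le> 1) \<and>
        (\<forall>z\<in>K. M \<le> smallest_eigenvalue (complex_hessian u z)))"

definition property_P_tilde :: "(complex^'n::finite) set \<Rightarrow> bool" where
  "property_P_tilde K \<longleftrightarrow> compact K \<and>
     (\<forall>M>0. \<exists>U g. open U \<and> K \<subseteq> U \<and> Ck_on 2 U g \<and>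
        (\<forall>z\<in>U. \<forall>X. (cmod (del_pairing g z X))\<^sup>2 \<le> levi_form g z X \<and>
                    M * (norm X)\<^sup>2 \<le> levi_form g z X))"

definition local_defining_function ::
  "'a::real_normed_vector set \<Rightarrow> 'a \<Rightarrow> 'a set \<Rightarrow> ('a \<Rightarrow> real) \<Rightarrow> bool" where
  "local_defining_function \<Omega> p V \<rho> \<longleftrightarrow>
     open V \<and> p \<in> V \<and> \<Omega> \<inter> V = {x\<in>V. \<rho> x < 0} \<and>
     (\<forall>x\<in>V. \<rho> differentiable (at x)) \<and>
     (\<forall>x\<in>V. \<exists>v. frechet_derivative \<rho> (at x) v \<noteq> 0)"

definition smooth_boundary :: "'a::real_normed_vector set \<Rightarrow> bool" where
  "smooth_boundary \<Omega> \<longleftrightarrow>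
     (\<forall>p\<in>frontier \<Omega>. \<exists>V \<rho>. local_defining_function \<Omega> p V \<rho> \<and> Cinf_on V \<rho>)"

text \<open>
  (Strict) Levi pseudoconvexity at a boundary point. At boundary points the sign of the Levi form
  on the complex tangent space does not depend on the choice of the \<open>C\<^sup>2\<close> defining function.
\<close>

definition pseudoconvex_at :: "(complex^'n::finite) set \<Rightarrow> complex^'n \<Rightarrow> bool" where
  "pseudoconvex_at \<Omega> p \<longleftrightarrow>
     (\<exists>V \<rho>. local_defining_function \<Omega> p V \<rho> \<and> Ck_on 2 V \<rho> \<and>
        (\<forall>X. del_pairing \<rho> p X = 0 \<longrightarrow> 0 \<le> levi_form \<rho> p X))"

definition strictly_pseudoconvex_at :: "(complex^'n::finite) set \<Rightarrow> complex^'n \<Rightarrow> bool" where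
  "strictly_pseudoconvex_at \<Omega> p \<longleftrightarrow>
     (\<exists>V \<rho>. local_defining_function \<Omega> p V \<rho> \<and> Ck_on 2 V \<rho> \<and>
        (\<forall>X. X \<noteq> 0 \<and> del_pairing \<rho> p X = 0 \<longrightarrow> 0 < levi_form \<rho> p X))"

definition pseudoconvex :: "(complex^'n::finite) set \<Rightarrow> bool" where
  "pseudoconvex \<Omega> \<longleftrightarrow> (\<forall>p\<in>frontier \<Omega>. pseudoconvex_at \<Omega> p)"

definition hartogs_domain :: "complex set \<Rightarrow> (complex \<Rightarrow> real) \<Rightarrow> (complex^2) set" where
  "hartogs_domain D \<phi> = {p. p $ 1 \<in> D \<and> cmod (p $ 2) < exp (- \<phi> (p $ 1))}"

definition complete_hartogs :: "(complex^2) set \<Rightarrow> bool" where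
  "complete_hartogs \<Omega> \<longleftrightarrow>
     (\<forall>p\<in>\<Omega>. \<forall>q. q $ 1 = p $ 1 \<and> cmod (q $ 2) \<le> cmod (p $ 2) \<longrightarrow> q \<in> \<Omega>)"

end

theory Submission
  imports Defs
begin

text \<open>
  (P) implies (P~) by passing to \<open>exp (\<lambda> - 1)\<close>. For the converse, strict pseudoconvexity at the base
  forces the boundary to consist of the graph \<open>\<bar>w\<bar> = exp (- \<phi> z)\<close>, \<open>z \<in> D\<close>, and of \<open>\<partial>D \<times> {0}\<close>, and to have
  its weakly pseudoconvex points over a compact set \<open>K\<close> in \<open>D\<close> on which the Laplacian of \<open>\<phi>\<close> vanishes. If
  \<open>g\<close> is as in (P~) with constant \<open>M\<close>, then \<open>exp (- g / 2)\<close> is a positive supersolution of \<open>\<Delta> + cM\<close> along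
  complex tangential discs; averaged over rotations of \<open>w\<close> and restricted to the boundary, it gives such a
  supersolution near \<open>K\<close> in the plane. The latter bounds the first Dirichlet eigenvalue of a neighborhood of
  \<open>K\<close> from below by \<open>cM\<close>, hence its torsion function \<open>v\<close> (\<open>\<Delta>v = -1\<close>) from above by \<open>C / M\<close>, and
  \<open>\<lambda> = 1 - M v / C\<close> is bounded with Laplacian \<open>M / C\<close> on \<open>K\<close>. To avoid the Dirichlet problem, \<open>v\<close> is
  constructed on a fine square lattice and then mollified. Finally \<open>\<lambda>(z) + A r + B r\<^sup>2\<close>, with a defining
  function \<open>r\<close> and suitable large \<open>A\<close> and \<open>B\<close>, witnesses (P): it differs little from \<open>\<lambda>\<close> near the boundary,
  where \<open>r\<close> vanishes.
\<close>

subsection \<open>Functions of class C2\<close>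

text \<open>Property (P~) bounds \<open>g\<close> by nothing uniform in \<open>M\<close>, so
  \<open>g\<close> cannot be made into a bounded function directly. What survives is multiplicative:
  by the gradient condition the Levi form of \<open>exp (- g / 2)\<close> is at most
  \<open>- 1/4\<close> times \<open>exp (- g / 2)\<close> times that of \<open>g\<close>, and
  Barta's argument only uses quotients of the supersolution. The price is an L2 estimate instead of
  a pointwise one. Exponential weights with rate of order \<open>sqrt M\<close> (Agmon's device)
  localize it to discs of radius \<open>1 / sqrt M\<close>, where it bounds averages of the torsion
  function by a multiple of \<open>1 / M\<close>, whatever the size of the domain. Averages over
  much smaller discs exceed these by no more than another multiple of \<open>1 / M\<close>, because
  the torsion function, extended by zero, has Laplacian at least \<open>- 1\<close> in the whole
  plane, also across the edge of the domain. The crude bound coming from the diameter only enters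
  multiplied by the discretization error, and the lattice step is chosen after everything
  else.\<close>

definition C2_derivs ::
  "'a::euclidean_space set \<Rightarrow> ('a \<Rightarrow> real) \<Rightarrow> ('a \<Rightarrow> 'a \<Rightarrow> real) \<Rightarrow> ('a \<Rightarrow> 'a \<Rightarrow> 'a \<Rightarrow> real) \<Rightarrow> bool"
where
  "C2_derivs U f D B \<longleftrightarrow> open U \<and>
     (\<forall>x\<in>U. (f has_derivative D x) (at x)) \<and>
     (\<forall>x\<in>U. \<forall>v. ((\<lambda>y. D y v) has_derivative B x v) (at x)) \<and>
     (\<forall>v w. continuous_on U (\<lambda>x. B x v w))"

lemma C2_derivsD:
  assumes "C2_derivs U f D B"
  shows "open U" "\<And>x. x \<in> U \<Longrightarrow> (f has_derivative D x) (at x)"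
    "\<And>x v. x \<in> U \<Longrightarrow> ((\<lambda>y. D y v) has_derivative B x v) (at x)"
    "\<And>v w. continuous_on U (\<lambda>x. B x v w)"
  using assms by (auto simp: C2_derivs_def)

text \<open>The entry point from \<open>Ck_on\<close>. \<open>C2_derivs\<close> carries both
  derivatives as data, so that sums, products, compositions and gluing produce explicit Hessians on
  which \<open>levi_of\<close> and \<open>lap\<close> can be computed.\<close>

lemma Ck_on_2_imp_C2_derivs:
  assumes "open U" "Ck_on 2 U f"
  shows "C2_derivs U f (\<lambda>x. frechet_derivative f (at x))
           (\<lambda>x v. frechet_derivative (\<lambda>y. frechet_derivative f (at y) v) (at x))"
proof -
  have "Ck_on (Suc (Suc 0)) U f"
    using assms by (simp add: numeral_2_eq_2)
  then show ?thesis
    using assms(1) by (simp add: C2_derivs_def frechet_derivative_works)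
qed

lemma C2_derivs_frechet1:
  assumes "C2_derivs U f D B" "x \<in> U"
  shows "frechet_derivative f (at x) = D x"
  using C2_derivsD(2)[OF assms] by (metis frechet_derivative_at)

lemma C2_derivs_frechet2:
  assumes "C2_derivs U f D B" "x \<in> U"
  shows "((\<lambda>y. frechet_derivative f (at y) v) has_derivative B x v) (at x)"
proof (rule has_derivative_transform_within_open)
  show "((\<lambda>y. D y v) has_derivative B x v) (at x)"
    by (rule C2_derivsD(3)[OF assms])
  show "open U" by (rule C2_derivsD(1)[OF assms(1)])
  show "x \<in> U" by fact
qed (simp add: C2_derivs_frechet1[OF assms(1)])

lemma C2_derivs_imp_Ck_on_2:
  assumes "C2_derivs U f D B"
  shows "Ck_on 2 U f"
proof -
  have 2: "(2::nat) = Suc (Suc 0)" by simp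
  have eq: "frechet_derivative (\<lambda>y. frechet_derivative f (at y) v) (at x) = B x v" if "x \<in> U" for x v
    using C2_derivs_frechet2[OF assms that, of v] by (metis frechet_derivative_at)
  have "continuous_on U (\<lambda>x. frechet_derivative (\<lambda>y. frechet_derivative f (at y) v) (at x) w)" for v w
    using C2_derivsD(4)[OF assms, of v w] by (rule continuous_on_eq) (simp add: eq)
  then show ?thesis
    unfolding 2 using C2_derivsD(2)[OF assms] C2_derivs_frechet2[OF assms]
    by (auto simp: differentiable_def) blast
qed

lemma C2_derivs_subset:
  assumes "C2_derivs U f D B" "open V" "V \<subseteq> U"
  shows "C2_derivs V f D B"
  using assms unfolding C2_derivs_def by (meson continuous_on_subset subsetD)

lemma C2_derivs_linear1:
  assumes "C2_derivs U f D B" "x \<in> U" shows "linear (D x)"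
  using C2_derivsD(2)[OF assms] has_derivative_linear by blast

lemma C2_derivs_linear2:
  assumes "C2_derivs U f D B" "x \<in> U" shows "linear (B x v)"
  using C2_derivsD(3)[OF assms] has_derivative_linear by blast

text \<open>Linearity in the first slot is inherited from \<open>D y\<close>: differentiate its
  linearity identities, valid for all \<open>y\<close> in the open set, and use uniqueness of
  derivatives.\<close>

lemma C2_derivs_linear3:
  assumes "C2_derivs U f D B" "x \<in> U" shows "linear (\<lambda>v. B x v w)"
proof (rule linearI)
  note d = C2_derivsD(3)[OF assms]
  note l = C2_derivs_linear1[OF assms(1)]
  fix u v :: 'a and c :: real
  have "((\<lambda>y. D y (u + v)) has_derivative (\<lambda>w. B x u w + B x v w)) (at x)"
    by (rule has_derivative_transform_within_open[OF has_derivative_add[OF d d] C2_derivsD(1)[OF assms(1)] assms(2)])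
      (auto simp: linear_add[OF l])
  with d[of "u + v"] show "B x (u + v) w = B x u w + B x v w"
    using has_derivative_unique by (metis (no_types, lifting))
  have "((\<lambda>y. D y (c *\<^sub>R u)) has_derivative (\<lambda>w. c *\<^sub>R B x u w)) (at x)"
    by (rule has_derivative_transform_within_open[OF has_derivative_scaleR_right[OF d] C2_derivsD(1)[OF assms(1)] assms(2)])
      (auto simp: linear_scale[OF l])
  with d[of "c *\<^sub>R u"] show "B x (c *\<^sub>R u) w = c *\<^sub>R B x u w"
    using has_derivative_unique by (metis (no_types, lifting))
qed

lemma C2_derivs_continuous0:
  assumes "C2_derivs U f D B" shows "continuous_on U f"
  using C2_derivsD(1,2)[OF assms]
  by (meson continuous_on_eq_continuous_at has_derivative_continuous)

lemma C2_derivs_continuous1: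
  assumes "C2_derivs U f D B" shows "continuous_on U (\<lambda>x. D x v)"
  using C2_derivsD(1,3)[OF assms]
  by (meson continuous_on_eq_continuous_at has_derivative_continuous)

text \<open>Continuity in each fixed direction suffices in finite dimension: expanding the direction
  in a basis gives joint continuity, which the compactness arguments over unit spheres need.\<close>

lemma C2_derivs_joint1:
  assumes "C2_derivs U f D B"
  shows "continuous_on (U \<times> UNIV) (\<lambda>p. D (fst p) (snd p))"
proof -
  have "continuous_on (U \<times> UNIV) (\<lambda>p. \<Sum>b\<in>Basis. (snd p \<bullet> b) * D (fst p) b)"
    by (intro continuous_intros continuous_on_compose2[OF C2_derivs_continuous1[OF assms]]) auto
  moreover have "(\<Sum>b\<in>Basis. (snd p \<bullet> b) * D (fst p) b) = D (fst p) (snd p)" if "p \<in> U \<times> UNIV" for p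
  proof -
    have l: "linear (D (fst p))" using C2_derivs_linear1[OF assms] that by auto
    have "D (fst p) (snd p) = D (fst p) (\<Sum>b\<in>Basis. (snd p \<bullet> b) *\<^sub>R b)"
      by (simp add: euclidean_representation)
    then show ?thesis by (simp add: linear_sum[OF l] linear_scale[OF l])
  qed
  ultimately show ?thesis by (rule continuous_on_eq)
qed

lemma C2_derivs_joint2:
  assumes "C2_derivs U f D B"
  shows "continuous_on (U \<times> UNIV) (\<lambda>p. B (fst p) (snd p) (snd p))"
proof -
  have "continuous_on (U \<times> UNIV)
      (\<lambda>p. \<Sum>b\<in>Basis. \<Sum>c\<in>Basis. (snd p \<bullet> b) * (snd p \<bullet> c) * B (fst p) b c)"
    by (intro continuous_intros continuous_on_compose2[OF C2_derivsD(4)[OF assms]]) auto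
  moreover have "(\<Sum>b\<in>Basis. \<Sum>c\<in>Basis. (snd p \<bullet> b) * (snd p \<bullet> c) * B (fst p) b c)
      = B (fst p) (snd p) (snd p)" if "p \<in> U \<times> UNIV" for p
  proof -
    have l: "linear (B (fst p) v)" "linear (\<lambda>v. B (fst p) v w)" for v w
      using C2_derivs_linear2[OF assms] C2_derivs_linear3[OF assms] that by auto
    have "B (fst p) (snd p) (snd p) = B (fst p) (\<Sum>b\<in>Basis. (snd p \<bullet> b) *\<^sub>R b) (\<Sum>b\<in>Basis. (snd p \<bullet> b) *\<^sub>R b)"
      by (simp add: euclidean_representation)
    also have "\<dots> = (\<Sum>b\<in>Basis. B (fst p) ((snd p \<bullet> b) *\<^sub>R b) (\<Sum>b\<in>Basis. (snd p \<bullet> b) *\<^sub>R b))"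
      by (rule linear_sum[OF l(2)])
    also have "\<dots> = (\<Sum>b\<in>Basis. \<Sum>c\<in>Basis. B (fst p) ((snd p \<bullet> b) *\<^sub>R b) ((snd p \<bullet> c) *\<^sub>R c))"
      by (simp add: linear_sum[OF l(1)])
    finally show ?thesis by (simp add: linear_scale[OF l(1)] linear_scale[OF l(2)] mult.left_commute mult.assoc)
  qed
  ultimately show ?thesis by (rule continuous_on_eq)
qed

lemma C2_derivs_line:
  assumes "C2_derivs U f D B" "p + t *\<^sub>R v \<in> U"
  shows "((\<lambda>t. f (p + t *\<^sub>R v)) has_real_derivative D (p + t *\<^sub>R v) v) (at t)"
    and "((\<lambda>t. D (p + t *\<^sub>R v) w) has_real_derivative B (p + t *\<^sub>R v) w v) (at t)"
proof -
  have g: "((\<lambda>t. p + t *\<^sub>R v) has_derivative (\<lambda>s. s *\<^sub>R v)) (at t)"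
    by (auto intro!: derivative_eq_intros)
  have "((\<lambda>t. f (p + t *\<^sub>R v)) has_derivative (\<lambda>s. D (p + t *\<^sub>R v) (s *\<^sub>R v))) (at t)"
    by (rule has_derivative_compose[OF g C2_derivsD(2)[OF assms]])
  then show "((\<lambda>t. f (p + t *\<^sub>R v)) has_real_derivative D (p + t *\<^sub>R v) v) (at t)"
    by (simp add: linear_scale[OF C2_derivs_linear1[OF assms]] has_field_derivative_def mult_commute_abs)
  have "((\<lambda>t. D (p + t *\<^sub>R v) w) has_derivative (\<lambda>s. B (p + t *\<^sub>R v) w (s *\<^sub>R v))) (at t)"
    by (rule has_derivative_compose[OF g C2_derivsD(3)[OF assms]])
  then show "((\<lambda>t. D (p + t *\<^sub>R v) w) has_real_derivative B (p + t *\<^sub>R v) w v) (at t)"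
    by (simp add: linear_scale[OF C2_derivs_linear2[OF assms]] has_field_derivative_def mult_commute_abs)
qed

text \<open>Both second derivatives are recovered from the same second difference by two applications of
  the mean value theorem.\<close>

lemma C2_derivs_second_difference:
  assumes C: "C2_derivs U f D B" and b: "cball p e \<subseteq> U" and s: "0 < s" "s * (norm v + norm w) \<le> e"
  shows "\<exists>q. norm (q - p) \<le> s * (norm v + norm w) \<and>
    f (p + s *\<^sub>R v + s *\<^sub>R w) - f (p + s *\<^sub>R v) - f (p + s *\<^sub>R w) + f p = s\<^sup>2 * B q v w"
proof -
  have inU: "p + t *\<^sub>R v + t' *\<^sub>R w \<in> U" and nrm: "norm (t *\<^sub>R v + t' *\<^sub>R w) \<le> s * (norm v + norm w)"
    if "0 \<le> t" "t \<le> s" "0 \<le> t'" "t' \<le> s" for t t'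
  proof -
    have "norm (t *\<^sub>R v + t' *\<^sub>R w) \<le> t * norm v + t' * norm w"
      using that norm_triangle_ineq[of "t *\<^sub>R v" "t' *\<^sub>R w"] by simp
    also have "\<dots> \<le> s * norm v + s * norm w"
      using that by (intro add_mono mult_right_mono) auto
    finally show "norm (t *\<^sub>R v + t' *\<^sub>R w) \<le> s * (norm v + norm w)" by (simp add: algebra_simps)
    with s have "p + (t *\<^sub>R v + t' *\<^sub>R w) \<in> cball p e"
      by (simp add: mem_cball dist_norm norm_minus_cancel[of "t *\<^sub>R v + t' *\<^sub>R w", symmetric] del: norm_minus_cancel)
    then show "p + t *\<^sub>R v + t' *\<^sub>R w \<in> U" using b by (auto simp: add.assoc)
  qed
  define g where "g t = f (p + s *\<^sub>R w + t *\<^sub>R v) - f (p + t *\<^sub>R v)" for t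
  have "\<exists>\<xi>. 0 < \<xi> \<and> \<xi> < s \<and> g s - g 0 = (s - 0) * (D (p + s *\<^sub>R w + \<xi> *\<^sub>R v) v - D (p + \<xi> *\<^sub>R v) v)"
  proof (rule MVT2[OF s(1)])
    fix t assume t: "0 \<le> t" "t \<le> s"
    show "DERIV g t :> D (p + s *\<^sub>R w + t *\<^sub>R v) v - D (p + t *\<^sub>R v) v"
      unfolding g_def
      using inU[of t s] inU[of t 0] t s
      by (intro DERIV_diff C2_derivs_line(1)[OF C]) (auto simp: ac_simps)
  qed
  then obtain \<xi> where xi: "0 < \<xi>" "\<xi> < s"
    "g s - g 0 = s * (D (p + s *\<^sub>R w + \<xi> *\<^sub>R v) v - D (p + \<xi> *\<^sub>R v) v)" by auto
  have "\<exists>\<eta>. 0 < \<eta> \<and> \<eta> < s \<and> D (p + \<xi> *\<^sub>R v + s *\<^sub>R w) v - D (p + \<xi> *\<^sub>R v + 0 *\<^sub>R w) v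
      = (s - 0) * B (p + \<xi> *\<^sub>R v + \<eta> *\<^sub>R w) v w"
  proof (rule MVT2[OF s(1)])
    fix t assume t: "0 \<le> t" "t \<le> s"
    show "DERIV (\<lambda>t. D (p + \<xi> *\<^sub>R v + t *\<^sub>R w) v) t :> B (p + \<xi> *\<^sub>R v + t *\<^sub>R w) v w"
      using inU[of \<xi> t] t xi by (intro C2_derivs_line(2)[OF C]) auto
  qed
  then obtain \<eta> where eta: "0 < \<eta>" "\<eta> < s"
    "D (p + \<xi> *\<^sub>R v + s *\<^sub>R w) v - D (p + \<xi> *\<^sub>R v) v = s * B (p + \<xi> *\<^sub>R v + \<eta> *\<^sub>R w) v w" by auto
  have "f (p + s *\<^sub>R v + s *\<^sub>R w) - f (p + s *\<^sub>R v) - f (p + s *\<^sub>R w) + f p = g s - g 0"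
    by (simp add: g_def add.commute add.left_commute)
  also have "\<dots> = s * (s * B (p + \<xi> *\<^sub>R v + \<eta> *\<^sub>R w) v w)"
    unfolding xi(3) eta(3)[symmetric] by (simp add: add.commute add.left_commute)
  finally show ?thesis
    using nrm[of \<xi> \<eta>] xi eta
    by (intro exI[of _ "p + \<xi> *\<^sub>R v + \<eta> *\<^sub>R w"]) (simp add: power2_eq_square add.assoc)
qed

text \<open>Schwarz's theorem. The second difference is symmetric in \<open>v\<close> and
  \<open>w\<close>, so \<open>B q1 v w = B q2 w v\<close> at two points as close to \<open>p\<close>
  as desired, and continuity transfers the equality to \<open>p\<close>.\<close>

lemma C2_derivs_symmetric:
  assumes C: "C2_derivs U f D B" and p: "p \<in> U"
  shows "B p v w = B p w v"
proof (rule ccontr)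
  assume ne: "B p v w \<noteq> B p w v"
  define \<epsilon> where "\<epsilon> = \<bar>B p v w - B p w v\<bar> / 2"
  have e: "\<epsilon> > 0" using ne by (simp add: \<epsilon>_def)
  have op: "open U" using C2_derivsD(1)[OF C] .
  have "isCont (\<lambda>x. B x v w) p" "isCont (\<lambda>x. B x w v) p"
    using C2_derivsD(4)[OF C] op p continuous_on_eq_continuous_at by blast+
  then obtain d1 d2 where d: "d1 > 0" "d2 > 0"
    "\<And>x. dist x p < d1 \<Longrightarrow> dist (B x v w) (B p v w) < \<epsilon>"
    "\<And>x. dist x p < d2 \<Longrightarrow> dist (B x w v) (B p w v) < \<epsilon>"
    using e unfolding continuous_at_eps_delta by metis
  obtain d3 where d3: "d3 > 0" "cball p d3 \<subseteq> U" using op p open_contains_cball by blast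
  define d where "d = min (min d1 d2) d3 / 2"
  have dpos: "d > 0" "d < d1" "d < d2" "d \<le> d3" using d d3 by (auto simp: d_def)
  define s where "s = d / (1 + norm v + norm w)"
  have pos: "1 + norm v + norm w > 0" by (simp add: add_pos_nonneg)
  have s: "s > 0" "s * (norm v + norm w) \<le> d"
    using dpos pos by (auto simp: s_def field_simps)
  obtain q1 where q1: "norm (q1 - p) \<le> d"
    "f (p + s *\<^sub>R v + s *\<^sub>R w) - f (p + s *\<^sub>R v) - f (p + s *\<^sub>R w) + f p = s\<^sup>2 * B q1 v w"
    using C2_derivs_second_difference[OF C d3(2) s(1) order_trans[OF s(2) dpos(4)]] s(2)
    by (meson order_trans)
  have s': "s * (norm w + norm v) \<le> d" using s(2) by (simp add: add.commute)
  obtain q2 where q2: "norm (q2 - p) \<le> d"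
    "f (p + s *\<^sub>R w + s *\<^sub>R v) - f (p + s *\<^sub>R w) - f (p + s *\<^sub>R v) + f p = s\<^sup>2 * B q2 w v"
    using C2_derivs_second_difference[OF C d3(2) s(1) order_trans[OF s' dpos(4)]] s'
    by (meson order_trans)
  have "s\<^sup>2 * B q1 v w = s\<^sup>2 * B q2 w v"
    unfolding q1(2)[symmetric] q2(2)[symmetric] by (simp add: add.commute add.left_commute)
  then have "B q1 v w = B q2 w v" using s by simp
  moreover have "\<bar>B q1 v w - B p v w\<bar> < \<epsilon>" "\<bar>B q2 w v - B p w v\<bar> < \<epsilon>"
    using d(3)[of q1] d(4)[of q2] order_le_less_trans[OF q1(1) dpos(2)] order_le_less_trans[OF q2(1) dpos(3)]
    unfolding dist_norm real_norm_def by blast+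
  moreover have "\<bar>B p v w - B p w v\<bar> = 2 * \<epsilon>" by (simp add: \<epsilon>_def)
  ultimately show False by linarith
qed

lemma compact_thickening_subset_open:
  fixes K :: "'a::euclidean_space set"
  assumes "compact K" "open U" "K \<subseteq> U"
  obtains d where "d > 0" "compact {x + v |x v. x \<in> K \<and> v \<in> cball 0 d}"
    "\<And>x v. x \<in> K \<Longrightarrow> norm v \<le> d \<Longrightarrow> x + v \<in> U"
proof -
  obtain e where e: "e > 0" "(\<Union>x\<in>K. ball x e) \<subseteq> U"
    using compact_subset_open_imp_ball_epsilon_subset[OF assms] by blast
  have "x + v \<in> U" if "x \<in> K" "norm v \<le> e / 2" for x v
  proof -
    have "x + v \<in> ball x e" using that e by (simp add: dist_norm)
    then show ?thesis using that e by blast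
  qed
  moreover have "compact {x + v |x v. x \<in> K \<and> v \<in> cball 0 (e/2)}"
    by (intro compact_sums assms compact_cball)
  ultimately show ?thesis using that[of "e/2"] e by simp
qed

text \<open>Uniformity in \<open>p\<close> comes from uniform continuity of the Hessian on a compact
  thickening of \<open>K\<close> times the unit sphere; homogeneity in \<open>v\<close> turns its
  modulus of continuity into the quadratic error.\<close>

lemma C2_derivs_uniform_Taylor:
  fixes f :: "'a::euclidean_space \<Rightarrow> real"
  assumes C: "C2_derivs U f D B" and K: "compact K" "K \<subseteq> U" and \<eta>: "\<eta> > 0"
  obtains \<delta> where "\<delta> > 0" "\<And>p v. p \<in> K \<Longrightarrow> norm v < \<delta> \<Longrightarrow> p + v \<in> U"
    "\<And>p v. p \<in> K \<Longrightarrow> norm v < \<delta> \<Longrightarrow> \<bar>f (p + v) - f p - D p v - B p v v / 2\<bar> \<le> \<eta> * (norm v)\<^sup>2"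
proof -
  obtain d where d: "d > 0" "compact {x + v |x v. x \<in> K \<and> v \<in> cball 0 d}"
    "\<And>x v. x \<in> K \<Longrightarrow> norm v \<le> d \<Longrightarrow> x + v \<in> U"
    using compact_thickening_subset_open[OF K(1) C2_derivsD(1)[OF C] K(2)] by blast
  define K1 where "K1 = {x + v |x v. x \<in> K \<and> v \<in> cball 0 d}"
  have "compact (K1 \<times> sphere (0::'a) 1)" using d(2) unfolding K1_def by (intro compact_Times compact_sphere)
  moreover have "continuous_on (K1 \<times> sphere (0::'a) 1) (\<lambda>p. B (fst p) (snd p) (snd p))"
    by (rule continuous_on_subset[OF C2_derivs_joint2[OF C]]) (use d(3) in \<open>auto simp: K1_def\<close>)
  ultimately have "uniformly_continuous_on (K1 \<times> sphere 0 1) (\<lambda>p. B (fst p) (snd p) (snd p))"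
    by (rule compact_uniformly_continuous[rotated])
  then obtain e where e: "e > 0" "\<And>x x'. x \<in> K1 \<times> sphere 0 1 \<Longrightarrow> x' \<in> K1 \<times> sphere 0 1 \<Longrightarrow> dist x' x < e
     \<Longrightarrow> dist (B (fst x') (snd x') (snd x')) (B (fst x) (snd x) (snd x)) < \<eta>"
    using \<eta> unfolding uniformly_continuous_on_def by metis
  show ?thesis
  proof (rule that[of "min e d"])
    fix p v :: 'a assume pv: "p \<in> K" "norm v < min e d"
    show "p + v \<in> U" using d(3) pv by auto
    show "\<bar>f (p + v) - f p - D p v - B p v v / 2\<bar> \<le> \<eta> * (norm v)\<^sup>2"
    proof (cases "v = 0")
      case True
      have l: "linear (D p)" "linear (B p v)"
        using C2_derivs_linear1[OF C] C2_derivs_linear2[OF C] pv K by auto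
      then show ?thesis using True by (simp add: linear_0)
    next
      case False
      have inU: "p + t *\<^sub>R v \<in> U" and inK: "p + t *\<^sub>R v \<in> K1" if "0 \<le> t" "t \<le> 1" for t
      proof -
        have "norm (t *\<^sub>R v) \<le> norm v" using that by (simp add: mult_left_le_one_le)
        then have n: "norm (t *\<^sub>R v) \<le> d" using pv by linarith
        then show "p + t *\<^sub>R v \<in> U" using d(3) pv by blast
        from n pv show "p + t *\<^sub>R v \<in> K1" unfolding K1_def mem_Collect_eq mem_cball_0 by blast
      qed
      define diff where "diff m t = (if m = 0 then f (p + t *\<^sub>R v)
         else if m = 1 then D (p + t *\<^sub>R v) v else B (p + t *\<^sub>R v) v v)" for m :: nat and t
      have "\<exists>t>0. t < 1 \<and> f (p + 1 *\<^sub>R v) = (\<Sum>m<2. diff m 0 / fact m * 1 ^ m) + diff 2 t / fact 2 * 1\<^sup>2"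
      proof (rule Maclaurin)
        show "diff 0 = (\<lambda>t. f (p + t *\<^sub>R v))" by (simp add: diff_def fun_eq_iff)
        show "\<forall>m t. m < 2 \<and> 0 \<le> t \<and> t \<le> 1 \<longrightarrow> DERIV (diff m) t :> diff (Suc m) t"
        proof (intro allI impI)
          fix m :: nat and t :: real assume mt: "m < 2 \<and> 0 \<le> t \<and> t \<le> 1"
          then have "m = 0 \<or> m = 1" by auto
          then show "DERIV (diff m) t :> diff (Suc m) t"
            using C2_derivs_line[OF C inU[of t]] mt by (auto simp: diff_def[abs_def])
        qed
      qed auto
      then obtain t where t: "0 < t" "t < 1"
        "f (p + v) = f p + D p v + B (p + t *\<^sub>R v) v v / 2"
        by (auto simp: diff_def numeral_2_eq_2)
      define u where "u = v /\<^sub>R norm v"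
      have vu: "v = norm v *\<^sub>R u" using False by (simp add: u_def)
      have sc: "B q v v = (norm v)\<^sup>2 * B q u u" if "q \<in> U" for q
      proof -
        have "B q v v = B q (norm v *\<^sub>R u) (norm v *\<^sub>R u)" using vu by simp
        also have "\<dots> = norm v * B q (norm v *\<^sub>R u) u"
          using linear_scale[OF C2_derivs_linear2[OF C that]] by simp
        also have "B q (norm v *\<^sub>R u) u = norm v * B q u u"
          using linear_scale[OF C2_derivs_linear3[OF C that], of "norm v" u] by simp
        finally show ?thesis by (simp add: power2_eq_square)
      qed
      have "norm u = 1" using False by (simp add: u_def)
      moreover have "norm (t *\<^sub>R v) < e" using pv t by (simp) (meson less_trans mult_less_cancel_right2 norm_ge_zero not_le order_le_less_trans mult_left_le_one_le less_imp_le)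
      ultimately have "dist (B (p + t *\<^sub>R v) u u) (B p u u) < \<eta>"
        using e(2)[of "(p, u)" "(p + t *\<^sub>R v, u)"] inK[of t] inK[of 0] t by (simp add: dist_Pair_Pair dist_norm)
      then have "(norm v)\<^sup>2 * \<bar>B (p + t *\<^sub>R v) u u - B p u u\<bar> \<le> (norm v)\<^sup>2 * \<eta>"
        by (intro mult_left_mono) (auto simp: dist_norm)
      then have "\<bar>B (p + t *\<^sub>R v) v v - B p v v\<bar> \<le> \<eta> * (norm v)\<^sup>2"
        using sc[of p] sc[of "p + t *\<^sub>R v"] inU[of t] inU[of 0] t
        by (simp add: abs_mult right_diff_distrib[symmetric] mult.commute[of \<eta>])
      moreover have "0 \<le> \<eta> * (norm v)\<^sup>2" using \<eta> by simp
      ultimately show ?thesis unfolding t(3) by linarith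
    qed
  qed (use e d in auto)
qed

section \<open>Calculus with explicit second derivatives\<close>

lemma C2_derivs_cong:
  assumes C: "C2_derivs U f D B" and "\<And>x. x \<in> U \<Longrightarrow> f' x = f x"
    "\<And>x v. x \<in> U \<Longrightarrow> D' x v = D x v" "\<And>x v w. x \<in> U \<Longrightarrow> B' x v w = B x v w"
  shows "C2_derivs U f' D' B'"
  unfolding C2_derivs_def
proof (intro conjI ballI allI)
  note d = C2_derivsD[OF C]
  show "open U" by (rule d(1))
  show "(f' has_derivative D' x) (at x)" if "x \<in> U" for x
  proof -
    have "D' x = D x" using assms that by auto
    then show ?thesis
      using has_derivative_transform_within_open[OF d(2)[OF that] d(1) that, of f'] assms(2) by simp
  qed
  show "((\<lambda>y. D' y v) has_derivative B' x v) (at x)" if "x \<in> U" for x v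
  proof -
    have "B' x v = B x v" using assms that by auto
    then show ?thesis
      using has_derivative_transform_within_open[OF d(3)[OF that] d(1) that, of v "\<lambda>y. D' y v"] assms(3) by simp
  qed
  show "continuous_on U (\<lambda>x. B' x v w)" for v w
    using d(4)[of v w] by (rule continuous_on_eq) (simp add: assms)
qed

lemma C2_derivs_const: "open U \<Longrightarrow> C2_derivs U (\<lambda>_. c) (\<lambda>_ _. 0) (\<lambda>_ _ _. 0)"
  by (simp add: C2_derivs_def)

lemma C2_derivs_add:
  assumes "C2_derivs U f D B" "C2_derivs U g E C"
  shows "C2_derivs U (\<lambda>x. f x + g x) (\<lambda>x v. D x v + E x v) (\<lambda>x v w. B x v w + C x v w)"
  using assms unfolding C2_derivs_def by (auto intro!: has_derivative_add continuous_on_add)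

lemma C2_derivs_sum:
  assumes "finite J" "open U" "\<And>j. j \<in> J \<Longrightarrow> C2_derivs U (f j) (D j) (B j)"
  shows "C2_derivs U (\<lambda>x. \<Sum>j\<in>J. f j x) (\<lambda>x v. \<Sum>j\<in>J. D j x v) (\<lambda>x v w. \<Sum>j\<in>J. B j x v w)"
  using assms(2,3) unfolding C2_derivs_def by (auto intro!: has_derivative_sum continuous_on_sum)

lemma C2_derivs_mult:
  assumes f: "C2_derivs U f D B" and g: "C2_derivs U g E C"
  shows "C2_derivs U (\<lambda>x. f x * g x) (\<lambda>x v. f x * E x v + D x v * g x)
    (\<lambda>x v w. f x * C x v w + D x w * E x v + (D x v * E x w + B x v w * g x))"
  unfolding C2_derivs_def
proof (intro conjI ballI allI)
  note df = C2_derivsD[OF f] and dg = C2_derivsD[OF g]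
  show "open U" by (rule df(1))
  fix v w
  show "continuous_on U (\<lambda>x. f x * C x v w + D x w * E x v + (D x v * E x w + B x v w * g x))"
    by (intro continuous_intros df dg C2_derivs_continuous0[OF f] C2_derivs_continuous0[OF g]
        C2_derivs_continuous1[OF f] C2_derivs_continuous1[OF g])
  fix x assume x: "x \<in> U"
  show "((\<lambda>x. f x * g x) has_derivative (\<lambda>v. f x * E x v + D x v * g x)) (at x)"
    by (rule has_derivative_mult[OF df(2) dg(2)]) (rule x)+
  show "((\<lambda>y. f y * E y v + D y v * g y) has_derivative
      (\<lambda>w. f x * C x v w + D x w * E x v + (D x v * E x w + B x v w * g x))) (at x)"
    by (intro has_derivative_add has_derivative_mult df dg x)
qed

lemma C2_derivs_cmult:
  assumes "C2_derivs U f D B"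
  shows "C2_derivs U (\<lambda>x. c * f x) (\<lambda>x v. c * D x v) (\<lambda>x v w. c * B x v w)"
  using C2_derivs_mult[OF C2_derivs_const[OF C2_derivsD(1)[OF assms], of c] assms] by simp

lemma C2_derivs_compose_real:
  assumes f: "C2_derivs U f D B" and sub: "f ` U \<subseteq> I" and I: "open I"
    and d1: "\<And>t. t \<in> I \<Longrightarrow> (\<psi> has_real_derivative \<psi>1 t) (at t)"
    and d2: "\<And>t. t \<in> I \<Longrightarrow> (\<psi>1 has_real_derivative \<psi>2 t) (at t)"
    and c2: "continuous_on I \<psi>2"
  shows "C2_derivs U (\<lambda>x. \<psi> (f x)) (\<lambda>x v. \<psi>1 (f x) * D x v)
    (\<lambda>x v w. \<psi>1 (f x) * B x v w + \<psi>2 (f x) * D x w * D x v)"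
  unfolding C2_derivs_def
proof (intro conjI ballI allI)
  note df = C2_derivsD[OF f]
  have c1: "continuous_on I \<psi>1"
    using d2 I by (meson DERIV_isCont continuous_at_imp_continuous_on)
  have cf: "continuous_on U f" by (rule C2_derivs_continuous0[OF f])
  show "open U" by (rule df(1))
  fix v w
  show "continuous_on U (\<lambda>x. \<psi>1 (f x) * B x v w + \<psi>2 (f x) * D x w * D x v)"
    by (intro continuous_intros df C2_derivs_continuous1[OF f]
        continuous_on_compose2[OF c1 cf sub] continuous_on_compose2[OF c2 cf sub])
  fix x assume x: "x \<in> U"
  then have t: "f x \<in> I" using sub by auto
  show "((\<lambda>x. \<psi> (f x)) has_derivative (\<lambda>v. \<psi>1 (f x) * D x v)) (at x)"
    using has_derivative_compose[OF df(2)[OF x] d1[OF t, unfolded has_field_derivative_def]] .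
  have "((\<lambda>x. \<psi>1 (f x)) has_derivative (\<lambda>v. \<psi>2 (f x) * D x v)) (at x)"
    using has_derivative_compose[OF df(2)[OF x] d2[OF t, unfolded has_field_derivative_def]] .
  from has_derivative_mult[OF this df(3)[OF x]]
  show "((\<lambda>y. \<psi>1 (f y) * D y v) has_derivative
      (\<lambda>w. \<psi>1 (f x) * B x v w + \<psi>2 (f x) * D x w * D x v)) (at x)" .
qed

lemma C2_derivs_compose_affine:
  fixes L :: "'a::euclidean_space \<Rightarrow> 'b::euclidean_space"
  assumes f: "C2_derivs U f D B" and L: "bounded_linear L"
  shows "C2_derivs {x. L x + a \<in> U} (\<lambda>x. f (L x + a)) (\<lambda>x v. D (L x + a) (L v))
    (\<lambda>x v w. B (L x + a) (L v) (L w))"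
  unfolding C2_derivs_def
proof (intro conjI ballI allI)
  note df = C2_derivsD[OF f]
  have cL: "continuous_on S (\<lambda>x. L x + a)" for S
    by (intro continuous_intros linear_continuous_on L)
  show "open {x. L x + a \<in> U}"
    using open_vimage[OF df(1) cL] by (simp add: vimage_def)
  fix v w
  show "continuous_on {x. L x + a \<in> U} (\<lambda>x. B (L x + a) (L v) (L w))"
    by (rule continuous_on_compose2[OF df(4) cL]) auto
  fix x assume x: "x \<in> {x. L x + a \<in> U}"
  have dL: "((\<lambda>x. L x + a) has_derivative L) (at x)"
    using bounded_linear_imp_has_derivative[OF L] by (auto intro!: derivative_eq_intros)
  show "((\<lambda>x. f (L x + a)) has_derivative (\<lambda>v. D (L x + a) (L v))) (at x)"
    by (rule has_derivative_compose[OF dL df(2)]) (use x in auto)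
  show "((\<lambda>y. D (L y + a) (L v)) has_derivative (\<lambda>w. B (L x + a) (L v) (L w))) (at x)"
    by (rule has_derivative_compose[OF dL df(3)]) (use x in auto)
qed

lemma C2_derivs_inner_self: "C2_derivs UNIV (\<lambda>x. x \<bullet> x) (\<lambda>x v. 2 * (x \<bullet> v)) (\<lambda>x v w. 2 * (w \<bullet> v))"
  unfolding C2_derivs_def
  by (auto intro!: derivative_eq_intros continuous_intros simp: inner_commute)

text \<open>\<open>V\<close> and the complement of \<open>S\<close> form an open cover, and on the
  latter the extension is zero. This makes cut-offs of local defining functions global.\<close>

lemma C2_derivs_extend_zero:
  assumes C: "C2_derivs V f D B" and S: "closed S" "S \<subseteq> V"
    and z: "\<And>x. x \<in> V - S \<Longrightarrow> f x = 0" "\<And>x v. x \<in> V - S \<Longrightarrow> D x v = 0"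
      "\<And>x v w. x \<in> V - S \<Longrightarrow> B x v w = 0"
  shows "C2_derivs UNIV (\<lambda>x. if x \<in> V then f x else 0) (\<lambda>x v. if x \<in> V then D x v else 0)
    (\<lambda>x v w. if x \<in> V then B x v w else 0)"
  unfolding C2_derivs_def
proof (intro conjI ballI allI)
  note d = C2_derivsD[OF C]
  have oS: "open (- S)" using S by auto
  have glue_deriv: "((\<lambda>y. if y \<in> V then h y else 0) has_derivative (\<lambda>v. if x \<in> V then h' v else 0)) (at x)"
    if h: "x \<in> V \<Longrightarrow> (h has_derivative h') (at x)" "\<And>y. y \<in> V - S \<Longrightarrow> h y = 0" for h h' and x
  proof (cases "x \<in> V")
    case True
    then show ?thesis
      using has_derivative_transform_within_open[OF h(1)[OF True] d(1) True, of "\<lambda>y. if y \<in> V then h y else 0"]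
      by simp
  next
    case False
    then have "((\<lambda>y. if y \<in> V then h y else 0) has_derivative (\<lambda>v. 0)) (at x)"
      using S h(2) by (intro has_derivative_transform_within_open[OF has_derivative_const[of 0] oS]) auto
    then show ?thesis using False by simp
  qed
  show "((\<lambda>x. if x \<in> V then f x else 0) has_derivative (\<lambda>v. if x \<in> V then D x v else 0)) (at x)" for x
    by (rule glue_deriv) (use d z in auto)
  show "((\<lambda>x. if x \<in> V then D x v else 0) has_derivative (\<lambda>w. if x \<in> V then B x v w else 0)) (at x)" for x v
    by (rule glue_deriv) (use d z in auto)
  fix v w
  have "continuous_on (V \<union> - S) (\<lambda>x. if x \<in> V then B x v w else 0)"
  proof (rule continuous_on_open_Un[OF d(1) oS])
    show "continuous_on V (\<lambda>x. if x \<in> V then B x v w else 0)"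
      using d(4) by (rule continuous_on_eq) auto
    have "continuous_on (-S) (\<lambda>x. 0 :: real)" by simp
    then show "continuous_on (-S) (\<lambda>x. if x \<in> V then B x v w else 0)"
      by (rule continuous_on_eq) (use z in auto)
  qed
  moreover have "V \<union> - S = UNIV" using S by auto
  ultimately show "continuous_on UNIV (\<lambda>x. if x \<in> V then B x v w else 0)" by simp
qed auto

section \<open>Polynomial cut-off functions\<close>

lemma has_real_derivative_pospart_power:
  assumes "k \<ge> 2"
  shows "((\<lambda>t::real. max 0 t ^ k) has_real_derivative real k * max 0 t ^ (k - 1)) (at t)"
proof -
  consider "t > 0" | "t < 0" | "t = 0" by linarith
  then show ?thesis
  proof cases
    case 1
    have "((\<lambda>t::real. t ^ k) has_real_derivative real k * t ^ (k - 1)) (at t)"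
      by (auto intro!: derivative_eq_intros)
    moreover have "\<forall>\<^sub>F x in nhds t. max 0 x ^ k = x ^ k"
      using eventually_nhds_in_open[of "{0<..}" t] 1
      by (auto elim!: eventually_mono simp: max_def)
    ultimately show ?thesis
      using 1 DERIV_cong_ev[OF refl _ refl, of "\<lambda>t. max 0 t ^ k" "\<lambda>t. t ^ k" t "real k * t ^ (k - 1)"]
      by (simp add: max_def)
  next
    case 2
    have "((\<lambda>t::real. 0) has_real_derivative 0) (at t)" by simp
    moreover have "\<forall>\<^sub>F x in nhds t. max 0 x ^ k = (0::real)"
      using eventually_nhds_in_open[of "{..<0}" t] 2 assms
      by (auto elim!: eventually_mono simp: max_def)
    ultimately show ?thesis
      using 2 assms DERIV_cong_ev[of t t "\<lambda>t. max 0 t ^ k" "\<lambda>t. 0" 0 0]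
      by (simp add: max_def power_0_left split: if_splits)
  next
    case 3
    have "((\<lambda>h. max 0 h ^ k / h) \<longlongrightarrow> 0) (at (0::real))"
    proof (rule Lim_null_comparison)
      have "max 0 h ^ k / h = max 0 h ^ (k - 1)" if "h \<noteq> 0" for h :: real
        using that assms by (cases k) (auto simp: max_def)
      then have "norm (max 0 h ^ k / h) \<le> max 0 h ^ (k - 1)" if "h \<noteq> 0" for h :: real
        using that by (metis abs_of_nonneg dual_order.refl max.cobounded1 real_norm_def zero_le_power)
      then show "\<forall>\<^sub>F h in at (0::real). norm (max 0 h ^ k / h) \<le> max 0 h ^ (k - 1)"
        unfolding eventually_at_filter by (intro always_eventually allI impI) blast
      have "((\<lambda>h. max 0 h ^ (k - 1)) \<longlongrightarrow> max 0 0 ^ (k - 1)) (at (0::real))"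
        by (intro tendsto_intros)
      moreover have "max 0 0 ^ (k - 1) = (0::real)" using assms by (simp add: power_0_left)
      ultimately show "((\<lambda>h. max 0 h ^ (k - 1)) \<longlongrightarrow> 0) (at (0::real))" by (simp only:)
    qed
    then show ?thesis
      using 3 assms by (simp add: has_field_derivative_iff power_0_left)
  qed
qed

text \<open>A truncated power serves as cut-off: it is of class C2 for \<open>k \<ge> 3\<close>, its
  derivatives are explicit polynomials on the ball, and the exponents 3 and 4 are tied together by
  \<open>bump_scale_derivative\<close>. It is not normalized to integral one; the constants absorb
  this.\<close>

definition bump :: "nat \<Rightarrow> 'a::euclidean_space \<Rightarrow> real"
  where "bump k x = max 0 (1 - x \<bullet> x) ^ k"

definition bump1 :: "nat \<Rightarrow> 'a::euclidean_space \<Rightarrow> 'a \<Rightarrow> real"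
  where "bump1 k x v = - 2 * real k * max 0 (1 - x \<bullet> x) ^ (k - 1) * (x \<bullet> v)"

definition bump2 :: "nat \<Rightarrow> 'a::euclidean_space \<Rightarrow> 'a \<Rightarrow> 'a \<Rightarrow> real"
  where "bump2 k x v w = 4 * real k * real (k - 1) * max 0 (1 - x \<bullet> x) ^ (k - 2) * (x \<bullet> v) * (x \<bullet> w)
     - 2 * real k * max 0 (1 - x \<bullet> x) ^ (k - 1) * (w \<bullet> v)"

lemma C2_derivs_bump:
  assumes "k \<ge> 3"
  shows "C2_derivs UNIV (bump k) (bump1 k) (bump2 k)"
proof -
  have 1: "C2_derivs UNIV (\<lambda>x::'a. 1 + (-1) * (x \<bullet> x)) (\<lambda>x v. 0 + (-1) * (2 * (x \<bullet> v)))
      (\<lambda>x v w. 0 + (-1) * (2 * (w \<bullet> v)))"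
    by (intro C2_derivs_add C2_derivs_const C2_derivs_cmult C2_derivs_inner_self open_UNIV)
  have k: "k - 1 - 1 = k - 2" by simp
  have "C2_derivs UNIV (\<lambda>x::'a. (\<lambda>t. max 0 t ^ k) (1 + (-1) * (x \<bullet> x)))
    (\<lambda>x v. real k * max 0 (1 + (-1) * (x \<bullet> x)) ^ (k - 1) * (0 + (-1) * (2 * (x \<bullet> v))))
    (\<lambda>x v w. real k * max 0 (1 + (-1) * (x \<bullet> x)) ^ (k - 1) * (0 + (-1) * (2 * (w \<bullet> v)))
      + real k * (real (k - 1) * max 0 (1 + (-1) * (x \<bullet> x)) ^ (k - 2)) * (0 + (-1) * (2 * (x \<bullet> w))) * (0 + (-1) * (2 * (x \<bullet> v))))"
  proof (rule C2_derivs_compose_real[OF 1, where I = UNIV])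
    show "((\<lambda>t. real k * max 0 t ^ (k - 1)) has_real_derivative real k * (real (k - 1) * max 0 t ^ (k - 2))) (at t)" for t
      using DERIV_cmult[OF has_real_derivative_pospart_power[of "k - 1" t], of "real k"] assms
      unfolding k by simp
    show "((\<lambda>t. max 0 t ^ k) has_real_derivative real k * max 0 t ^ (k - 1)) (at t)" for t
      by (rule has_real_derivative_pospart_power) (use assms in simp)
  qed (auto intro!: continuous_intros)
  then show ?thesis
    by (rule C2_derivs_cong) (auto simp: bump_def bump1_def bump2_def algebra_simps)
qed

lemma bump_bounds: "0 \<le> bump k x" "bump k x \<le> 1"
  by (auto simp: bump_def power_le_one)

lemma bump_eq_0: "norm x \<ge> 1 \<Longrightarrow> k \<ge> 1 \<Longrightarrow> bump k x = 0"
  and bump1_eq_0: "norm x \<ge> 1 \<Longrightarrow> k \<ge> 2 \<Longrightarrow> bump1 k x v = 0"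
  and bump2_eq_0: "norm x \<ge> 1 \<Longrightarrow> k \<ge> 3 \<Longrightarrow> bump2 k x v w = 0"
proof -
  assume "norm x \<ge> 1"
  then have "x \<bullet> x \<ge> 1" by (metis dot_square_norm one_le_power)
  then have m: "max 0 (1 - x \<bullet> x) = 0" by simp
  show "k \<ge> 1 \<Longrightarrow> bump k x = 0" "k \<ge> 2 \<Longrightarrow> bump1 k x v = 0" "k \<ge> 3 \<Longrightarrow> bump2 k x v w = 0"
    unfolding bump_def bump1_def bump2_def m by (auto simp: power_0_left)
qed

lemma bump_pos: "norm x < 1 \<Longrightarrow> bump k x > 0"
  by (auto simp: bump_def dot_square_norm abs_square_less_1)

subsection \<open>The Levi form and the smallest eigenvalue\<close>

text \<open>The Levi form in terms of the real second derivative \<open>b\<close>: it is its average over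
  \<open>X\<close> and \<open>\<i>X\<close>, up to the factor \<open>1/2\<close>.\<close>

definition levi_of :: "(complex^'n \<Rightarrow> complex^'n \<Rightarrow> real) \<Rightarrow> complex^'n \<Rightarrow> real"
  where "levi_of b X = (b X X + b (\<i> *s X) (\<i> *s X)) / 4"

lemma complex_vector_expansion:
  fixes X :: "complex^'n"
  shows "X = (\<Sum>j\<in>UNIV. Re (X $ j) *\<^sub>R axis j 1 + Im (X $ j) *\<^sub>R axis j \<i>)"
proof (rule vec_eq_iff[THEN iffD2], rule allI)
  fix i
  have "(\<Sum>j\<in>UNIV. Re (X $ j) *\<^sub>R axis j 1 + Im (X $ j) *\<^sub>R axis j \<i>) $ i
    = (\<Sum>j\<in>UNIV. if j = i then X $ i else 0)"
    unfolding sum_component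
    by (rule sum.cong) (auto simp: axis_def complex_eq_iff)
  then show "X $ i = (\<Sum>j\<in>UNIV. Re (X $ j) *\<^sub>R axis j 1 + Im (X $ j) *\<^sub>R axis j \<i>) $ i"
    by simp
qed

lemma linear_complex_vector_expansion:
  fixes l :: "complex^'n \<Rightarrow> real"
  assumes "linear l"
  shows "l X = (\<Sum>j\<in>UNIV. Re (X $ j) * l (axis j 1) + Im (X $ j) * l (axis j \<i>))"
  by (subst complex_vector_expansion[of X]) (simp add: linear_sum[OF assms] linear_add[OF assms] linear_scale[OF assms])

lemma C2_derivs_frechet_of_real:
  assumes "C2_derivs U f D B" "p \<in> U"
  shows "frechet_derivative (\<lambda>q. complex_of_real (f q)) (at p) v = of_real (D p v)"
proof -
  have "((\<lambda>q. complex_of_real (f q)) has_derivative (\<lambda>v. of_real (D p v))) (at p)"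
    by (rule has_derivative_of_real[OF C2_derivsD(2)[OF assms]])
  then show ?thesis by (metis frechet_derivative_at)
qed

lemma C2_derivs_del_pairing:
  fixes f :: "complex^'n \<Rightarrow> real"
  assumes C: "C2_derivs U f D B" and p: "p \<in> U"
  shows "del_pairing f p X = (of_real (D p X) - \<i> * of_real (D p (\<i> *s X))) / 2"
proof -
  have l: "linear (D p)" by (rule C2_derivs_linear1[OF assms])
  have "del_pairing f p X =
    (\<Sum>j\<in>UNIV. (of_real (D p (axis j 1)) - \<i> * of_real (D p (axis j \<i>))) / 2 * X $ j)"
    by (simp add: del_pairing_def d_z_def C2_derivs_frechet_of_real[OF assms])
  also have "\<dots> = (\<Sum>j\<in>UNIV. (of_real (Re (X $ j) * D p (axis j 1) + Im (X $ j) * D p (axis j \<i>))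
      - \<i> * of_real (Re ((\<i> *s X) $ j) * D p (axis j 1) + Im ((\<i> *s X) $ j) * D p (axis j \<i>))) / 2)"
    by (rule sum.cong) (auto simp: complex_eq_iff field_simps)
  also have "\<dots> = (of_real (D p X) - \<i> * of_real (D p (\<i> *s X))) / 2"
    unfolding linear_complex_vector_expansion[OF l, of X] linear_complex_vector_expansion[OF l, of "\<i> *s X"]
    by (simp only: sum_divide_distrib of_real_sum sum_distrib_left sum_subtractf diff_divide_distrib)
  finally show ?thesis .
qed

lemma C2_derivs_complex_hessian:
  fixes f :: "complex^'n \<Rightarrow> real"
  assumes C: "C2_derivs U f D B" and p: "p \<in> U"
  shows "complex_hessian f p $ j $ k =
    Complex (B p (axis k 1) (axis j 1) + B p (axis k \<i>) (axis j \<i>))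
            (B p (axis k \<i>) (axis j 1) - B p (axis k 1) (axis j \<i>)) / 4"
proof -
  have "((\<lambda>q. (complex_of_real (D q (axis k 1)) + \<i> * of_real (D q (axis k \<i>))) / 2) has_derivative
      (\<lambda>v. (of_real (B p (axis k 1) v) + \<i> * of_real (B p (axis k \<i>) v)) / 2)) (at p)"
    unfolding divide_inverse
    by (intro has_derivative_mult_left has_derivative_add has_derivative_mult_right has_derivative_of_real
        C2_derivsD(3)[OF assms])
  then have "(d_zbar k (\<lambda>q. complex_of_real (f q)) has_derivative
      (\<lambda>v. (of_real (B p (axis k 1) v) + \<i> * of_real (B p (axis k \<i>) v)) / 2)) (at p)"
    by (rule has_derivative_transform_within_open[OF _ C2_derivsD(1)[OF C] p])
      (simp add: d_zbar_def C2_derivs_frechet_of_real[OF C])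
  from frechet_derivative_at[OF this]
  have "frechet_derivative (d_zbar k (\<lambda>q. complex_of_real (f q))) (at p) =
      (\<lambda>v. (of_real (B p (axis k 1) v) + \<i> * of_real (B p (axis k \<i>) v)) / 2)" ..
  then show ?thesis
    by (simp add: complex_hessian_def d_z_def complex_eq_iff)
qed

lemma C2_derivs_levi_form:
  fixes f :: "complex^'n \<Rightarrow> real"
  assumes C: "C2_derivs U f D B" and p: "p \<in> U"
  shows "levi_form f p X = levi_of (B p) X"
proof -
  note l2 = C2_derivs_linear2[OF assms] and l3 = C2_derivs_linear3[OF assms]
  have ex: "B p Y Y = (\<Sum>j\<in>UNIV. \<Sum>k\<in>UNIV.
      Re (Y $ j) * Re (Y $ k) * B p (axis k 1) (axis j 1) + Re (Y $ j) * Im (Y $ k) * B p (axis k \<i>) (axis j 1)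
      + Im (Y $ j) * Re (Y $ k) * B p (axis k 1) (axis j \<i>) + Im (Y $ j) * Im (Y $ k) * B p (axis k \<i>) (axis j \<i>))" for Y
    by (subst linear_complex_vector_expansion[OF l2], subst (1 2) linear_complex_vector_expansion[OF l3])
      (simp add: sum_distrib_left algebra_simps sum.distrib)
  show ?thesis
    unfolding levi_form_def levi_of_def ex C2_derivs_complex_hessian[OF assms]
    by (simp add: sum.distrib[symmetric] sum_divide_distrib Re_sum, intro sum.cong refl)
      (simp add: field_simps)
qed

lemma C2_derivs_hessian_hermitian:
  fixes f :: "complex^'n \<Rightarrow> real"
  assumes "C2_derivs U f D B" "p \<in> U"
  shows "complex_hessian f p $ j $ k = cnj (complex_hessian f p $ k $ j)"
  unfolding C2_derivs_complex_hessian[OF assms]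
  using C2_derivs_symmetric[OF assms] by (simp add: complex_eq_iff)

section \<open>Rayleigh quotients of Hermitian matrices\<close>

lemma inner_matrix_vector_mult:
  fixes A :: "complex^'n^'n"
  shows "(A *v x) \<bullet> y = (\<Sum>i\<in>UNIV. \<Sum>j\<in>UNIV. Re (A $ i $ j * x $ j * cnj (y $ i)))"
proof -
  have c: "a \<bullet> b = Re (a * cnj b)" for a b :: complex by (simp add: inner_complex_def)
  show ?thesis
    by (simp only: inner_vec_def matrix_vector_mult_def vec_lambda_beta c sum_distrib_right Re_sum)
qed

text \<open>First variation: the form of \<open>T - m\<close> is nonnegative and vanishes at
  \<open>v\<close>, so along \<open>v + t y\<close> with \<open>y = T v - m v\<close> its linear
  term in \<open>t\<close>, which is \<open>2 t\<close> times \<open>y \<bullet> y\<close>, has to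
  vanish.\<close>

lemma symmetric_minimizer_eigenvector:
  fixes T :: "'a::euclidean_space \<Rightarrow> 'a"
  assumes T: "linear T" and sym: "\<And>x y. T x \<bullet> y = x \<bullet> T y"
    and ge: "\<And>x. m * (x \<bullet> x) \<le> T x \<bullet> x" and eq: "T v \<bullet> v = m * (v \<bullet> v)"
  shows "T v = m *\<^sub>R v"
proof -
  define y where "y = T v - m *\<^sub>R v"
  define c where "c = T y \<bullet> y - m * (y \<bullet> y)"
  have c: "c \<ge> 0" using ge[of y] by (simp add: c_def)
  have key: "0 \<le> 2 * t * (y \<bullet> y) + t\<^sup>2 * c" for t
  proof -
    have "0 \<le> T (v + t *\<^sub>R y) \<bullet> (v + t *\<^sub>R y) - m * ((v + t *\<^sub>R y) \<bullet> (v + t *\<^sub>R y))"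
      using ge[of "v + t *\<^sub>R y"] by simp
    also have "\<dots> = 2 * t * (T v \<bullet> y - m * (v \<bullet> y)) + t\<^sup>2 * c"
    proof -
      have "T y \<bullet> v = T v \<bullet> y" using sym[of y v] by (metis inner_commute)
      moreover have "y \<bullet> v = v \<bullet> y" by (rule inner_commute)
      ultimately
      have "T (v + t *\<^sub>R y) \<bullet> (v + t *\<^sub>R y) = T v \<bullet> v + 2 * t * (T v \<bullet> y) + t\<^sup>2 * (T y \<bullet> y)"
        "(v + t *\<^sub>R y) \<bullet> (v + t *\<^sub>R y) = v \<bullet> v + 2 * t * (v \<bullet> y) + t\<^sup>2 * (y \<bullet> y)"
        by (simp_all add: linear_add[OF T] linear_scale[OF T] inner_add_left inner_add_right
            power2_eq_square distrib_left)
      then show ?thesis unfolding c_def eq by (simp only:) (simp add: algebra_simps)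
    qed
    also have "T v \<bullet> y - m * (v \<bullet> y) = y \<bullet> y"
      by (simp only: y_def inner_diff_left inner_scaleR_left)
    finally show ?thesis .
  qed

  have "y \<bullet> y = 0"
  proof (rule ccontr)
    assume "y \<bullet> y \<noteq> 0"
    then have yy: "y \<bullet> y > 0" by simp
    \<comment> \<open>For this \<open>t\<close> the quadratic in \<open>key\<close> collapses to
      \<open>t * (y \<bullet> y) - t\<^sup>2\<close>, which is negative. The denominator is
      \<open>c + 1\<close> because \<open>c\<close> may be zero.\<close>
    define t where "t = - (y \<bullet> y) / (c + 1)"
    have t: "t * (c + 1) = - (y \<bullet> y)" "t < 0" using c yy by (simp_all add: t_def divide_neg_pos)
    have "2 * t * (y \<bullet> y) + t\<^sup>2 * c = 2 * t * (y \<bullet> y) + t * (t * (c + 1)) - t\<^sup>2"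
      by (simp add: algebra_simps power2_eq_square)
    also have "\<dots> = t * (y \<bullet> y) - t\<^sup>2" unfolding t(1) by simp
    also have "\<dots> < 0" using mult_neg_pos[OF t(2) yy] zero_le_power2[of t] by linarith
    finally show False using key[of t] by simp
  qed
  then show ?thesis by (simp add: y_def)
qed

text \<open>On the underlying real inner product space a Hermitian matrix is a symmetric operator.
  The minimum of its Rayleigh quotient on the unit sphere is attained at an eigenvector and bounds
  every real eigenvalue from below, so it is the value of the \<open>LEAST\<close> term.\<close>

lemma smallest_eigenvalue_ge_iff:
  fixes A :: "complex^'n^'n"
  assumes herm: "\<And>j k. A $ j $ k = cnj (A $ k $ j)"
  shows "M \<le> smallest_eigenvalue A \<longleftrightarrow> (\<forall>v. M * (v \<bullet> v) \<le> (A *v v) \<bullet> v)"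
proof -
  define T where "T = (\<lambda>v. A *v v)"
  have T: "linear T"
    by (rule linearI) (simp_all add: T_def vec_eq_iff matrix_vector_mult_def algebra_simps sum.distrib
        scaleR_sum_right)
  have sym: "T x \<bullet> y = x \<bullet> T y" for x y
  proof -
    have "T x \<bullet> y = (\<Sum>i\<in>UNIV. \<Sum>j\<in>UNIV. Re (A $ i $ j * x $ j * cnj (y $ i)))"
      by (simp only: T_def inner_matrix_vector_mult)
    also have "\<dots> = (\<Sum>j\<in>UNIV. \<Sum>i\<in>UNIV. Re (A $ i $ j * x $ j * cnj (y $ i)))" by (rule sum.swap)
    also have "\<dots> = (\<Sum>j\<in>UNIV. \<Sum>i\<in>UNIV. Re (A $ j $ i * y $ i * cnj (x $ j)))"
    proof (intro sum.cong refl)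
      fix i j
      show "Re (A $ i $ j * x $ j * cnj (y $ i)) = Re (A $ j $ i * y $ i * cnj (x $ j))"
        using herm[of j i] by (simp add: algebra_simps)
    qed
    also have "\<dots> = x \<bullet> T y"
      by (simp only: T_def inner_matrix_vector_mult inner_commute[of x])
    finally show ?thesis .
  qed
  have "continuous_on (sphere (0::complex^'n) 1) (\<lambda>v. T v \<bullet> v)"
    by (intro continuous_intros linear_continuous_on) (use T linear_conv_bounded_linear in blast)
  moreover have "sphere (0::complex^'n) 1 \<noteq> {}" by simp
  ultimately have "\<exists>v0\<in>sphere 0 1. \<forall>v\<in>sphere 0 1. T v0 \<bullet> v0 \<le> T v \<bullet> v"
    using continuous_attains_inf[OF compact_sphere] by blast
  then obtain v0 where v0: "norm v0 = 1" "\<And>v. norm v = 1 \<Longrightarrow> T v0 \<bullet> v0 \<le> T v \<bullet> v"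
    by auto
  define m where "m = T v0 \<bullet> v0"
  have ge: "m * (x \<bullet> x) \<le> T x \<bullet> x" for x
  proof (cases "x = 0")
    case False
    have "m \<le> T (x /\<^sub>R norm x) \<bullet> (x /\<^sub>R norm x)" unfolding m_def by (rule v0(2)) (use False in simp)
    also have "\<dots> = (T x \<bullet> x) / (x \<bullet> x)"
      by (simp add: linear_scale[OF T] dot_square_norm power2_eq_square divide_inverse)
    finally show ?thesis using False by (simp add: field_simps)
  qed (use T linear_0 in simp)
  have ev: "T v = complex_of_real c *s v \<longleftrightarrow> T v = c *\<^sub>R v" for v c
    by (simp add: vec_eq_iff scaleR_conv_of_real[where 'a = complex])
  have "v0 \<bullet> v0 = 1" using v0(1) by (simp add: dot_square_norm)
  then have "T v0 = m *\<^sub>R v0"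
    using symmetric_minimizer_eigenvector[OF T sym ge, of v0] by (simp add: m_def)
  moreover have "v0 \<noteq> 0" using v0(1) by auto
  ultimately have "smallest_eigenvalue A = m"
    unfolding smallest_eigenvalue_def
  proof (intro Least_equality)
    fix c assume "\<exists>v. v \<noteq> 0 \<and> A *v v = complex_of_real c *s v"
    then obtain v where v: "v \<noteq> 0" "T v = c *\<^sub>R v" using ev by (auto simp: T_def)
    then have "m * (v \<bullet> v) \<le> c * (v \<bullet> v)" using ge[of v] by simp
    then show "m \<le> c" using v(1) by simp
  qed (use ev in \<open>auto simp: T_def\<close>)
  moreover have "M \<le> m \<longleftrightarrow> (\<forall>v. M * (v \<bullet> v) \<le> T v \<bullet> v)"
  proof
    assume "M \<le> m"
    then show "\<forall>v. M * (v \<bullet> v) \<le> T v \<bullet> v"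
      using ge by (meson inner_ge_zero mult_right_mono order_trans)
  next
    assume "\<forall>v. M * (v \<bullet> v) \<le> T v \<bullet> v"
    then show "M \<le> m" using \<open>v0 \<bullet> v0 = 1\<close> unfolding m_def by (metis mult.right_neutral)
  qed
  ultimately show ?thesis by (simp add: T_def)
qed

lemma smallest_eigenvalue_hessian_ge_iff:
  fixes f :: "complex^'n \<Rightarrow> real"
  assumes "C2_derivs U f D B" "p \<in> U"
  shows "M \<le> smallest_eigenvalue (complex_hessian f p) \<longleftrightarrow> (\<forall>X. M * (norm X)\<^sup>2 \<le> levi_of (B p) X)"
proof -
  \<comment> \<open>The Levi form conjugates the factor of the second index, the quadratic form of
    \<open>*v\<close> that of the first. Conjugating the vector reconciles the two and keeps its
    norm.\<close>
  define cj where "cj = (\<lambda>X :: complex^'n. \<chi> i. cnj (X $ i))"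
  have cj: "cj (cj X) = X" for X by (simp add: cj_def vec_eq_iff)
  have nrm: "cj X \<bullet> cj X = (norm X)\<^sup>2" for X
    by (simp add: dot_square_norm[symmetric] inner_vec_def inner_complex_def cj_def)
  have q: "(complex_hessian f p *v cj X) \<bullet> cj X = levi_form f p X" for X
    unfolding levi_form_def inner_matrix_vector_mult Re_sum
    by (intro sum.cong refl arg_cong[where f = Re]) (simp add: cj_def ac_simps)
  have "M \<le> smallest_eigenvalue (complex_hessian f p) \<longleftrightarrow>
    (\<forall>v. M * (v \<bullet> v) \<le> (complex_hessian f p *v v) \<bullet> v)"
    by (rule smallest_eigenvalue_ge_iff) (rule C2_derivs_hessian_hermitian[OF assms])
  also have "\<dots> \<longleftrightarrow> (\<forall>X. M * (cj X \<bullet> cj X) \<le> (complex_hessian f p *v cj X) \<bullet> cj X)"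
    using cj by metis
  finally show ?thesis by (simp only: nrm q C2_derivs_levi_form[OF assms])
qed

subsection \<open>The discrete torsion problem\<close>

definition dirs :: "complex set" where "dirs = {1, -1, \<i>, -\<i>}"

text \<open>The centre is left out: \<open>(stencil h v x - 4 * v x) / h\<^sup>2\<close> is the
  five-point Laplacian, while the bare neighbour sum is the order-preserving operator that the
  Jacobi iteration and Barta's argument work with.\<close>

definition stencil :: "real \<Rightarrow> (complex \<Rightarrow> real) \<Rightarrow> complex \<Rightarrow> real"
  where "stencil h v x = (\<Sum>d\<in>dirs. v (x + of_real h * d))"

lemma finite_dirs [simp]: "finite dirs" by (simp add: dirs_def)

lemma sum_dirs: "(\<Sum>d\<in>dirs. f d) = f 1 + f (-1) + f \<i> + f (-\<i>)" for f :: "complex \<Rightarrow> 'a::real_vector"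
  by (simp add: dirs_def complex_eq_iff algebra_simps)

lemma sum_dirs_uminus: "(\<Sum>d\<in>dirs. f (- d)) = (\<Sum>d\<in>dirs. f d)" for f :: "complex \<Rightarrow> 'a::real_vector"
  by (simp add: sum_dirs)

lemma norm_dirs: "d \<in> dirs \<Longrightarrow> norm d = 1"
  by (auto simp: dirs_def)

lemma uminus_dirs: "d \<in> dirs \<Longrightarrow> - d \<in> dirs"
  by (auto simp: dirs_def)

lemma sum_translate:
  fixes f :: "'a::ab_group_add \<Rightarrow> real"
  assumes F: "finite F" and 1: "\<And>x. f x \<noteq> 0 \<Longrightarrow> x \<in> F" and 2: "\<And>x. f (x + c) \<noteq> 0 \<Longrightarrow> x \<in> F"
  shows "(\<Sum>x\<in>F. f (x + c)) = (\<Sum>x\<in>F. f x)"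
proof -
  have "(\<Sum>x\<in>F. f (x + c)) = (\<Sum>x\<in>{x. f (x + c) \<noteq> 0}. f (x + c))"
    by (rule sum.mono_neutral_right[OF F]) (use 2 in auto)
  also have "\<dots> = (\<Sum>x\<in>{x. f x \<noteq> 0}. f x)"
    by (rule sum.reindex_bij_witness[of _ "\<lambda>x. x - c" "\<lambda>x. x + c"]) auto
  also have "\<dots> = (\<Sum>x\<in>F. f x)"
    by (rule sum.mono_neutral_left[OF F]) (use 1 in auto)
  finally show ?thesis .
qed

text \<open>Reversal of every directed edge of the grid. As \<open>G\<close> lives on
  \<open>I \<times> I\<close>, edges leaving \<open>I\<close> do not contribute.\<close>

lemma edge_swap:
  fixes G :: "complex \<Rightarrow> complex \<Rightarrow> real"
  assumes I: "finite I" and G: "\<And>x y. G x y \<noteq> 0 \<Longrightarrow> x \<in> I \<and> y \<in> I"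
  shows "(\<Sum>x\<in>I. \<Sum>d\<in>dirs. G x (x + of_real h * d)) = (\<Sum>x\<in>I. \<Sum>d\<in>dirs. G (x + of_real h * d) x)"
proof -
  have "(\<Sum>x\<in>I. \<Sum>d\<in>dirs. G x (x + of_real h * d)) = (\<Sum>d\<in>dirs. \<Sum>x\<in>I. G x (x + of_real h * d))"
    by (rule sum.swap)
  also have "\<dots> = (\<Sum>d\<in>dirs. \<Sum>x\<in>I. G (x + of_real h * (- d)) x)"
  proof (rule sum.cong[OF refl])
    fix d
    show "(\<Sum>x\<in>I. G x (x + of_real h * d)) = (\<Sum>x\<in>I. G (x + of_real h * (- d)) x)"
      using sum_translate[OF I, of "\<lambda>x. G (x + of_real h * (- d)) x" "of_real h * d"] G by (simp, blast?)
  qed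
  also have "\<dots> = (\<Sum>d\<in>dirs. \<Sum>x\<in>I. G (x + of_real h * d) x)"
    by (rule sum_dirs_uminus)
  also have "\<dots> = (\<Sum>x\<in>I. \<Sum>d\<in>dirs. G (x + of_real h * d) x)" by (rule sum.swap)
  finally show ?thesis .
qed

text \<open>The neighbour sum is a symmetric operator; \<open>F\<close> contains the support of
  \<open>v\<close> and all its neighbours, so no boundary terms arise.\<close>

lemma stencil_summation_by_parts:
  assumes F: "finite F" and v: "\<And>x. v x \<noteq> 0 \<Longrightarrow> x \<in> F" "\<And>x d. d \<in> dirs \<Longrightarrow> v (x + of_real h * d) \<noteq> 0 \<Longrightarrow> x \<in> F"
  shows "(\<Sum>x\<in>F. stencil h q x * v x) = (\<Sum>x\<in>F. q x * stencil h v x)"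
proof -
  have "(\<Sum>x\<in>F. q x * stencil h v x) = (\<Sum>d\<in>dirs. \<Sum>x\<in>F. q x * v (x + of_real h * d))"
    unfolding stencil_def sum_distrib_left by (rule sum.swap)
  also have "\<dots> = (\<Sum>d\<in>dirs. \<Sum>x\<in>F. q (x + of_real h * (- d)) * v x)"
  proof (rule sum.cong[OF refl])
    fix d assume "d \<in> dirs"
    then show "(\<Sum>x\<in>F. q x * v (x + of_real h * d)) = (\<Sum>x\<in>F. q (x + of_real h * (- d)) * v x)"
      using sum_translate[OF F, of "\<lambda>x. q (x + of_real h * (- d)) * v x" "of_real h * d"] v by simp
  qed
  also have "\<dots> = (\<Sum>d\<in>dirs. \<Sum>x\<in>F. q (x + of_real h * d) * v x)"
    by (rule sum_dirs_uminus)
  also have "\<dots> = (\<Sum>x\<in>F. stencil h q x * v x)"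
    unfolding stencil_def sum_distrib_right by (rule sum.swap)
  finally show ?thesis by simp
qed

text \<open>The solution of the discrete torsion problem is the monotone limit of the Jacobi iteration,
  dominated by the paraboloid \<open>(R\<^sup>2 - \<bar>x\<bar>\<^sup>2) / 4\<close>.\<close>

lemma discrete_torsion:
  assumes h: "h > 0" and R: "\<And>x. x \<in> I \<Longrightarrow> norm x + h \<le> R"
  obtains v :: "complex \<Rightarrow> real" where "\<And>x. 0 \<le> v x" "\<And>x. x \<notin> I \<Longrightarrow> v x = 0"
    "\<And>x. x \<in> I \<Longrightarrow> stencil h v x = 4 * v x - h\<^sup>2" "\<And>x. v x \<le> R\<^sup>2"
proof -
  define w where "w = rec_nat (\<lambda>x::complex. 0::real) (\<lambda>_ v x. if x \<in> I then (stencil h v x + h\<^sup>2) / 4 else 0)"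
  have w0: "w 0 x = 0" and wS: "w (Suc n) x = (if x \<in> I then (stencil h (w n) x + h\<^sup>2) / 4 else 0)" for n x
    by (simp_all add: w_def)
  have nn: "0 \<le> w n x" for n x
    by (induction n arbitrary: x) (auto simp: w0 wS stencil_def intro!: add_nonneg_nonneg sum_nonneg)
  have mono: "w n x \<le> w (Suc n) x" for n x
  proof (induction n arbitrary: x)
    case 0
    then show ?case using nn[of "Suc 0"] by (simp add: w0)
  next
    case (Suc n)
    have "stencil h (w n) x \<le> stencil h (w (Suc n)) x"
      unfolding stencil_def by (intro sum_mono Suc)
    then show ?case by (subst (1 2) wS) auto
  qed
  \<comment> \<open>The five-point formula has no error on this quadratic, so \<open>b\<close>
    solves the discrete equation in the whole plane. The hypothesis \<open>R\<close> keeps it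
    nonnegative at the neighbours of \<open>I\<close>, where the iterates may be zero.\<close>
  define b where "b x = (R\<^sup>2 - (norm x)\<^sup>2) / 4" for x :: complex
  have sb: "stencil h b x = 4 * b x - h\<^sup>2" for x
    unfolding stencil_def sum_dirs b_def cmod_power2 by (simp add: field_simps power2_eq_square)
  have wb: "w n x \<le> b x" if "x \<in> I" for n x
    using that
  proof (induction n arbitrary: x)
    case 0
    have "(norm x)\<^sup>2 \<le> R\<^sup>2" using R[OF 0] h by (intro power_mono) auto
    then show ?case by (simp add: w0 b_def)
  next
    case (Suc n)
    have "w n (x + of_real h * d) \<le> b (x + of_real h * d)" if d: "d \<in> dirs" for d
    proof (cases "x + of_real h * d \<in> I")
      case False
      have "norm (x + of_real h * d) \<le> norm x + norm (of_real h * d)" by (rule norm_triangle_ineq)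
      also have "\<dots> \<le> R" using R[OF Suc.prems] h norm_dirs[OF d] by (simp add: norm_mult)
      finally have "(norm (x + of_real h * d))\<^sup>2 \<le> R\<^sup>2" by (intro power_mono) auto
      moreover have "w n (x + of_real h * d) = 0" using False by (cases n) (auto simp: w0 wS)
      ultimately show ?thesis by (simp add: b_def)
    qed (use Suc.IH in auto)
    then have "stencil h (w n) x \<le> stencil h b x"
      unfolding stencil_def by (rule sum_mono)
    then show ?case using Suc.prems by (simp add: wS sb)
  qed
  have wR: "w n x \<le> R\<^sup>2" for n x
  proof (cases "x \<in> I")
    case True
    have "b x \<le> R\<^sup>2" by (simp add: b_def field_simps)
    then show ?thesis using wb[OF True, of n] by linarith
  next
    case False
    then show ?thesis by (cases n) (auto simp: w0 wS)
  qed
  define v where "v x = lim (\<lambda>n. w n x)" for x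
  have lim: "(\<lambda>n. w n x) \<longlonglongrightarrow> v x" for x
  proof -
    have "incseq (\<lambda>n. w n x)" using mono by (rule incseq_SucI)
    then obtain L where "(\<lambda>n. w n x) \<longlonglongrightarrow> L"
      using wR incseq_convergent[of "\<lambda>n. w n x" "R\<^sup>2"] by blast
    then have "convergent (\<lambda>n. w n x)" by (rule convergentI)
    then show ?thesis by (simp add: v_def convergent_LIMSEQ_iff)
  qed
  show ?thesis
  proof (rule that)
    show "0 \<le> v x" for x by (rule LIMSEQ_le_const[OF lim]) (use nn in auto)
    show "v x \<le> R\<^sup>2" for x by (rule LIMSEQ_le_const2[OF lim]) (use wR in auto)
    show "v x = 0" if "x \<notin> I" for x
    proof -
      have "w n x = 0" for n using that by (cases n) (auto simp: w0 wS)
      then have "(\<lambda>n. 0) \<longlonglongrightarrow> v x" using lim[of x] by simp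
      then show ?thesis by (simp add: LIMSEQ_const_iff)
    qed
    show "stencil h v x = 4 * v x - h\<^sup>2" if "x \<in> I" for x
    proof -
      have "(\<lambda>n. w (Suc n) x) \<longlonglongrightarrow> (stencil h v x + h\<^sup>2) / 4"
        unfolding wS stencil_def using that by (simp) (intro tendsto_intros lim, simp)
      moreover have "(\<lambda>n. w (Suc n) x) \<longlonglongrightarrow> v x" using lim[of x] by (rule LIMSEQ_Suc)
      ultimately have "v x = (stencil h v x + h\<^sup>2) / 4" using LIMSEQ_unique by blast
      then show ?thesis by simp
    qed
  qed
qed

text \<open>Barta's trick: a positive supersolution \<open>u\<close> bounds the quadratic form from below, because
  \<open>f(x) f(y) \<le> (f(x)\<^sup>2 u(y) / u(x) + f(y)\<^sup>2 u(x) / u(y)) / 2\<close>.\<close>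

lemma discrete_spectral_gap:
  fixes f u :: "complex \<Rightarrow> real"
  assumes I: "finite I" and f: "\<And>x. x \<notin> I \<Longrightarrow> f x = 0"
    and u: "\<And>x. 0 \<le> u x" "\<And>x. x \<in> I \<Longrightarrow> 0 < u x" "\<And>x. x \<in> I \<Longrightarrow> stencil h u x \<le> (4 - \<kappa>) * u x"
  shows "(\<Sum>x\<in>I. f x * stencil h f x) \<le> (4 - \<kappa>) * (\<Sum>x\<in>I. (f x)\<^sup>2)"
proof -
  \<comment> \<open>Outside \<open>I\<close> the supersolution may vanish, so the quotient is cut
    off there. Since \<open>f\<close> vanishes off \<open>I\<close>, edges leaving \<open>I\<close>
    cost nothing on the left; since \<open>u\<close> is nonnegative, they may be added back on the
    right.\<close>
  define G where "G x y = (if x \<in> I \<and> y \<in> I then (f x)\<^sup>2 * u y / u x else 0)" for x y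
  have amgm: "f x * f y \<le> (G x y + G y x) / 2" for x y
  proof (cases "x \<in> I \<and> y \<in> I")
    case True
    then have p: "u x > 0" "u y > 0" using u by auto
    have "0 \<le> (f x * u y - f y * u x)\<^sup>2 / (2 * u x * u y)" using p by simp
    also have "\<dots> = (G x y + G y x) / 2 - f x * f y"
      using True p by (simp add: G_def field_simps power2_eq_square)
    finally show ?thesis by simp
  next
    case False
    then show ?thesis using f by (auto simp: G_def)
  qed
  have "(\<Sum>x\<in>I. f x * stencil h f x) = (\<Sum>x\<in>I. \<Sum>d\<in>dirs. f x * f (x + of_real h * d))"
    by (simp add: stencil_def sum_distrib_left)
  also have "\<dots> \<le> (\<Sum>x\<in>I. \<Sum>d\<in>dirs. (G x (x + of_real h * d) + G (x + of_real h * d) x) / 2)"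
    by (intro sum_mono amgm)
  also have "\<dots> = ((\<Sum>x\<in>I. \<Sum>d\<in>dirs. G x (x + of_real h * d)) + (\<Sum>x\<in>I. \<Sum>d\<in>dirs. G (x + of_real h * d) x)) / 2"
    by (simp add: sum.distrib sum_divide_distrib[symmetric])
  also have "\<dots> = (\<Sum>x\<in>I. \<Sum>d\<in>dirs. G x (x + of_real h * d))"
    using edge_swap[OF I, of G h] by (simp add: G_def split: if_splits)
  also have "\<dots> \<le> (\<Sum>x\<in>I. (4 - \<kappa>) * (f x)\<^sup>2)"
  proof (rule sum_mono)
    fix x assume x: "x \<in> I"
    have "(\<Sum>d\<in>dirs. G x (x + of_real h * d)) \<le> (\<Sum>d\<in>dirs. (f x)\<^sup>2 / u x * u (x + of_real h * d))"
      using u(1) by (intro sum_mono) (auto simp: G_def)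
    also have "\<dots> = (f x)\<^sup>2 / u x * stencil h u x" by (simp add: stencil_def sum_distrib_left)
    also have "\<dots> \<le> (f x)\<^sup>2 / u x * ((4 - \<kappa>) * u x)"
      using u x by (intro mult_left_mono) auto
    also have "\<dots> = (4 - \<kappa>) * (f x)\<^sup>2" using u(2)[OF x] by simp
    finally show "(\<Sum>d\<in>dirs. G x (x + of_real h * d)) \<le> (4 - \<kappa>) * (f x)\<^sup>2" .
  qed
  finally show ?thesis by (simp add: sum_distrib_left)
qed

text \<open>Agmon's estimate: the spectral gap is tested on \<open>\<psi> * v\<close>. The
  commutator \<open>J\<close> is at most \<open>\<kappa> * S\<close>, as each of the four directions
  costs at most \<open>\<kappa> / 4\<close>. Half of it enters, Young's inequality on the source
  term uses another quarter of \<open>\<kappa> * S\<close>, and a quarter is left.\<close>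

lemma discrete_weighted_bound:
  fixes v u \<psi> :: "complex \<Rightarrow> real"
  assumes I: "finite I" and v: "\<And>x. x \<notin> I \<Longrightarrow> v x = 0" "\<And>x. 0 \<le> v x"
    "\<And>x. x \<in> I \<Longrightarrow> stencil h v x = 4 * v x - h\<^sup>2"
    and u: "\<And>x. 0 \<le> u x" "\<And>x. x \<in> I \<Longrightarrow> 0 < u x" "\<And>x. x \<in> I \<Longrightarrow> stencil h u x \<le> (4 - \<kappa>) * u x"
    and \<psi>: "\<And>x d. d \<in> dirs \<Longrightarrow> (\<psi> (x + of_real h * d) - \<psi> x)\<^sup>2 \<le> \<kappa> / 4 * (\<psi> x)\<^sup>2"
    and \<kappa>: "\<kappa> > 0"
  shows "(\<Sum>x\<in>I. (\<psi> x)\<^sup>2 * (v x)\<^sup>2) \<le> 4 * h^4 / \<kappa>\<^sup>2 * (\<Sum>x\<in>I. (\<psi> x)\<^sup>2)"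
proof -
  define f where "f x = \<psi> x * v x" for x
  define S where "S = (\<Sum>x\<in>I. (f x)\<^sup>2)"
  let ?n = "\<lambda>x d. x + of_real h * d"
  have gap: "(\<Sum>x\<in>I. f x * stencil h f x) \<le> (4 - \<kappa>) * S"
    unfolding S_def by (rule discrete_spectral_gap[OF I _ u]) (simp add: f_def v)
  have vI: "v x * v y \<noteq> 0 \<Longrightarrow> x \<in> I \<and> y \<in> I" for x y using v(1) by auto
  have sw: "(\<Sum>x\<in>I. \<Sum>d\<in>dirs. v x * v (?n x d) * (\<psi> x)\<^sup>2) = (\<Sum>x\<in>I. \<Sum>d\<in>dirs. v (?n x d) * v x * (\<psi> (?n x d))\<^sup>2)"
    by (rule edge_swap[OF I, of "\<lambda>x y. v x * v y * (\<psi> x)\<^sup>2"]) (use vI in auto)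
  define J where "J = (\<Sum>x\<in>I. \<Sum>d\<in>dirs. v x * v (?n x d) * (\<psi> x - \<psi> (?n x d))\<^sup>2)"
  \<comment> \<open>Discrete IMS localization formula: moving the weight inside the quadratic form
    costs only squared differences of the weight, with no first-order term.\<close>
  have id: "(\<Sum>x\<in>I. \<Sum>d\<in>dirs. v x * v (?n x d) * (\<psi> x)\<^sup>2) - (\<Sum>x\<in>I. \<Sum>d\<in>dirs. f x * f (?n x d)) = J / 2"
  proof -
    have "J = (\<Sum>x\<in>I. \<Sum>d\<in>dirs. v x * v (?n x d) * (\<psi> x)\<^sup>2) + (\<Sum>x\<in>I. \<Sum>d\<in>dirs. v (?n x d) * v x * (\<psi> (?n x d))\<^sup>2)
        - 2 * (\<Sum>x\<in>I. \<Sum>d\<in>dirs. f x * f (?n x d))"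
      unfolding J_def f_def sum_distrib_left sum.distrib[symmetric] sum_subtractf[symmetric]
      by (intro sum.cong refl) (simp add: power2_eq_square algebra_simps)
    then show ?thesis using sw by simp
  qed
  have "(\<Sum>x\<in>I. \<Sum>d\<in>dirs. f x * f (?n x d)) = (\<Sum>x\<in>I. f x * stencil h f x)"
    by (simp add: stencil_def sum_distrib_left)
  moreover have "(\<Sum>x\<in>I. \<Sum>d\<in>dirs. v x * v (?n x d) * (\<psi> x)\<^sup>2) = 4 * S - h\<^sup>2 * (\<Sum>x\<in>I. (\<psi> x)\<^sup>2 * v x)"
  proof -
    have "(\<Sum>x\<in>I. \<Sum>d\<in>dirs. v x * v (?n x d) * (\<psi> x)\<^sup>2) = (\<Sum>x\<in>I. (\<psi> x)\<^sup>2 * v x * stencil h v x)"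
      unfolding stencil_def sum_distrib_left by (intro sum.cong refl) simp
    also have "\<dots> = (\<Sum>x\<in>I. 4 * (f x)\<^sup>2 - h\<^sup>2 * ((\<psi> x)\<^sup>2 * v x))"
      by (intro sum.cong refl) (simp add: v(3) f_def power2_eq_square algebra_simps)
    finally show ?thesis by (simp add: S_def sum_subtractf sum_distrib_left)
  qed
  ultimately have 1: "\<kappa> * S \<le> h\<^sup>2 * (\<Sum>x\<in>I. (\<psi> x)\<^sup>2 * v x) + J / 2"
    using gap id by (simp add: algebra_simps)
  have "J \<le> \<kappa> * S"
  proof -
    define G where "G x y = (v x)\<^sup>2 * (if x \<in> I \<and> y \<in> I then (\<psi> x - \<psi> y)\<^sup>2 else 0)" for x y
    have Gs: "(\<Sum>x\<in>I. \<Sum>d\<in>dirs. G x (?n x d)) = (\<Sum>x\<in>I. \<Sum>d\<in>dirs. G (?n x d) x)"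
      by (rule edge_swap[OF I]) (auto simp: G_def split: if_splits)
    have "v x * v y * (\<psi> x - \<psi> y)\<^sup>2 \<le> (G x y + G y x) / 2" for x y
    proof (cases "x \<in> I \<and> y \<in> I")
      case True
      have "0 \<le> (v x - v y)\<^sup>2 * (\<psi> x - \<psi> y)\<^sup>2 / 2" by simp
      also have "\<dots> = (G x y + G y x) / 2 - v x * v y * (\<psi> x - \<psi> y)\<^sup>2"
        using True by (simp add: G_def power2_eq_square field_simps)
      finally show ?thesis by simp
    next
      case False
      then show ?thesis using v(1) by (auto simp: G_def)
    qed
    then have "J \<le> (\<Sum>x\<in>I. \<Sum>d\<in>dirs. (G x (?n x d) + G (?n x d) x) / 2)"
      unfolding J_def by (intro sum_mono)
    also have "\<dots> = ((\<Sum>x\<in>I. \<Sum>d\<in>dirs. G x (?n x d)) + (\<Sum>x\<in>I. \<Sum>d\<in>dirs. G (?n x d) x)) / 2"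
      by (simp add: sum.distrib sum_divide_distrib[symmetric])
    also have "\<dots> = (\<Sum>x\<in>I. \<Sum>d\<in>dirs. G x (?n x d))" using Gs by simp
    also have "\<dots> \<le> (\<Sum>x\<in>I. \<Sum>d\<in>dirs. (v x)\<^sup>2 * (\<kappa> / 4 * (\<psi> x)\<^sup>2))"
      unfolding G_def using \<psi> \<kappa> by (intro sum_mono mult_left_mono) (auto simp: power2_commute)
    also have "\<dots> = \<kappa> * S"
      unfolding sum_dirs S_def sum_distrib_left f_def by (intro sum.cong refl) (simp add: power_mult_distrib field_simps)
    finally show ?thesis .
  qed
  moreover have "h\<^sup>2 * (\<Sum>x\<in>I. (\<psi> x)\<^sup>2 * v x) \<le> \<kappa> / 4 * S + h^4 / \<kappa> * (\<Sum>x\<in>I. (\<psi> x)\<^sup>2)"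
  proof -
    have "h\<^sup>2 * v x \<le> \<kappa> / 4 * (v x)\<^sup>2 + h^4 / \<kappa>" for x
    proof -
      have "0 \<le> (\<kappa> * v x / 2 - h\<^sup>2)\<^sup>2 / \<kappa>" using \<kappa> by simp
      also have "\<dots> = \<kappa> / 4 * (v x)\<^sup>2 + h^4 / \<kappa> - h\<^sup>2 * v x"
        using \<kappa> by (simp add: field_simps power2_eq_square power4_eq_xxxx)
      finally show ?thesis by simp
    qed
    then have "(\<psi> x)\<^sup>2 * (h\<^sup>2 * v x) \<le> (\<psi> x)\<^sup>2 * (\<kappa> / 4 * (v x)\<^sup>2 + h^4 / \<kappa>)" for x
      by (intro mult_left_mono) auto
    then have "(\<Sum>x\<in>I. (\<psi> x)\<^sup>2 * (h\<^sup>2 * v x)) \<le> (\<Sum>x\<in>I. (\<psi> x)\<^sup>2 * (\<kappa> / 4 * (v x)\<^sup>2 + h^4 / \<kappa>))"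
      by (intro sum_mono)
    moreover have "(\<Sum>x\<in>I. (\<psi> x)\<^sup>2 * (\<kappa> / 4 * (v x)\<^sup>2 + h^4 / \<kappa>)) = \<kappa> / 4 * S + h^4 / \<kappa> * (\<Sum>x\<in>I. (\<psi> x)\<^sup>2)"
      unfolding S_def sum_distrib_left f_def sum.distrib[symmetric]
      by (intro sum.cong refl) (simp add: power_mult_distrib algebra_simps)
    moreover have "(\<Sum>x\<in>I. (\<psi> x)\<^sup>2 * (h\<^sup>2 * v x)) = h\<^sup>2 * (\<Sum>x\<in>I. (\<psi> x)\<^sup>2 * v x)"
      unfolding sum_distrib_left by (intro sum.cong refl) simp
    ultimately show ?thesis by linarith
  qed
  ultimately have "\<kappa> / 4 * S \<le> h^4 / \<kappa> * (\<Sum>x\<in>I. (\<psi> x)\<^sup>2)" using 1 by (simp add: algebra_simps)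
  then have "4 / \<kappa> * (\<kappa> / 4 * S) \<le> 4 / \<kappa> * (h^4 / \<kappa> * (\<Sum>x\<in>I. (\<psi> x)\<^sup>2))"
    using \<kappa> by (intro mult_left_mono) auto
  then show ?thesis using \<kappa>
    by (simp add: S_def f_def power_mult_distrib[of "\<psi> _"] power2_eq_square[of \<kappa>] mult.assoc)
qed

subsection \<open>Sums over a square lattice\<close>

definition lattice :: "real \<Rightarrow> complex set"
  where "lattice h = range (\<lambda>(m::int, n::int). Complex (h * of_int m) (h * of_int n))"

lemma lattice_translate:
  assumes "x \<in> lattice h" "d \<in> dirs"
  shows "x + of_real h * d \<in> lattice h"
proof -
  obtain m n where x: "x = Complex (h * of_int m) (h * of_int n)"
    using assms(1) by (auto simp: lattice_def)
  have "x + of_real h * d = Complex (h * of_int (m + \<lfloor>Re d\<rfloor>)) (h * of_int (n + \<lfloor>Im d\<rfloor>))"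
    using assms(2) by (auto simp: x dirs_def complex_eq_iff algebra_simps)
  then show ?thesis unfolding lattice_def
    by (intro image_eqI[of _ _ "(m + \<lfloor>Re d\<rfloor>, n + \<lfloor>Im d\<rfloor>)"]) auto
qed

lemma finite_lattice_Int:
  assumes h: "h > 0" and W: "bounded W"
  shows "finite (lattice h \<inter> W)"
proof -
  obtain R where R: "\<And>x. x \<in> W \<Longrightarrow> norm x \<le> R" using W bounded_iff by blast
  define N where "N = \<lceil>R / h\<rceil>"
  have "lattice h \<inter> W \<subseteq> (\<lambda>(m::int, n::int). Complex (h * of_int m) (h * of_int n)) ` ({-N..N} \<times> {-N..N})"
  proof
    fix x assume x: "x \<in> lattice h \<inter> W"
    then obtain m n where mn: "x = Complex (h * of_int m) (h * of_int n)" by (auto simp: lattice_def)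
    have "\<bar>h * of_int m\<bar> \<le> R" "\<bar>h * of_int n\<bar> \<le> R"
      using R[of x] x abs_Re_le_cmod[of x] abs_Im_le_cmod[of x] by (auto simp: mn)
    then have "\<bar>of_int m\<bar> \<le> R / h" "\<bar>of_int n\<bar> \<le> R / h"
      using h by (auto simp: abs_mult field_simps)
    then have "\<bar>m\<bar> \<le> N" "\<bar>n\<bar> \<le> N"
      unfolding N_def by linarith+
    then show "x \<in> (\<lambda>(m::int, n::int). Complex (h * of_int m) (h * of_int n)) ` ({-N..N} \<times> {-N..N})"
      unfolding mn by (intro image_eqI[of _ _ "(m, n)"]) auto
  qed
  then show ?thesis using finite_subset by blast
qed

text \<open>On each side of \<open>t\<close> the integers have distances at least 0, 1, 2, ... from
  \<open>t\<close>, so each side is dominated by a geometric series of ratio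
  \<open>exp (- s)\<close>. For \<open>s \<le> 1\<close> one has
  \<open>1 - exp (- s) \<ge> s / 2\<close>, which gives \<open>2 / s\<close> per side.\<close>

lemma sum_exp_int_le:
  fixes s t :: real
  assumes P: "finite P" and s: "0 < s" "s \<le> 1"
  shows "(\<Sum>m\<in>P. exp (- s * \<bar>of_int m - t\<bar>)) \<le> 4 / s"
proof -
  define r where "r = exp (- s)"
  have r: "0 < r" "r < 1" using s by (auto simp: r_def)
  have "exp s \<ge> 1 + s" by (rule exp_ge_add_one_self)
  then have "r \<le> 1 / (1 + s)" using s by (simp add: r_def exp_minus field_simps)
  then have "1 - r \<ge> s / (1 + s)" using s by (simp add: field_simps)
  moreover have "s / (1 + s) \<ge> s / 2" using s by (intro divide_left_mono) auto
  ultimately have r2: "1 - r \<ge> s / 2" by linarith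
  have geo: "(\<Sum>m\<in>Q. exp (- s * \<bar>of_int m - t\<bar>)) \<le> 1 / (1 - r)"
    if Q: "finite Q" "inj_on j Q" "\<And>m. m \<in> Q \<Longrightarrow> real (j m) \<le> \<bar>of_int m - t\<bar>" for Q and j :: "int \<Rightarrow> nat"
  proof -
    have "(\<Sum>m\<in>Q. exp (- s * \<bar>of_int m - t\<bar>)) \<le> (\<Sum>m\<in>Q. r ^ j m)"
    proof (rule sum_mono)
      fix m assume "m \<in> Q"
      then have "exp (- s * \<bar>of_int m - t\<bar>) \<le> exp (- s * real (j m))"
        using Q(3) s by simp
      also have "\<dots> = r ^ j m" by (simp add: r_def exp_of_nat_mult[symmetric] mult.commute)
      finally show "exp (- s * \<bar>of_int m - t\<bar>) \<le> r ^ j m" .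
    qed
    also have "\<dots> = (\<Sum>i\<in>j ` Q. r ^ i)" by (simp add: sum.reindex Q(2))
    also have "\<dots> \<le> (\<Sum>i. r ^ i)"
      using r Q(1) by (intro sum_le_suminf summable_geometric) auto
    also have "\<dots> = 1 / (1 - r)" using r by (intro suminf_geometric) auto
    finally show ?thesis .
  qed
  have "(\<Sum>m\<in>P. exp (- s * \<bar>of_int m - t\<bar>))
     = (\<Sum>m\<in>{m\<in>P. of_int m \<ge> t}. exp (- s * \<bar>of_int m - t\<bar>)) + (\<Sum>m\<in>{m\<in>P. \<not> of_int m \<ge> t}. exp (- s * \<bar>of_int m - t\<bar>))"
    by (rule trans[OF sum.Int_Diff[OF P, of _ "{m. of_int m \<ge> t}"]])
      (simp only: Int_def set_diff_eq mem_Collect_eq)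
  also have "\<dots> \<le> 1 / (1 - r) + 1 / (1 - r)"
  proof (rule add_mono)
    show "(\<Sum>m\<in>{m\<in>P. of_int m \<ge> t}. exp (- s * \<bar>of_int m - t\<bar>)) \<le> 1 / (1 - r)"
    proof (rule geo[where j = "\<lambda>m. nat (m - \<lceil>t\<rceil>)"])
      fix m assume "m \<in> {m \<in> P. t \<le> of_int m}"
      then have "t \<le> of_int m" "\<lceil>t\<rceil> \<le> m" by (auto simp: ceiling_le)
      then show "real (nat (m - \<lceil>t\<rceil>)) \<le> \<bar>of_int m - t\<bar>" by simp
    next
      show "inj_on (\<lambda>m. nat (m - \<lceil>t\<rceil>)) {m \<in> P. t \<le> of_int m}"
      proof (rule inj_onI)
        fix x y assume "x \<in> {m \<in> P. t \<le> of_int m}" "y \<in> {m \<in> P. t \<le> of_int m}"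
          and eq: "nat (x - \<lceil>t\<rceil>) = nat (y - \<lceil>t\<rceil>)"
        then have "\<lceil>t\<rceil> \<le> x" "\<lceil>t\<rceil> \<le> y" by (auto intro: ceiling_le)
        then show "x = y" using eq by arith
      qed
    qed (use P in simp)
    show "(\<Sum>m\<in>{m\<in>P. \<not> of_int m \<ge> t}. exp (- s * \<bar>of_int m - t\<bar>)) \<le> 1 / (1 - r)"
    proof (rule geo[where j = "\<lambda>m. nat (\<lfloor>t\<rfloor> - m)"])
      fix m assume "m \<in> {m \<in> P. \<not> t \<le> of_int m}"
      then have "of_int m < t" "m \<le> \<lfloor>t\<rfloor>" by (auto simp: le_floor_iff)
      then show "real (nat (\<lfloor>t\<rfloor> - m)) \<le> \<bar>of_int m - t\<bar>" by simp
    next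
      show "inj_on (\<lambda>m. nat (\<lfloor>t\<rfloor> - m)) {m \<in> P. \<not> t \<le> of_int m}"
      proof (rule inj_onI)
        fix x y assume "x \<in> {m \<in> P. \<not> t \<le> of_int m}" "y \<in> {m \<in> P. \<not> t \<le> of_int m}"
          and eq: "nat (\<lfloor>t\<rfloor> - x) = nat (\<lfloor>t\<rfloor> - y)"
        then have "x \<le> \<lfloor>t\<rfloor>" "y \<le> \<lfloor>t\<rfloor>" by (auto simp: le_floor_iff)
        then show "x = y" using eq by arith
      qed
    qed (use P in simp)
  qed
  also have "\<dots> \<le> 4 / s"
  proof -
    have "1 / (1 - r) \<le> 1 / (s / 2)" using r2 s by (intro divide_left_mono) auto
    then have "1 / (1 - r) \<le> 2 / s" by simp
    then show ?thesis by linarith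
  qed
  finally show ?thesis .
qed

text \<open>The l1 distance in the exponent makes the sum factor into two one-dimensional ones.
  Squaring doubles the rate and the lattice rescales it by \<open>h\<close>, hence the rate
  \<open>2 * a * h\<close>; the factor in front then cancels \<open>h\<close>.\<close>

lemma lattice_exp_sum_le:
  assumes I: "finite I" "I \<subseteq> lattice h" and h: "h > 0" and a: "a > 0" "2 * a * h \<le> 1"
  shows "h\<^sup>2 * (\<Sum>x\<in>I. (exp (- a * (\<bar>Re x - Re c\<bar> + \<bar>Im x - Im c\<bar>)))\<^sup>2) \<le> 4 / a\<^sup>2"
proof -
  define s where "s = 2 * a * h"
  have s: "0 < s" "s \<le> 1" using h a by (auto simp: s_def)
  define fm where "fm x = \<lfloor>Re x / h\<rfloor>" for x :: complex
  define fn where "fn x = \<lfloor>Im x / h\<rfloor>" for x :: complex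
  have fmn: "Re x = h * of_int (fm x)" "Im x = h * of_int (fn x)" if "x \<in> I" for x
    using that I(2) h by (auto simp: lattice_def fm_def fn_def)
  define e where "e t m = exp (- s * \<bar>of_int m - t\<bar>)" for t :: real and m :: int
  have wt: "(exp (- a * (\<bar>Re x - Re c\<bar> + \<bar>Im x - Im c\<bar>)))\<^sup>2 = e (Re c / h) (fm x) * e (Im c / h) (fn x)"
    if "x \<in> I" for x
  proof -
    have "\<bar>h * of_int m - b\<bar> = h * \<bar>of_int m - b / h\<bar>" for m b
    proof -
      have "h * of_int m - b = h * (of_int m - b / h)" using h by (simp add: field_simps)
      then show ?thesis using h by (simp only: abs_mult abs_of_pos)
    qed
    then show ?thesis unfolding fmn[OF that] e_def s_def
      by (simp add: power2_eq_square exp_add[symmetric] algebra_simps)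
  qed
  have "(\<Sum>x\<in>I. (exp (- a * (\<bar>Re x - Re c\<bar> + \<bar>Im x - Im c\<bar>)))\<^sup>2) = (\<Sum>x\<in>I. e (Re c / h) (fm x) * e (Im c / h) (fn x))"
    by (intro sum.cong refl wt)
  also have "\<dots> = (\<Sum>(m, n)\<in>(\<lambda>x. (fm x, fn x)) ` I. e (Re c / h) m * e (Im c / h) n)"
    by (subst sum.reindex) (auto simp: inj_on_def complex_eq_iff fmn)
  also have "\<dots> \<le> (\<Sum>(m, n)\<in>fm ` I \<times> fn ` I. e (Re c / h) m * e (Im c / h) n)"
    using I(1) by (intro sum_mono2) (auto simp: e_def)
  also have "\<dots> = (\<Sum>m\<in>fm ` I. e (Re c / h) m) * (\<Sum>n\<in>fn ` I. e (Im c / h) n)"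
    by (simp add: sum_product sum.cartesian_product)
  also have "\<dots> \<le> (4 / s) * (4 / s)"
    unfolding e_def using I(1) s
    by (intro mult_mono sum_exp_int_le) (auto intro!: sum_nonneg)
  finally have "h\<^sup>2 * (\<Sum>x\<in>I. (exp (- a * (\<bar>Re x - Re c\<bar> + \<bar>Im x - Im c\<bar>)))\<^sup>2) \<le> h\<^sup>2 * (4 / s * (4 / s))"
    by (intro mult_left_mono) auto
  also have "\<dots> = 4 / a\<^sup>2" using h a by (simp add: s_def field_simps power2_eq_square)
  finally show ?thesis .
qed

lemma abs_Re_Im_le: "\<bar>Re z\<bar> + \<bar>Im z\<bar> \<le> 2 * norm z"
  using abs_Re_le_cmod[of z] abs_Im_le_cmod[of z] by linarith

text \<open>Counting through the exponential sum with rate \<open>1 / s\<close>: on the disc the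
  squared weight is at least \<open>exp (-4)\<close>, and \<open>4 * exp 4\<close> is at most
  \<open>4 * 81 = 324\<close>.\<close>

lemma lattice_card_le:
  assumes I: "finite I" "I \<subseteq> lattice h" "I \<subseteq> cball c s" and h: "h > 0" "2 * h \<le> s"
  shows "h\<^sup>2 * real (card I) \<le> 324 * s\<^sup>2"
proof -
  have s: "s > 0" using h by linarith
  have "exp (-4) \<le> (exp (- (1/s) * (\<bar>Re x - Re c\<bar> + \<bar>Im x - Im c\<bar>)))\<^sup>2" if "x \<in> I" for x
  proof -
    have "\<bar>Re x - Re c\<bar> + \<bar>Im x - Im c\<bar> \<le> 2 * s"
      using abs_Re_Im_le[of "x - c"] that I(3) by (auto simp: dist_norm norm_minus_commute)
    then have "- 4 \<le> 2 * (- (1/s) * (\<bar>Re x - Re c\<bar> + \<bar>Im x - Im c\<bar>))"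
      using s by (simp add: field_simps)
    then show ?thesis by (simp only: exp_double[symmetric] exp_le_cancel_iff)
  qed
  then have "(\<Sum>x\<in>I. exp (-4)) \<le> (\<Sum>x\<in>I. (exp (- (1/s) * (\<bar>Re x - Re c\<bar> + \<bar>Im x - Im c\<bar>)))\<^sup>2)"
    by (rule sum_mono)
  then have "h\<^sup>2 * (real (card I) * exp (-4)) \<le> h\<^sup>2 * (\<Sum>x\<in>I. (exp (- (1/s) * (\<bar>Re x - Re c\<bar> + \<bar>Im x - Im c\<bar>)))\<^sup>2)"
    by (intro mult_left_mono) auto
  also have "\<dots> \<le> 4 / (1/s)\<^sup>2"
    by (rule lattice_exp_sum_le) (use I h s in \<open>auto simp: field_simps\<close>)
  finally have "h\<^sup>2 * real (card I) * exp (-4) \<le> 4 * s\<^sup>2" by (simp add: power_one_over mult.assoc)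
  then have "h\<^sup>2 * real (card I) \<le> 4 * s\<^sup>2 * exp 4"
    by (simp add: exp_minus field_simps)
  also have "exp (4::real) \<le> 81"
  proof -
    have "exp (4::real) = exp 1 ^ 4" by (simp add: exp_of_nat_mult[symmetric])
    also have "\<dots> \<le> 3 ^ 4" using exp_le by (intro power_mono) auto
    finally show ?thesis by simp
  qed
  finally show ?thesis by (simp add: mult_left_mono)
qed

lemma card_int_interval_ge:
  assumes h: "h > 0" "h \<le> \<delta> / 4"
  shows "\<delta> / (4 * h) \<le> real (card {m::int. \<bar>h * of_int m - t\<bar> \<le> \<delta> / 4})" "finite {m::int. \<bar>h * of_int m - t\<bar> \<le> \<delta> / 4}"
proof -
  have eq: "{m::int. \<bar>h * of_int m - t\<bar> \<le> \<delta> / 4} = {\<lceil>(t - \<delta>/4) / h\<rceil> .. \<lfloor>(t + \<delta>/4) / h\<rfloor>}"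
  proof (intro set_eqI)
    fix m :: int
    have "\<bar>h * of_int m - t\<bar> \<le> \<delta> / 4 \<longleftrightarrow> (t - \<delta>/4) \<le> h * of_int m \<and> h * of_int m \<le> t + \<delta>/4"
      unfolding abs_le_iff by linarith
    also have "\<dots> \<longleftrightarrow> (t - \<delta>/4) / h \<le> of_int m \<and> of_int m \<le> (t + \<delta>/4) / h"
      using h by (simp add: pos_divide_le_eq pos_le_divide_eq mult.commute)
    finally show "m \<in> {m::int. \<bar>h * of_int m - t\<bar> \<le> \<delta> / 4} \<longleftrightarrow> m \<in> {\<lceil>(t - \<delta>/4) / h\<rceil> .. \<lfloor>(t + \<delta>/4) / h\<rfloor>}"
      by (simp add: ceiling_le_iff le_floor_iff)
  qed
  have "\<delta> / (4 * h) + 1 \<le> \<delta> / (2 * h)" using h by (simp add: field_simps)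
  moreover have "(t + \<delta>/4) / h - (t - \<delta>/4) / h = \<delta> / (2 * h)" using h by (simp add: field_simps)
  ultimately have "\<delta> / (4 * h) \<le> of_int (\<lfloor>(t + \<delta>/4) / h\<rfloor> - \<lceil>(t - \<delta>/4) / h\<rceil> + 1)"
    by (simp) linarith
  then show "\<delta> / (4 * h) \<le> real (card {m::int. \<bar>h * of_int m - t\<bar> \<le> \<delta> / 4})"
    unfolding eq by simp
  show "finite {m::int. \<bar>h * of_int m - t\<bar> \<le> \<delta> / 4}" unfolding eq by simp
qed

text \<open>The square of half side \<open>\<delta> / 4\<close> around \<open>c\<close> lies in the
  disc and contains at least \<open>\<delta> / (4 * h)\<close> lattice values in each
  coordinate.\<close>

lemma lattice_card_ge:
  assumes h: "h > 0" "h \<le> \<delta> / 4"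
  shows "\<delta>\<^sup>2 / 16 \<le> h\<^sup>2 * real (card (lattice h \<inter> cball c (\<delta> / 2)))"
proof -
  define P where "P t = {m::int. \<bar>h * of_int m - t\<bar> \<le> \<delta> / 4}" for t
  define F where "F = (\<lambda>(m::int, n::int). Complex (h * of_int m) (h * of_int n))"
  have inj: "inj F" using h by (auto simp: inj_def F_def)
  have "F ` (P (Re c) \<times> P (Im c)) \<subseteq> lattice h \<inter> cball c (\<delta> / 2)"
  proof
    fix x assume "x \<in> F ` (P (Re c) \<times> P (Im c))"
    then obtain m n where x: "x = F (m, n)" and mn: "m \<in> P (Re c)" "n \<in> P (Im c)" by auto
    have "norm (F (m, n) - c) \<le> \<bar>Re (F (m, n) - c)\<bar> + \<bar>Im (F (m, n) - c)\<bar>" by (rule cmod_le)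
    also have "\<dots> \<le> \<delta> / 2" using mn by (auto simp: P_def F_def)
    finally show "x \<in> lattice h \<inter> cball c (\<delta> / 2)"
      unfolding x by (auto simp: dist_norm norm_minus_commute lattice_def F_def)
  qed
  then have "card (F ` (P (Re c) \<times> P (Im c))) \<le> card (lattice h \<inter> cball c (\<delta> / 2))"
    by (intro card_mono finite_lattice_Int h) auto
  moreover have "card (F ` (P (Re c) \<times> P (Im c))) = card (P (Re c)) * card (P (Im c))"
    using inj by (simp add: card_image inj_on_subset card_cartesian_product)
  ultimately have "real (card (P (Re c))) * real (card (P (Im c))) \<le> real (card (lattice h \<inter> cball c (\<delta> / 2)))"
    by (metis of_nat_le_iff of_nat_mult)
  moreover have "\<delta> / (4 * h) * (\<delta> / (4 * h)) \<le> real (card (P (Re c))) * real (card (P (Im c)))"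
    unfolding P_def using h by (intro mult_mono card_int_interval_ge) auto
  ultimately have "h\<^sup>2 * (\<delta> / (4 * h) * (\<delta> / (4 * h))) \<le> h\<^sup>2 * real (card (lattice h \<inter> cball c (\<delta> / 2)))"
    by (intro mult_left_mono) auto
  moreover have "h\<^sup>2 * (\<delta> / (4 * h) * (\<delta> / (4 * h))) = \<delta>\<^sup>2 / 16" using h by (simp add: field_simps power2_eq_square)
  ultimately show ?thesis by (simp only:)
qed

lemma abs_exp_minus_one_le:
  fixes t :: real
  assumes "\<bar>t\<bar> \<le> 1/2"
  shows "\<bar>exp t - 1\<bar> \<le> 2 * \<bar>t\<bar>"
proof (cases "t \<ge> 0")
  case True
  then show ?thesis using exp_bound_lemma[of t] assms by (simp add: abs_if)
next
  case False
  then have "\<bar>exp t - 1\<bar> = 1 - exp t" "\<bar>t\<bar> = - t" by auto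
  then show ?thesis using exp_ge_add_one_self[of t] False by linarith
qed

text \<open>Young's inequality turns the weighted L2 bound into a bound on sums over a disc of
  radius \<open>1 / sqrt M\<close>. That is the length on which the weight stays comparable to one,
  and total weight times \<open>h\<^sup>2\<close> is of order \<open>1 / M\<close>, so the size of
  \<open>I\<close> does not enter.\<close>

lemma discrete_torsion_mean_bound:
  fixes v u :: "complex \<Rightarrow> real"
  assumes I: "finite I" "I \<subseteq> lattice h" and v: "\<And>x. x \<notin> I \<Longrightarrow> v x = 0" "\<And>x. 0 \<le> v x"
    "\<And>x. x \<in> I \<Longrightarrow> stencil h v x = 4 * v x - h\<^sup>2"
    and u: "\<And>x. 0 \<le> u x" "\<And>x. x \<in> I \<Longrightarrow> 0 < u x" "\<And>x. x \<in> I \<Longrightarrow> stencil h u x \<le> (4 - M * h\<^sup>2) * u x"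
    and M: "M > 0" and h: "h > 0" "sqrt M * h \<le> 1"
  shows "h\<^sup>2 * (\<Sum>y\<in>I \<inter> cball c (1 / sqrt M). v y) \<le> 480 / M\<^sup>2"
proof -
  define a where "a = sqrt M / 4"
  have sM: "sqrt M > 0" and sM2: "sqrt M * sqrt M = M" using M by auto
  have a: "a > 0" "2 * a * h \<le> 1" "a * h \<le> 1/2" using sM h by (auto simp: a_def mult.commute)
  define \<psi> where "\<psi> x = exp (- a * (\<bar>Re x - Re c\<bar> + \<bar>Im x - Im c\<bar>))" for x
  define N where "N = I \<inter> cball c (1 / sqrt M)"
  have fN: "finite N" and NI: "N \<subseteq> I" using I by (auto simp: N_def)
  have sum\<psi>: "h\<^sup>2 * (\<Sum>x\<in>I. (\<psi> x)\<^sup>2) \<le> 64 / M"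
  proof -
    have "h\<^sup>2 * (\<Sum>x\<in>I. (\<psi> x)\<^sup>2) \<le> 4 / a\<^sup>2"
      unfolding \<psi>_def by (rule lattice_exp_sum_le) (use I h a in auto)
    also have "\<dots> = 64 / M" using sM M by (simp add: a_def power_divide)
    finally show ?thesis .
  qed
  have "(\<psi> (x + of_real h * d) - \<psi> x)\<^sup>2 \<le> (M * h\<^sup>2) / 4 * (\<psi> x)\<^sup>2" if d: "d \<in> dirs" for x d
  proof -
    define t where "t = - a * (\<bar>Re (x + of_real h * d) - Re c\<bar> + \<bar>Im (x + of_real h * d) - Im c\<bar>)
       - (- a * (\<bar>Re x - Re c\<bar> + \<bar>Im x - Im c\<bar>))"
    have "t = - a * ((\<bar>Re (x + of_real h * d) - Re c\<bar> + \<bar>Im (x + of_real h * d) - Im c\<bar>) - (\<bar>Re x - Re c\<bar> + \<bar>Im x - Im c\<bar>))"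
      by (simp add: t_def algebra_simps)
    moreover have "\<bar>(\<bar>Re (x + of_real h * d) - Re c\<bar> + \<bar>Im (x + of_real h * d) - Im c\<bar>) - (\<bar>Re x - Re c\<bar> + \<bar>Im x - Im c\<bar>)\<bar> \<le> h"
      using d h by (auto simp: dirs_def)
    ultimately have t: "\<bar>t\<bar> \<le> a * h" using a h by (simp add: abs_mult mult_left_mono)
    have "\<psi> (x + of_real h * d) = \<psi> x * exp t"
      unfolding \<psi>_def t_def by (simp add: exp_add[symmetric] del: exp_add)
    then have "(\<psi> (x + of_real h * d) - \<psi> x)\<^sup>2 = (\<psi> x)\<^sup>2 * \<bar>exp t - 1\<bar>\<^sup>2"
      by (simp add: power2_eq_square algebra_simps)
    also have "\<dots> \<le> (\<psi> x)\<^sup>2 * (2 * (a * h))\<^sup>2"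
      using abs_exp_minus_one_le[of t] t a by (intro mult_left_mono power_mono) auto
    also have "(2 * (a * h))\<^sup>2 = (M * h\<^sup>2) / 4"
      using sM2 by (simp add: a_def power_mult_distrib power_divide)
    finally show ?thesis by (simp add: mult.commute)
  qed
  then have "(\<Sum>x\<in>I. (\<psi> x)\<^sup>2 * (v x)\<^sup>2) \<le> 4 * h^4 / (M * h\<^sup>2)\<^sup>2 * (\<Sum>x\<in>I. (\<psi> x)\<^sup>2)"
    using M h by (intro discrete_weighted_bound[OF I(1) v u]) auto
  also have "4 * h^4 / (M * h\<^sup>2)\<^sup>2 = 4 / M\<^sup>2" using h M by (simp add: power_mult_distrib)
  finally have "h\<^sup>2 * (\<Sum>x\<in>I. (\<psi> x)\<^sup>2 * (v x)\<^sup>2) \<le> h\<^sup>2 * (4 / M\<^sup>2 * (\<Sum>x\<in>I. (\<psi> x)\<^sup>2))"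
    by (intro mult_left_mono) auto
  also have "\<dots> = 4 / M\<^sup>2 * (h\<^sup>2 * (\<Sum>x\<in>I. (\<psi> x)\<^sup>2))" by simp
  also have "\<dots> \<le> 4 / M\<^sup>2 * (64 / M)" using M by (intro mult_left_mono sum\<psi>) auto
  finally have 1: "h\<^sup>2 * (\<Sum>x\<in>I. (\<psi> x)\<^sup>2 * (v x)\<^sup>2) \<le> 256 / M^3"
    by (simp add: power2_eq_square power3_eq_cube)
  \<comment> \<open>Within l1 distance \<open>2 / sqrt M\<close> of the centre the squared weight is
    at least \<open>exp (-1)\<close>, which is at least one third.\<close>
  have \<psi>N: "1 \<le> 3 * (\<psi> x)\<^sup>2" if "x \<in> N" for x
  proof -
    have "\<bar>Re x - Re c\<bar> + \<bar>Im x - Im c\<bar> \<le> 2 * (1 / sqrt M)"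
      using abs_Re_Im_le[of "x - c"] that by (auto simp: N_def dist_norm norm_minus_commute)
    then have "- 1 \<le> 2 * (- a * (\<bar>Re x - Re c\<bar> + \<bar>Im x - Im c\<bar>))"
      using sM by (simp add: a_def field_simps)
    then have "exp (-1) \<le> (\<psi> x)\<^sup>2" unfolding \<psi>_def by (simp only: exp_double[symmetric] exp_le_cancel_iff)
    moreover have "exp (-1) \<ge> (1/3 :: real)" using exp_le by (simp add: exp_minus field_simps)
    ultimately show ?thesis by linarith
  qed
  \<comment> \<open>The parameter \<open>M\<close> in Young's inequality balances the two sums,
    bounded by \<open>256 / M^3\<close> and \<open>64 / M\<close>. The result is
    \<open>3/2 * (256 + 64) = 480\<close> over \<open>M\<^sup>2\<close>.\<close>
  have "v x \<le> 3/2 * (M * ((\<psi> x)\<^sup>2 * (v x)\<^sup>2) + 1 / M * (\<psi> x)\<^sup>2)" if "x \<in> N" for x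
  proof -
    have "0 \<le> (M * v x - 1)\<^sup>2 / (2 * M)" using M by simp
    also have "\<dots> = 1/2 * (M * (v x)\<^sup>2 + 1 / M) - v x" using M by (simp add: field_simps power2_eq_square)
    finally have "v x \<le> 1 * (1/2 * (M * (v x)\<^sup>2 + 1 / M))" by simp
    also have "\<dots> \<le> 3 * (\<psi> x)\<^sup>2 * (1/2 * (M * (v x)\<^sup>2 + 1 / M))"
      using M by (intro mult_right_mono \<psi>N that) auto
    finally show ?thesis by (simp add: algebra_simps)
  qed
  then have "(\<Sum>x\<in>N. v x) \<le> (\<Sum>x\<in>N. 3/2 * (M * ((\<psi> x)\<^sup>2 * (v x)\<^sup>2) + 1 / M * (\<psi> x)\<^sup>2))"
    by (rule sum_mono)
  also have "\<dots> \<le> (\<Sum>x\<in>I. 3/2 * (M * ((\<psi> x)\<^sup>2 * (v x)\<^sup>2) + 1 / M * (\<psi> x)\<^sup>2))"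
    using I NI M by (intro sum_mono2) auto
  also have "\<dots> = 3/2 * (M * (\<Sum>x\<in>I. (\<psi> x)\<^sup>2 * (v x)\<^sup>2) + 1 / M * (\<Sum>x\<in>I. (\<psi> x)\<^sup>2))"
    by (simp only: sum_distrib_left[symmetric] sum.distrib)
  finally have "h\<^sup>2 * (\<Sum>x\<in>N. v x) \<le> h\<^sup>2 * (3/2 * (M * (\<Sum>x\<in>I. (\<psi> x)\<^sup>2 * (v x)\<^sup>2) + 1 / M * (\<Sum>x\<in>I. (\<psi> x)\<^sup>2)))"
    by (intro mult_left_mono) auto
  also have "\<dots> = 3/2 * (M * (h\<^sup>2 * (\<Sum>x\<in>I. (\<psi> x)\<^sup>2 * (v x)\<^sup>2)) + 1 / M * (h\<^sup>2 * (\<Sum>x\<in>I. (\<psi> x)\<^sup>2)))"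
    by (simp add: algebra_simps)
  also have "\<dots> \<le> 3/2 * (M * (256 / M^3) + 1 / M * (64 / M))"
    using M by (intro mult_left_mono add_mono 1 sum\<psi>) auto
  also have "\<dots> = 480 / M\<^sup>2" using M by (simp add: field_simps power2_eq_square power3_eq_cube)
  finally show ?thesis by (simp add: N_def)
qed

subsection \<open>From positive supersolutions to bounded subharmonic functions\<close>

definition lap :: "(complex \<Rightarrow> complex \<Rightarrow> real) \<Rightarrow> real"
  where "lap b = b 1 1 + b \<i> \<i>"

lemma C2_derivs_stencil_Taylor:
  assumes C: "C2_derivs U f D B" and K: "compact K" "K \<subseteq> U" and \<eta>: "\<eta> > 0"
  obtains \<delta> where "\<delta> > 0"
    "\<And>h x. 0 < h \<Longrightarrow> h < \<delta> \<Longrightarrow> x \<in> K \<Longrightarrow> \<bar>stencil h f x - 4 * f x - h\<^sup>2 * lap (B x)\<bar> \<le> \<eta> * h\<^sup>2"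
proof -
  have "\<eta>/4 > 0" using \<eta> by simp
  then obtain \<delta> where d: "\<delta> > 0" "\<And>p v. p \<in> K \<Longrightarrow> norm v < \<delta> \<Longrightarrow> p + v \<in> U"
    "\<And>p v. p \<in> K \<Longrightarrow> norm v < \<delta> \<Longrightarrow> \<bar>f (p + v) - f p - D p v - B p v v / 2\<bar> \<le> (\<eta>/4) * (norm v)\<^sup>2"
    by (rule C2_derivs_uniform_Taylor[OF C K]) (rule that)
  show ?thesis
  proof (rule that[OF d(1)])
    fix h x assume h: "0 < h" "h < \<delta>" and x: "x \<in> K"
    then have xU: "x \<in> U" using K by auto
    note l1 = C2_derivs_linear1[OF C xU] and l2 = C2_derivs_linear2[OF C xU] and l3 = C2_derivs_linear3[OF C xU]
    have sc: "D x (of_real h * d) = h * D x d" "B x (of_real h * d) (of_real h * d) = h\<^sup>2 * B x d d" for d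
      using linear_scale[OF l1, of h d] linear_scale[OF l2, of _ h d] linear_scale[OF l3, of h d]
      by (simp_all add: scaleR_conv_of_real power2_eq_square)
    have "stencil h f x - 4 * f x - h\<^sup>2 * lap (B x) =
      (\<Sum>d\<in>dirs. f (x + of_real h * d) - f x - D x (of_real h * d) - B x (of_real h * d) (of_real h * d) / 2)"
      unfolding sc stencil_def sum_dirs lap_def
      by (simp add: linear_neg[OF l1] linear_neg[OF l2] linear_neg[OF l3] algebra_simps)
    also have "\<bar>\<dots>\<bar> \<le> (\<Sum>d\<in>dirs. (\<eta>/4) * h\<^sup>2)"
    proof (rule order_trans[OF sum_abs sum_mono])
      fix d assume "d \<in> dirs"
      then have "norm (of_real h * d) = h" using h by (simp add: norm_mult norm_dirs)
      then show "\<bar>f (x + of_real h * d) - f x - D x (of_real h * d) - B x (of_real h * d) (of_real h * d) / 2\<bar> \<le> (\<eta>/4) * h\<^sup>2"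
        using d(3)[OF x, of "of_real h * d"] h by simp
    qed
    also have "\<dots> = \<eta> * h\<^sup>2" by (simp only: sum_dirs)
    finally show "\<bar>stencil h f x - 4 * f x - h\<^sup>2 * lap (B x)\<bar> \<le> \<eta> * h\<^sup>2" .
  qed
qed

text \<open>Consistency of the five-point formula, uniform over the whole plane. It is used for the
  exponents 3 and 4 and, after rescaling by \<open>s\<close>, with step
  \<open>h / s\<close>.\<close>

definition stencil_accuracy :: "nat \<Rightarrow> real \<Rightarrow> real \<Rightarrow> bool"
  where "stencil_accuracy k \<eta> h0 \<longleftrightarrow> (\<forall>h x. 0 < h \<longrightarrow> h \<le> h0 \<longrightarrow>
    \<bar>stencil h (bump k) x - 4 * bump k x - h\<^sup>2 * lap (bump2 k x)\<bar> \<le> \<eta> * h\<^sup>2)"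

text \<open>Beyond radius 2 and for steps at most 1 all terms vanish, so Taylor's formula is needed
  on a compact disc only.\<close>

lemma stencil_accuracy_exists:
  assumes k: "k \<ge> 3" and \<eta>: "\<eta> > 0"
  obtains h0 where "h0 > 0" "stencil_accuracy k \<eta> h0"
proof -
  obtain \<delta> where d: "\<delta> > 0" "\<And>h x. 0 < h \<Longrightarrow> h < \<delta> \<Longrightarrow> x \<in> cball 0 2 \<Longrightarrow>
     \<bar>stencil h (bump k) x - 4 * bump k x - h\<^sup>2 * lap (bump2 k x)\<bar> \<le> \<eta> * h\<^sup>2"
    using C2_derivs_stencil_Taylor[OF C2_derivs_bump[OF k] compact_cball subset_UNIV \<eta>, of 0 2] by blast
  have "\<bar>stencil h (bump k) x - 4 * bump k x - h\<^sup>2 * lap (bump2 k x)\<bar> \<le> \<eta> * h\<^sup>2"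
    if h: "0 < h" "h \<le> min (\<delta>/2) 1" for h x
  proof (cases "norm x \<le> 2")
    case True
    then show ?thesis using d h by auto
  next
    case False
    have "norm (x + of_real h * e) \<ge> 1" if "e \<in> dirs" for e
    proof -
      have "norm x \<le> norm (x + of_real h * e) + norm (of_real h * e)"
        using norm_triangle_ineq4[of "x + of_real h * e" "of_real h * e"] by simp
      then show ?thesis using False h norm_dirs[OF that] by (simp add: norm_mult)
    qed
    then have "stencil h (bump k) x = 0" using k by (simp add: stencil_def bump_eq_0)
    then show ?thesis using False k \<eta> by (simp add: bump_eq_0 bump2_eq_0 lap_def)
  qed
  then show ?thesis using d that[of "min (\<delta>/2) 1"] by (auto simp: stencil_accuracy_def)
qed

lemma stencil_scaled:
  assumes "s \<noteq> 0"
  shows "stencil h (\<lambda>y. f ((x - y) /\<^sub>R s)) y = stencil (h / s) f ((x - y) /\<^sub>R s)"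
proof -
  have "stencil h (\<lambda>y. f ((x - y) /\<^sub>R s)) y = (\<Sum>d\<in>dirs. f ((x - y) /\<^sub>R s + of_real (h / s) * (- d)))"
    unfolding stencil_def
    by (intro sum.cong refl arg_cong[where f = f]) (simp add: scaleR_conv_of_real algebra_simps divide_inverse)
  also have "\<dots> = stencil (h / s) f ((x - y) /\<^sub>R s)"
    unfolding stencil_def by (rule sum_dirs_uminus)
  finally show ?thesis .
qed

text \<open>Summation by parts moves the Laplacian from the mollifier to \<open>v\<close>, whose
  discrete Laplacian is known. \<open>F\<close> also contains the neighbours of \<open>I\<close>,
  where the discrete Laplacian of the extension by zero need not vanish. The consistency error is
  weighted by the mass of \<open>v\<close>.\<close>

lemma mollified_laplacian:
  assumes acc: "stencil_accuracy k \<eta> h0" and s: "s > 0" and h: "h > 0" "h \<le> h0 * s"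
    and F: "finite F" "I \<subseteq> F" "\<And>x d. x \<in> I \<Longrightarrow> d \<in> dirs \<Longrightarrow> x + of_real h * d \<in> F"
    and v: "\<And>x. x \<notin> I \<Longrightarrow> v x = 0" "\<And>x. 0 \<le> v x"
  shows "\<bar>h\<^sup>2 * (\<Sum>y\<in>I. lap (bump2 k ((x - y) /\<^sub>R s)) * v y)
     - s\<^sup>2 * (\<Sum>y\<in>F. bump k ((x - y) /\<^sub>R s) * (stencil h v y - 4 * v y))\<bar> \<le> \<eta> * (h\<^sup>2 * (\<Sum>y\<in>I. v y))"
proof -
  define q where "q y = bump k ((x - y) /\<^sub>R s)" for y
  have *: "\<bar>stencil h q y - 4 * q y - (h / s)\<^sup>2 * lap (bump2 k ((x - y) /\<^sub>R s))\<bar> \<le> \<eta> * (h / s)\<^sup>2" for y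
  proof -
    have "0 < h / s" "h / s \<le> h0" using s h by (simp_all add: pos_divide_le_eq)
    then show ?thesis
      using acc unfolding q_def stencil_scaled[OF less_imp_neq[OF s, symmetric]] stencil_accuracy_def
      by blast
  qed
  have err: "\<bar>h\<^sup>2 * lap (bump2 k ((x - y) /\<^sub>R s)) - s\<^sup>2 * (stencil h q y - 4 * q y)\<bar> \<le> \<eta> * h\<^sup>2" for y
  proof -
    have "s\<^sup>2 * \<bar>stencil h q y - 4 * q y - (h / s)\<^sup>2 * lap (bump2 k ((x - y) /\<^sub>R s))\<bar> \<le> s\<^sup>2 * (\<eta> * (h / s)\<^sup>2)"
      by (intro mult_left_mono *) auto
    moreover have "s\<^sup>2 * \<bar>stencil h q y - 4 * q y - (h / s)\<^sup>2 * lap (bump2 k ((x - y) /\<^sub>R s))\<bar>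
        = \<bar>h\<^sup>2 * lap (bump2 k ((x - y) /\<^sub>R s)) - s\<^sup>2 * (stencil h q y - 4 * q y)\<bar>"
    proof -
      have "s\<^sup>2 * \<bar>stencil h q y - 4 * q y - (h / s)\<^sup>2 * lap (bump2 k ((x - y) /\<^sub>R s))\<bar>
         = \<bar>s\<^sup>2 * (stencil h q y - 4 * q y - (h / s)\<^sup>2 * lap (bump2 k ((x - y) /\<^sub>R s)))\<bar>"
        by (simp add: abs_mult)
      also have "s\<^sup>2 * (stencil h q y - 4 * q y - (h / s)\<^sup>2 * lap (bump2 k ((x - y) /\<^sub>R s)))
         = - (h\<^sup>2 * lap (bump2 k ((x - y) /\<^sub>R s)) - s\<^sup>2 * (stencil h q y - 4 * q y))"
        using s by (simp add: field_simps)
      finally show ?thesis by (simp only: abs_minus_cancel)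
    qed
    moreover have "s\<^sup>2 * (\<eta> * (h / s)\<^sup>2) = \<eta> * h\<^sup>2" using s by (simp add: field_simps)
    ultimately show ?thesis by simp
  qed
  have vF: "(\<Sum>y\<in>F. g y * v y) = (\<Sum>y\<in>I. g y * v y)" for g
    using F v by (intro sum.mono_neutral_right) auto
  have parts: "(\<Sum>y\<in>F. q y * (stencil h v y - 4 * v y)) = (\<Sum>y\<in>I. (stencil h q y - 4 * q y) * v y)"
  proof -
    have "(\<Sum>y\<in>F. stencil h q y * v y) = (\<Sum>y\<in>F. q y * stencil h v y)"
    proof (rule stencil_summation_by_parts[OF F(1)])
      fix y show "v y \<noteq> 0 \<Longrightarrow> y \<in> F" using v F by auto
      fix d assume d: "d \<in> dirs" "v (y + of_real h * d) \<noteq> 0"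
      then have "y + of_real h * d \<in> I" using v by auto
      from F(3)[OF this uminus_dirs[OF d(1)]] show "y \<in> F" by simp
    qed
    then have "(\<Sum>y\<in>F. q y * (stencil h v y - 4 * v y)) = (\<Sum>y\<in>F. (stencil h q y - 4 * q y) * v y)"
      by (simp add: algebra_simps sum_subtractf sum_distrib_left[symmetric])
    then show ?thesis by (simp only: vF)
  qed
  have "\<bar>h\<^sup>2 * (\<Sum>y\<in>I. lap (bump2 k ((x - y) /\<^sub>R s)) * v y) - s\<^sup>2 * (\<Sum>y\<in>F. q y * (stencil h v y - 4 * v y))\<bar>
    = \<bar>\<Sum>y\<in>I. (h\<^sup>2 * lap (bump2 k ((x - y) /\<^sub>R s)) - s\<^sup>2 * (stencil h q y - 4 * q y)) * v y\<bar>"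
    unfolding parts sum_distrib_left sum_subtractf[symmetric] by (simp add: algebra_simps)
  also have "\<dots> \<le> (\<Sum>y\<in>I. \<eta> * h\<^sup>2 * v y)"
    by (intro order_trans[OF sum_abs] sum_mono)
      (simp only: abs_mult, intro mult_mono err order_trans[OF abs_ge_zero err], use v in auto)
  finally show ?thesis by (simp add: q_def sum_distrib_left mult.assoc)
qed

lemma lap_bump2: "lap (bump2 k x) = 4 * real k * real (k - 1) * max 0 (1 - x \<bullet> x) ^ (k - 2) * (x \<bullet> x)
   - 4 * real k * max 0 (1 - x \<bullet> x) ^ (k - 1)"
  by (simp add: lap_def bump2_def inner_complex_def algebra_simps power2_eq_square)

text \<open>\<open>\<partial>/\<partial>s\<close> of the mollifier \<open>s\<^sup>-\<^sup>2 bump 3 (w/s)\<close> is the Laplacian of a nonnegative function of \<open>w\<close>, so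
  mollifications of almost subharmonic functions almost increase with the scale.\<close>

lemma bump_scale_derivative:
  fixes w :: complex
  assumes s: "s > 0"
  shows "((\<lambda>s. bump 3 (w /\<^sub>R s) / s\<^sup>2) has_real_derivative lap (bump2 4 (w /\<^sub>R s)) / (8 * s^3)) (at s)"
proof -
  define a where "a = w \<bullet> w"
  have i: "(w /\<^sub>R t) \<bullet> (w /\<^sub>R t) = a / t\<^sup>2" for t :: real
    by (simp add: a_def power2_eq_square divide_inverse)
  have d1: "((\<lambda>t. 1 - a / t\<^sup>2) has_real_derivative 2 * a / s^3) (at s)"
    using s by (auto intro!: derivative_eq_intros simp: field_simps power2_eq_square power3_eq_cube)
  have "((\<lambda>t. max 0 (1 - a / t\<^sup>2) ^ 3) has_real_derivative (3 * max 0 (1 - a / s\<^sup>2) ^ 2) * (2 * a / s^3)) (at s)"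
    using DERIV_chain2[OF has_real_derivative_pospart_power[of 3 "1 - a / s\<^sup>2"] d1] by simp
  then have "((\<lambda>t. max 0 (1 - a / t\<^sup>2) ^ 3 / t\<^sup>2) has_real_derivative
     ((3 * max 0 (1 - a / s\<^sup>2) ^ 2) * (2 * a / s^3) * s\<^sup>2 - max 0 (1 - a / s\<^sup>2) ^ 3 * (2 * s)) / (s\<^sup>2 * s\<^sup>2)) (at s)"
    using s by (intro DERIV_divide) (auto intro!: derivative_eq_intros)
  moreover have "((3 * max 0 (1 - a / s\<^sup>2) ^ 2) * (2 * a / s^3) * s\<^sup>2 - max 0 (1 - a / s\<^sup>2) ^ 3 * (2 * s)) / (s\<^sup>2 * s\<^sup>2)
     = lap (bump2 4 (w /\<^sub>R s)) / (8 * s^3)"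
    using s unfolding lap_bump2 i
    by (simp add: field_simps eval_nat_numeral)
  ultimately show ?thesis by (simp only: bump_def i)
qed

lemma norm_diff_divideR:
  fixes x y :: "'a::real_normed_vector"
  shows "s > 0 \<Longrightarrow> norm ((x - y) /\<^sub>R s) = dist x y / s"
  by (simp only: norm_scaleR dist_norm) (simp add: divide_inverse mult.commute)

text \<open>\<open>lam\<close> is one minus \<open>M / 522\<close> times the mollification at scale
  \<open>\<delta>\<close> of the discrete torsion function. At scale \<open>1 / sqrt M\<close> the
  mollification is bounded by \<open>discrete_torsion_mean_bound\<close>; the scale derivative of
  the mollifier carries the bound down to \<open>\<delta>\<close>, which has to be so small that the
  \<open>\<delta>\<close>-discs around \<open>K\<close> stay in \<open>W\<close>.\<close>

theorem laplacian_from_supersolutions: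
  fixes K :: "complex set"
  assumes K: "compact K"
    and H: "\<And>M. M > 0 \<Longrightarrow> \<exists>W u h0. compact W \<and> K \<subseteq> interior W \<and> h0 > 0 \<and> (\<forall>x. 0 \<le> u x) \<and>
       (\<forall>x\<in>W. 0 < u x) \<and> (\<forall>h x. 0 < h \<and> h < h0 \<and> x \<in> W \<longrightarrow> stencil h u x \<le> (4 - M * h\<^sup>2) * u x)"
    and N: "N > 0"
  obtains lam D B where "C2_derivs UNIV lam D B" "\<And>x. 0 \<le> lam x" "\<And>x. lam x \<le> 1"
    "\<And>x. x \<in> K \<Longrightarrow> N \<le> lap (B x)"
proof -
  \<comment> \<open>The mollification is at most \<open>522 / M\<close> and its Laplacian on
    \<open>K\<close> at most \<open>- 1/128\<close>; the normalization to the range from 0 to 1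
    multiplies the latter by \<open>- M / 522\<close>, which leaves \<open>N\<close>.\<close>
  define M where "M = 522 * 128 * N"
  have M: "M > 0" using N by (simp add: M_def)
  from H[OF M] obtain W u h0 where Wu: "compact W \<and> K \<subseteq> interior W \<and> h0 > 0 \<and> (\<forall>x. 0 \<le> u x) \<and>
       (\<forall>x\<in>W. 0 < u x) \<and> (\<forall>h x. 0 < h \<and> h < h0 \<and> x \<in> W \<longrightarrow> stencil h u x \<le> (4 - M * h\<^sup>2) * u x)"
    by (elim exE)
  then have W: "compact W" "K \<subseteq> interior W" and h0: "h0 > 0" and u: "\<And>x. 0 \<le> u x" "\<And>x. x \<in> W \<Longrightarrow> 0 < u x"
    and su: "\<And>h x. 0 < h \<Longrightarrow> h < h0 \<Longrightarrow> x \<in> W \<Longrightarrow> stencil h u x \<le> (4 - M * h\<^sup>2) * u x"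
    by (blast, blast, blast, blast, blast, blast)
  obtain d where d: "d > 0" "\<And>x y. x \<in> K \<Longrightarrow> norm y \<le> d \<Longrightarrow> x + y \<in> interior W"
    by (rule compact_thickening_subset_open[OF K open_interior W(2)]) (rule that)
  define r where "r = 1 / sqrt M"
  have r: "r > 0" "r\<^sup>2 = 1 / M" using M by (auto simp: r_def power_divide)
  define \<delta> where "\<delta> = min d (r / 2)"
  have \<delta>: "\<delta> > 0" "\<delta> \<le> d" "\<delta> < r" using d r by (auto simp: \<delta>_def)
  have KW: "cball x \<delta> \<subseteq> W" if "x \<in> K" for x
  proof (rule subsetI)
    fix y assume "y \<in> cball x \<delta>"
    then show "y \<in> W" using d(2)[OF that, of "y - x"] \<delta> interior_subset[of W]
      by (auto simp: dist_norm norm_minus_commute)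
  qed
  obtain R0 where R0: "\<And>x. x \<in> W \<Longrightarrow> norm x \<le> R0" using compact_imp_bounded[OF W(1)] bounded_iff by blast
  define R where "R = \<bar>R0\<bar> + 1"
  have R: "R \<ge> 1" "\<And>x. x \<in> W \<Longrightarrow> norm x + 1 \<le> R" using R0 by (force simp: R_def)+
  define C where "C = 324 * R^4"
  have C: "C > 0" using R by (simp add: C_def)
  \<comment> \<open>With the crude mass bound \<open>C\<close>, the first term makes the stencil
    error cost at most \<open>1 / M\<close> in the descent from \<open>r\<close> to
    \<open>\<delta>\<close>, and the second makes it cost at most half of the gain
    \<open>\<delta>^4 / 64\<close> on \<open>K\<close>. The step \<open>h\<close> is chosen after
    \<open>\<eta>\<close>, so the bad dependence on \<open>R\<close> does no harm.\<close>
  define \<eta> where "\<eta> = min (8 * \<delta>^3 / (M * r * C)) (\<delta>^4 / (128 * C))"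
  have \<eta>: "\<eta> > 0" "r * (\<eta> * C / (8 * \<delta>^3)) \<le> 1 / M" "\<eta> * C \<le> \<delta>^4 / 128"
  proof -
    show "\<eta> > 0" using \<delta> M r C by (simp add: \<eta>_def)
    have "\<eta> \<le> 8 * \<delta>^3 / (M * r * C)" "\<eta> \<le> \<delta>^4 / (128 * C)" by (auto simp: \<eta>_def)
    then show "r * (\<eta> * C / (8 * \<delta>^3)) \<le> 1 / M" "\<eta> * C \<le> \<delta>^4 / 128"
      using \<delta> M r C by (simp_all add: field_simps)
  qed
  obtain h3 where h3: "h3 > 0" "stencil_accuracy 3 \<eta> h3" by (rule stencil_accuracy_exists[of 3]) (use \<eta> in auto)
  obtain h4 where h4: "h4 > 0" "stencil_accuracy 4 \<eta> h4" by (rule stencil_accuracy_exists[of 4]) (use \<eta> in auto)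
  define h where "h = Min {h0 / 2, \<delta> * h3, \<delta> * h4, \<delta> / 4, 1/2, r}"
  have h: "h > 0" "h < h0" "h \<le> h3 * \<delta>" "h \<le> h4 * \<delta>" "h \<le> \<delta> / 4" "h \<le> 1/2" "h \<le> r"
    using h0 h3 h4 \<delta> r by (auto simp: h_def mult.commute min_less_iff_disj)
  define I where "I = lattice h \<inter> W"
  have I: "finite I" "I \<subseteq> lattice h" "I \<subseteq> W"
    using finite_lattice_Int[OF h(1) compact_imp_bounded[OF W(1)]] by (auto simp: I_def)
  have "norm x + h \<le> R" if "x \<in> I" for x using R(2)[of x] that h I by auto
  then obtain v where v: "\<And>x. 0 \<le> v x" "\<And>x. x \<notin> I \<Longrightarrow> v x = 0"
    "\<And>x. x \<in> I \<Longrightarrow> stencil h v x = 4 * v x - h\<^sup>2" "\<And>x. v x \<le> R\<^sup>2"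
    using discrete_torsion[OF h(1)] by metis
  \<comment> \<open>Off \<open>I\<close> the function \<open>v\<close> is zero with nonnegative
    neighbours, so the lower bound persists across the edge of \<open>I\<close>. The descent in
    scale relies on this.\<close>
  have sv: "stencil h v x - 4 * v x \<ge> - h\<^sup>2" for x
  proof (cases "x \<in> I")
    case False
    have "stencil h v x \<ge> 0" unfolding stencil_def by (intro sum_nonneg v)
    moreover have "0 \<le> h\<^sup>2" by simp
    ultimately show ?thesis using v(2)[OF False] by linarith
  qed (use v in auto)
  define V0 where "V0 = h\<^sup>2 * (\<Sum>y\<in>I. v y)"
  have V0: "V0 \<le> C" "0 \<le> V0"
  proof -
    have "V0 \<le> h\<^sup>2 * (\<Sum>y\<in>I. R\<^sup>2)" unfolding V0_def by (intro mult_left_mono sum_mono v) auto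
    also have "\<dots> = h\<^sup>2 * real (card I) * R\<^sup>2" by simp
    also have "\<dots> \<le> 324 * R\<^sup>2 * R\<^sup>2"
    proof (intro mult_right_mono lattice_card_le[OF I(1,2)])
      show "I \<subseteq> cball 0 R" using R(2) I by force
      show "2 * h \<le> R" using h R by linarith
    qed (use h in auto)
    finally show "V0 \<le> C" by (simp add: C_def power2_eq_square power4_eq_xxxx)
    show "0 \<le> V0" unfolding V0_def by (intro mult_nonneg_nonneg sum_nonneg v) auto
  qed
  define F where "F = I \<union> (\<Union>d\<in>dirs. (\<lambda>x. x + of_real h * d) ` I)"
  have F: "finite F" "I \<subseteq> F" "\<And>x d. x \<in> I \<Longrightarrow> d \<in> dirs \<Longrightarrow> x + of_real h * d \<in> F" "F \<subseteq> lattice h"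
    using I by (auto simp: F_def intro: lattice_translate)
  define m where "m x s = (\<Sum>y\<in>I. h\<^sup>2 * v y * (bump 3 ((x - y) /\<^sub>R s) / s\<^sup>2))" for x s
  have mr: "m x r \<le> 480 / M" for x
  proof -
    have "m x r \<le> (\<Sum>y\<in>I. if y \<in> cball x r then M * h\<^sup>2 * v y else 0)"
      unfolding m_def
    proof (rule sum_mono)
      fix y assume "y \<in> I"
      show "h\<^sup>2 * v y * (bump 3 ((x - y) /\<^sub>R r) / r\<^sup>2) \<le> (if y \<in> cball x r then M * h\<^sup>2 * v y else 0)"
      proof (cases "y \<in> cball x r")
        case True
        have "h\<^sup>2 * v y * (bump 3 ((x - y) /\<^sub>R r) / r\<^sup>2) \<le> h\<^sup>2 * v y * (1 / r\<^sup>2)"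
          using v r M by (intro mult_left_mono divide_right_mono bump_bounds) auto
        then show ?thesis using True r M by (simp add: mult.commute mult.left_commute)
      next
        case False
        then have "norm ((x - y) /\<^sub>R r) \<ge> 1" using r by (simp only: norm_diff_divideR) (simp add: field_simps)
        then show ?thesis using False by (simp add: bump_eq_0)
      qed
    qed
    also have "\<dots> = M * (h\<^sup>2 * (\<Sum>y\<in>I \<inter> cball x r. v y))"
      by (simp add: sum.inter_restrict[OF I(1)] sum_distrib_left if_distrib mult.assoc cong: if_cong)
    also have "\<dots> \<le> M * (480 / M\<^sup>2)"
      unfolding r_def
    proof (intro mult_left_mono discrete_torsion_mean_bound[OF I(1,2) v(2,1,3), where u = u])
      show "sqrt M * h \<le> 1" using h(7) M by (simp add: r_def field_simps)
    qed (use u su h I M in auto)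
    also have "\<dots> = 480 / M" using M by (simp add: power2_eq_square)
    finally show ?thesis .
  qed
  \<comment> \<open>The constant is \<open>480\<close> from scale \<open>r\<close>, plus
    \<open>41\<close> from the lower bound on the Laplacian, plus \<open>1\<close> from the stencil
    error.\<close>
  have m\<delta>: "m x \<delta> \<le> 522 / M" for x
  proof -
    have "\<exists>s>\<delta>. s < r \<and> m x r - m x \<delta> = (r - \<delta>) * (\<Sum>y\<in>I. h\<^sup>2 * v y * (lap (bump2 4 ((x - y) /\<^sub>R s)) / (8 * s^3)))"
    proof (rule MVT2[OF \<delta>(3)])
      fix s assume "\<delta> \<le> s" "s \<le> r"
      then have s: "s > 0" using \<delta> by simp
      show "DERIV (m x) s :> (\<Sum>y\<in>I. h\<^sup>2 * v y * (lap (bump2 4 ((x - y) /\<^sub>R s)) / (8 * s^3)))"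
        unfolding m_def by (intro DERIV_sum DERIV_cmult bump_scale_derivative s)
    qed
    then obtain s where s: "\<delta> < s" "s < r"
      "m x r - m x \<delta> = (r - \<delta>) * (\<Sum>y\<in>I. h\<^sup>2 * v y * (lap (bump2 4 ((x - y) /\<^sub>R s)) / (8 * s^3)))" by blast
    have s0: "s > 0" using s \<delta> by simp
    define Q where "Q = (\<Sum>y\<in>F. bump 4 ((x - y) /\<^sub>R s) * (stencil h v y - 4 * v y))"
    have "\<bar>h\<^sup>2 * (\<Sum>y\<in>I. lap (bump2 4 ((x - y) /\<^sub>R s)) * v y) - s\<^sup>2 * Q\<bar> \<le> \<eta> * (h\<^sup>2 * (\<Sum>y\<in>I. v y))"
      unfolding Q_def
    proof (rule mollified_laplacian[OF h4(2) s0 h(1) _ F(1-3) v(2,1)])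
      have "h4 * \<delta> \<le> h4 * s" using h4 s by simp
      then show "h \<le> h4 * s" using h by linarith
    qed
    \<comment> \<open>The cut-off is at most one and vanishes outside the disc of radius
      \<open>s\<close>, so the bound is \<open>h\<^sup>2\<close> times the number of lattice points
      there.\<close>
    moreover have "Q \<ge> - (324 * s\<^sup>2)"
    proof -
      have "(\<Sum>y\<in>F. if y \<in> cball x s then - h\<^sup>2 else 0) \<le> Q"
        unfolding Q_def
      proof (rule sum_mono)
        fix y assume "y \<in> F"
        show "(if y \<in> cball x s then - h\<^sup>2 else 0) \<le> bump 4 ((x - y) /\<^sub>R s) * (stencil h v y - 4 * v y)"
        proof (cases "y \<in> cball x s")
          case True
          have "bump 4 ((x - y) /\<^sub>R s) * (- h\<^sup>2) \<le> bump 4 ((x - y) /\<^sub>R s) * (stencil h v y - 4 * v y)"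
            by (intro mult_left_mono sv bump_bounds)
          moreover have "- h\<^sup>2 \<le> bump 4 ((x - y) /\<^sub>R s) * (- h\<^sup>2)"
            using mult_right_mono[OF bump_bounds(2), of "h\<^sup>2" 4 "(x - y) /\<^sub>R s"] by simp
          ultimately show ?thesis using True by simp
        next
          case False
          then have "norm ((x - y) /\<^sub>R s) \<ge> 1" using s0 by (simp only: norm_diff_divideR) (simp add: field_simps)
          then show ?thesis using False by (simp add: bump_eq_0)
        qed
      qed
      moreover have "(\<Sum>y\<in>F. if y \<in> cball x s then - h\<^sup>2 else 0) = - (h\<^sup>2 * real (card (F \<inter> cball x s)))"
        by (simp only: sum.inter_restrict[OF F(1), symmetric]) simp
      moreover have "h\<^sup>2 * real (card (F \<inter> cball x s)) \<le> 324 * s\<^sup>2"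
        using F h s \<delta> by (intro lattice_card_le) auto
      ultimately show ?thesis by linarith
    qed
    then have "s\<^sup>2 * Q \<ge> s\<^sup>2 * (- (324 * s\<^sup>2))" by (intro mult_left_mono) auto
    moreover have "\<eta> * (h\<^sup>2 * (\<Sum>y\<in>I. v y)) \<le> \<eta> * C"
      using V0 \<eta> unfolding V0_def by (intro mult_left_mono) auto
    ultimately have *: "h\<^sup>2 * (\<Sum>y\<in>I. lap (bump2 4 ((x - y) /\<^sub>R s)) * v y) \<ge> - (324 * s^4 + \<eta> * C)"
      by (simp add: power4_eq_xxxx power2_eq_square abs_le_iff)
    have "(\<Sum>y\<in>I. h\<^sup>2 * v y * (lap (bump2 4 ((x - y) /\<^sub>R s)) / (8 * s^3)))
      = (h\<^sup>2 * (\<Sum>y\<in>I. lap (bump2 4 ((x - y) /\<^sub>R s)) * v y)) / (8 * s^3)"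
      unfolding sum_distrib_left sum_divide_distrib by (intro sum.cong refl) simp
    also have "\<dots> \<ge> - (324 * s^4 + \<eta> * C) / (8 * s^3)"
      using * s0 by (intro divide_right_mono) auto
    also have "- (324 * s^4 + \<eta> * C) / (8 * s^3) = - (324 / 8 * s) - \<eta> * C / (8 * s^3)"
      using s0 by (simp add: field_simps eval_nat_numeral)
    \<comment> \<open>The mean value theorem only places \<open>s\<close> between
      \<open>\<delta>\<close> and \<open>r\<close>: the first term is estimated at \<open>r\<close>,
      the second at \<open>\<delta>\<close>, and \<open>324 / 8 = 40.5\<close> is rounded
      up.\<close>
    also have "- (41 * r) - \<eta> * C / (8 * \<delta>^3) \<le> - (324 / 8 * s) - \<eta> * C / (8 * s^3)"
    proof -
      have "\<eta> * C / (8 * s^3) \<le> \<eta> * C / (8 * \<delta>^3)"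
        using s \<delta> \<eta> C by (intro divide_left_mono mult_left_mono power_mono) auto
      moreover have "324 / 8 * s \<le> 41 * r" using s(2) r(1) by simp
      ultimately show ?thesis by linarith
    qed
    finally have "(r - \<delta>) * (- (41 * r) - \<eta> * C / (8 * \<delta>^3)) \<le> m x r - m x \<delta>"
      unfolding s(3) using \<delta> by (intro mult_left_mono) auto
    moreover have "r * (- (41 * r) - \<eta> * C / (8 * \<delta>^3)) \<le> (r - \<delta>) * (- (41 * r) - \<eta> * C / (8 * \<delta>^3))"
    proof (rule mult_right_mono_neg)
      have "0 \<le> \<eta> * C / (8 * \<delta>^3)" "0 \<le> 41 * r" using r \<delta> \<eta> C by simp_all
      then show "- (41 * r) - \<eta> * C / (8 * \<delta>^3) \<le> 0" by linarith
    qed (use \<delta> in simp)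
    moreover have "r * (- (41 * r) - \<eta> * C / (8 * \<delta>^3)) = - (41 * r\<^sup>2) - r * (\<eta> * C / (8 * \<delta>^3))"
      by (simp add: algebra_simps power2_eq_square)
    ultimately show ?thesis using mr[of x] \<eta>(2) r(2) by simp
  qed
  have lapK: "h\<^sup>2 * (\<Sum>y\<in>I. lap (bump2 3 ((x - y) /\<^sub>R \<delta>)) * v y) \<le> - (\<delta>^4 / 128)" if x: "x \<in> K" for x
  proof -
    define Q where "Q = (\<Sum>y\<in>F. bump 3 ((x - y) /\<^sub>R \<delta>) * (stencil h v y - 4 * v y))"
    have "\<bar>h\<^sup>2 * (\<Sum>y\<in>I. lap (bump2 3 ((x - y) /\<^sub>R \<delta>)) * v y) - \<delta>\<^sup>2 * Q\<bar> \<le> \<eta> * (h\<^sup>2 * (\<Sum>y\<in>I. v y))"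
      unfolding Q_def by (rule mollified_laplacian[OF h3(2) \<delta>(1) h(1) h(3) F(1-3) v(2,1)])
    \<comment> \<open>All lattice points of the \<open>\<delta>\<close>-disc around \<open>x\<close>
      lie in \<open>I\<close>, where the discrete Laplacian is exactly \<open>- h\<^sup>2\<close>.
      On the half disc the cut-off is at least \<open>(3/4)^3\<close>, hence at least
      \<open>1/4\<close>, and \<open>lattice_card_ge\<close> contributes
      \<open>1/16\<close>.\<close>
    moreover have "Q \<le> - (\<delta>\<^sup>2 / 64)"
    proof -
      have "Q \<le> (\<Sum>y\<in>F. if y \<in> cball x (\<delta>/2) then - (h\<^sup>2 / 4) else 0)"
        unfolding Q_def
      proof (rule sum_mono)
        fix y assume y: "y \<in> F"
        have "bump 3 ((x - y) /\<^sub>R \<delta>) * (stencil h v y - 4 * v y) = - h\<^sup>2 * bump 3 ((x - y) /\<^sub>R \<delta>)"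
        proof (cases "y \<in> cball x \<delta>")
          case True
          then have "y \<in> I" using KW[OF x] y F(4) by (auto simp: I_def)
          then show ?thesis using v(3) by simp
        next
          case False
          then have "norm ((x - y) /\<^sub>R \<delta>) \<ge> 1" using \<delta>(1) by (simp only: norm_diff_divideR) (simp add: field_simps)
          then show ?thesis by (simp add: bump_eq_0)
        qed
        moreover have "1/4 \<le> bump 3 ((x - y) /\<^sub>R \<delta>)" if "y \<in> cball x (\<delta>/2)"
        proof -
          have "norm ((x - y) /\<^sub>R \<delta>) \<le> 1/2" using that \<delta>(1) by (simp only: norm_diff_divideR) (simp add: field_simps)
          then have "((x - y) /\<^sub>R \<delta>) \<bullet> ((x - y) /\<^sub>R \<delta>) \<le> (1/2)\<^sup>2"
            unfolding dot_square_norm by (intro power_mono) auto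
          then have "3/4 \<le> max 0 (1 - ((x - y) /\<^sub>R \<delta>) \<bullet> ((x - y) /\<^sub>R \<delta>))" by (simp add: power2_eq_square)
          then have "(3/4)^3 \<le> bump 3 ((x - y) /\<^sub>R \<delta>)" unfolding bump_def by (rule power_mono) simp
          moreover have "(1/4::real) \<le> (3/4)^3" by (simp add: power3_eq_cube)
          ultimately show ?thesis by (rule order_trans[rotated])
        qed
        moreover have "0 \<le> h\<^sup>2 * bump 3 ((x - y) /\<^sub>R \<delta>)" by (simp add: bump_bounds)
        ultimately show "bump 3 ((x - y) /\<^sub>R \<delta>) * (stencil h v y - 4 * v y) \<le> (if y \<in> cball x (\<delta>/2) then - (h\<^sup>2 / 4) else 0)"
          using mult_left_mono[of "1/4" "bump 3 ((x - y) /\<^sub>R \<delta>)" "h\<^sup>2"] by auto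
      qed
      also have "\<dots> = - (h\<^sup>2 * real (card (F \<inter> cball x (\<delta>/2))) / 4)"
        by (simp only: sum.inter_restrict[OF F(1), symmetric]) simp
      also have "F \<inter> cball x (\<delta>/2) = lattice h \<inter> cball x (\<delta>/2)"
      proof -
        have "cball x (\<delta>/2) \<subseteq> W" using KW[OF x] \<delta> by (auto simp: subset_iff)
        then show ?thesis using F by (auto simp: I_def)
      qed
      finally have "Q \<le> - (h\<^sup>2 * real (card (lattice h \<inter> cball x (\<delta>/2))) / 4)" .
      then show ?thesis using lattice_card_ge[OF h(1,5), of x] by simp
    qed
    then have "\<delta>\<^sup>2 * Q \<le> \<delta>\<^sup>2 * (- (\<delta>\<^sup>2 / 64))" by (intro mult_left_mono) auto
    moreover have "\<eta> * (h\<^sup>2 * (\<Sum>y\<in>I. v y)) \<le> \<eta> * C"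
      using V0 \<eta> unfolding V0_def by (intro mult_left_mono) auto
    moreover have "\<delta>\<^sup>2 * (- (\<delta>\<^sup>2 / 64)) = - (\<delta>^4 / 64)" by (simp add: power4_eq_xxxx power2_eq_square)
    ultimately show ?thesis using \<eta>(3) by (simp add: abs_le_iff)
  qed
  have aff: "(- y) /\<^sub>R \<delta> + x /\<^sub>R \<delta> = (x - y) /\<^sub>R \<delta>" for x y :: complex by (simp add: algebra_simps)
  have C2: "C2_derivs UNIV (\<lambda>x. bump 3 ((x - y) /\<^sub>R \<delta>)) (\<lambda>x w. bump1 3 ((x - y) /\<^sub>R \<delta>) (w /\<^sub>R \<delta>))
     (\<lambda>x w z. bump2 3 ((x - y) /\<^sub>R \<delta>) (w /\<^sub>R \<delta>) (z /\<^sub>R \<delta>))" for y :: complex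
    using C2_derivs_compose_affine[OF C2_derivs_bump[of 3] bounded_linear_scaleR_right[of "inverse \<delta>"], of "(- y) /\<^sub>R \<delta>"]
    by (simp add: algebra_simps)
  define c where "c y = - (M / 522) * (h\<^sup>2 * v y / \<delta>\<^sup>2)" for y
  define lam where "lam x = 1 + (\<Sum>y\<in>I. c y * bump 3 ((x - y) /\<^sub>R \<delta>))" for x
  have C2lam: "C2_derivs UNIV lam (\<lambda>x w. 0 + (\<Sum>y\<in>I. c y * bump1 3 ((x - y) /\<^sub>R \<delta>) (w /\<^sub>R \<delta>)))
     (\<lambda>x w z. 0 + (\<Sum>y\<in>I. c y * bump2 3 ((x - y) /\<^sub>R \<delta>) (w /\<^sub>R \<delta>) (z /\<^sub>R \<delta>)))"
    unfolding lam_def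
    by (intro C2_derivs_add C2_derivs_const C2_derivs_sum C2_derivs_cmult C2 I open_UNIV)
  have lamm: "lam x = 1 - M / 522 * m x \<delta>" for x
    unfolding lam_def m_def c_def sum_distrib_left sum_negf[symmetric] diff_conv_add_uminus
    by (intro arg_cong2[where f = "(+)"] sum.cong refl) simp
  have m0: "m x \<delta> \<ge> 0" for x unfolding m_def using v by (intro sum_nonneg mult_nonneg_nonneg) (auto simp: bump_bounds)
  show ?thesis
  proof (rule that[OF C2lam])
    show "lam x \<le> 1" for x using m0[of x] M by (simp add: lamm)
    show "0 \<le> lam x" for x using m\<delta>[of x] M by (simp add: lamm field_simps)
    fix x assume x: "x \<in> K"
    have b2: "bump2 3 z (a /\<^sub>R \<delta>) (a /\<^sub>R \<delta>) = bump2 3 z a a / \<delta>\<^sup>2" for z a :: complex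
      using \<delta> by (simp add: bump2_def field_simps power2_eq_square)
    have "lap (\<lambda>w z. 0 + (\<Sum>y\<in>I. c y * bump2 3 ((x - y) /\<^sub>R \<delta>) (w /\<^sub>R \<delta>) (z /\<^sub>R \<delta>)))
       = (\<Sum>y\<in>I. c y * lap (bump2 3 ((x - y) /\<^sub>R \<delta>)) / \<delta>\<^sup>2)"
      unfolding lap_def b2 by (simp add: sum.distrib[symmetric] add_divide_distrib distrib_left)
    also have "\<dots> = - (M / 522) / \<delta>^4 * (h\<^sup>2 * (\<Sum>y\<in>I. lap (bump2 3 ((x - y) /\<^sub>R \<delta>)) * v y))"
      unfolding c_def sum_distrib_left by (intro sum.cong refl) (simp add: power4_eq_xxxx power2_eq_square ac_simps)
    also have "\<dots> \<ge> - (M / 522) / \<delta>^4 * (- (\<delta>^4 / 128))"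
      using M \<delta> by (intro mult_left_mono_neg lapK[OF x]) (auto simp: divide_nonpos_pos)
    also have "- (M / 522) / \<delta>^4 * (- (\<delta>^4 / 128)) = N" using \<delta> by (simp add: M_def)
    finally show "N \<le> lap (\<lambda>w z. 0 + (\<Sum>y\<in>I. c y * bump2 3 ((x - y) /\<^sub>R \<delta>) (w /\<^sub>R \<delta>) (z /\<^sub>R \<delta>)))" .
  qed
qed

subsection \<open>The properties (P) and (P~)\<close>

lemma card_dirs [simp]: "card dirs = 4"
  by (simp add: dirs_def complex_eq_iff)

text \<open>For \<open>l = D p\<close> this is the squared modulus of the pairing of
  \<open>X\<close> with the (1,0)-part of the differential, in terms of real derivatives
  only.\<close>

definition grad2_of :: "(complex^'n \<Rightarrow> real) \<Rightarrow> complex^'n \<Rightarrow> real"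
  where "grad2_of l X = ((l X)\<^sup>2 + (l (\<i> *s X))\<^sup>2) / 4"

lemma grad2_of_nonneg: "0 \<le> grad2_of l X"
  by (simp add: grad2_of_def)

lemma C2_derivs_cmod_del_pairing:
  fixes f :: "complex^'n \<Rightarrow> real"
  assumes "C2_derivs U f D B" "p \<in> U"
  shows "(cmod (del_pairing f p X))\<^sup>2 = grad2_of (D p) X"
  unfolding C2_derivs_del_pairing[OF assms] grad2_of_def cmod_power2
  by (simp add: power_divide add_divide_distrib)

lemma C2_derivs_del_pairing_eq_0_iff:
  fixes f :: "complex^'n \<Rightarrow> real"
  assumes "C2_derivs U f D B" "p \<in> U"
  shows "del_pairing f p X = 0 \<longleftrightarrow> D p X = 0 \<and> D p (\<i> *s X) = 0"
  unfolding C2_derivs_del_pairing[OF assms] by (auto simp: complex_eq_iff)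

lemma property_P_iff:
  fixes K :: "(complex^'n) set"
  shows "property_P K \<longleftrightarrow> compact K \<and> (\<forall>M>0. \<exists>U f D B. K \<subseteq> U \<and> C2_derivs U f D B \<and>
    (\<forall>z\<in>U. 0 \<le> f z \<and> f z \<le> 1) \<and> (\<forall>z\<in>K. \<forall>X. M * (norm X)\<^sup>2 \<le> levi_of (B z) X))"
proof -
  have "(\<exists>U u. open U \<and> K \<subseteq> U \<and> Ck_on 2 U u \<and> (\<forall>z\<in>U. 0 \<le> u z \<and> u z \<le> 1) \<and>
        (\<forall>z\<in>K. M \<le> smallest_eigenvalue (complex_hessian u z))) \<longleftrightarrow>
    (\<exists>U f D B. K \<subseteq> U \<and> C2_derivs U f D B \<and> (\<forall>z\<in>U. 0 \<le> f z \<and> f z \<le> 1) \<and>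
        (\<forall>z\<in>K. \<forall>X. M * (norm X)\<^sup>2 \<le> levi_of (B z) X))" (is "?A \<longleftrightarrow> ?B") for M
  proof
    assume ?A
    then obtain U u where u: "open U" "K \<subseteq> U" "Ck_on 2 U u" "\<forall>z\<in>U. 0 \<le> u z \<and> u z \<le> 1"
      "\<forall>z\<in>K. M \<le> smallest_eigenvalue (complex_hessian u z)" by blast
    note C = Ck_on_2_imp_C2_derivs[OF u(1,3)]
    show ?B
      using u(2,4,5) smallest_eigenvalue_hessian_ge_iff[OF C] C by (meson subsetD)
  next
    assume ?B
    then obtain U f D B where f: "K \<subseteq> U" "C2_derivs U f D B" "\<forall>z\<in>U. 0 \<le> f z \<and> f z \<le> 1"
        "\<forall>z\<in>K. \<forall>X. M * (norm X)\<^sup>2 \<le> levi_of (B z) X" by blast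
    show ?A
      using f C2_derivsD(1)[OF f(2)] C2_derivs_imp_Ck_on_2[OF f(2)]
        smallest_eigenvalue_hessian_ge_iff[OF f(2)] by (meson subsetD)
  qed
  then show ?thesis unfolding property_P_def by simp
qed

lemma property_P_tilde_iff:
  fixes K :: "(complex^'n) set"
  shows "property_P_tilde K \<longleftrightarrow> compact K \<and> (\<forall>M>0. \<exists>U f D B. K \<subseteq> U \<and> C2_derivs U f D B \<and>
    (\<forall>z\<in>U. \<forall>X. grad2_of (D z) X \<le> levi_of (B z) X \<and> M * (norm X)\<^sup>2 \<le> levi_of (B z) X))"
proof -
  have "(\<exists>U g. open U \<and> K \<subseteq> U \<and> Ck_on 2 U g \<and>
        (\<forall>z\<in>U. \<forall>X. (cmod (del_pairing g z X))\<^sup>2 \<le> levi_form g z X \<and>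
                    M * (norm X)\<^sup>2 \<le> levi_form g z X)) \<longleftrightarrow>
    (\<exists>U f D B. K \<subseteq> U \<and> C2_derivs U f D B \<and>
    (\<forall>z\<in>U. \<forall>X. grad2_of (D z) X \<le> levi_of (B z) X \<and> M * (norm X)\<^sup>2 \<le> levi_of (B z) X))" (is "?A \<longleftrightarrow> ?B") for M
  proof
    assume ?A
    then obtain U g where g: "open U" "K \<subseteq> U" "Ck_on 2 U g"
      "\<forall>z\<in>U. \<forall>X. (cmod (del_pairing g z X))\<^sup>2 \<le> levi_form g z X \<and> M * (norm X)\<^sup>2 \<le> levi_form g z X" by blast
    note C = Ck_on_2_imp_C2_derivs[OF g(1,3)]
    show ?B
      by (rule exI[of _ U], rule exI, rule exI, rule exI, rule conjI[OF g(2) conjI[OF C]])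
        (use g(4) C2_derivs_cmod_del_pairing[OF C] C2_derivs_levi_form[OF C] in simp)
  next
    assume ?B
    then obtain U f D B where f: "K \<subseteq> U" "C2_derivs U f D B"
        "\<forall>z\<in>U. \<forall>X. grad2_of (D z) X \<le> levi_of (B z) X \<and> M * (norm X)\<^sup>2 \<le> levi_of (B z) X" by blast
    show ?A
      by (rule exI[of _ U], rule exI[of _ f])
        (use f C2_derivsD(1)[OF f(2)] C2_derivs_imp_Ck_on_2[OF f(2)] C2_derivs_cmod_del_pairing[OF f(2)]
          C2_derivs_levi_form[OF f(2)] in simp)
  qed
  then show ?thesis unfolding property_P_tilde_def by simp
qed

lemma complex_scale_commute: "c *s (r *\<^sub>R X) = r *\<^sub>R (c *s X)" for X :: "complex^'n"
  by (simp add: vec_eq_iff)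

lemma levi_of_scale:
  assumes "C2_derivs U f D B" "p \<in> U"
  shows "levi_of (B p) (r *\<^sub>R X) = r\<^sup>2 * levi_of (B p) X"
  unfolding levi_of_def complex_scale_commute
  by (simp add: linear_scale[OF C2_derivs_linear2[OF assms]] linear_scale[OF C2_derivs_linear3[OF assms]]
      power2_eq_square algebra_simps)

lemma grad2_of_scale:
  assumes "linear l" shows "grad2_of l (r *\<^sub>R X) = r\<^sup>2 * grad2_of l X"
  unfolding grad2_of_def complex_scale_commute
  by (simp add: linear_scale[OF assms] power_mult_distrib algebra_simps)

lemma continuous_vector_smult: "continuous_on S (\<lambda>p. (c::complex) *s (g p :: complex^'n))"
  if "continuous_on S g"
  unfolding vector_scalar_mult_def using that
  by (intro continuous_on_vec_lambda continuous_intros)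

lemma continuous_on_levi_of:
  fixes f :: "complex^'n \<Rightarrow> real"
  assumes "C2_derivs U f D B"
  shows "continuous_on (U \<times> UNIV) (\<lambda>p. levi_of (B (fst p)) (snd p))"
  unfolding levi_of_def
  by (intro continuous_intros C2_derivs_joint2[OF assms]
      continuous_on_compose2[OF C2_derivs_joint2[OF assms], of _ "\<lambda>p. (fst p, \<i> *s snd p)", simplified] continuous_vector_smult) auto

lemma continuous_on_grad2_of:
  fixes f :: "complex^'n \<Rightarrow> real"
  assumes "C2_derivs U f D B"
  shows "continuous_on (U \<times> UNIV) (\<lambda>p. grad2_of (D (fst p)) (snd p))"
  unfolding grad2_of_def
  by (intro continuous_intros C2_derivs_joint1[OF assms]
      continuous_on_compose2[OF C2_derivs_joint1[OF assms], of _ "\<lambda>p. (fst p, \<i> *s snd p)", simplified] continuous_vector_smult) auto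

lemma levi_of_ge_from_sphere:
  assumes C: "C2_derivs U f D B" and p: "p \<in> U"
    and s: "\<And>X. norm X = 1 \<Longrightarrow> m \<le> levi_of (B p) X"
  shows "m * (norm X)\<^sup>2 \<le> levi_of (B p) X"
proof (cases "X = 0")
  case True
  then show ?thesis using levi_of_scale[OF C p, of 0 0] by simp
next
  case False
  have "levi_of (B p) X = (norm X)\<^sup>2 * levi_of (B p) (X /\<^sub>R norm X)"
    using levi_of_scale[OF C p, of "norm X" "X /\<^sub>R norm X"] False by simp
  moreover have "m * (norm X)\<^sup>2 \<le> levi_of (B p) (X /\<^sub>R norm X) * (norm X)\<^sup>2"
    using False by (intro mult_right_mono s) auto
  ultimately show ?thesis by (simp add: mult.commute)
qed

text \<open>Tube lemma: compactness of the unit sphere makes a strict inequality over all unit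
  vectors an open condition on the base point, so bounds on a compact set pass to a
  neighbourhood.\<close>

lemma open_sphere_condition:
  fixes g :: "'a::euclidean_space \<times> 'b::euclidean_space \<Rightarrow> real"
  assumes U: "open U" and g: "continuous_on (U \<times> UNIV) g"
  shows "open {z \<in> U. \<forall>X\<in>sphere 0 1. m < g (z, X)}"
proof (subst open_subopen, rule ballI)
  define W where "W = (U \<times> UNIV) \<inter> g -` {m<..}"
  have W: "open W" unfolding W_def using U by (intro continuous_open_preimage g open_Times) auto
  fix z assume "z \<in> {z \<in> U. \<forall>X\<in>sphere 0 1. m < g (z, X)}"
  then have "{z} \<times> sphere 0 1 \<subseteq> W" by (auto simp: W_def)
  from Elementary_Topology.tube_lemma[OF compact_sphere W this] obtain X0 where X0: "z \<in> X0" "open X0" "X0 \<times> sphere 0 1 \<subseteq> W"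
    by blast
  have "sphere (0::'b) 1 \<noteq> {}" by simp
  then obtain X1 :: 'b where "X1 \<in> sphere 0 1" by blast
  then have "X0 \<subseteq> {z \<in> U. \<forall>X\<in>sphere 0 1. m < g (z, X)}"
    using X0(3) unfolding W_def by blast
  then show "\<exists>T. open T \<and> z \<in> T \<and> T \<subseteq> {z \<in> U. \<forall>X\<in>sphere 0 1. m < g (z, X)}" using X0 by blast
qed

lemma has_real_derivative_exp_affine: "((\<lambda>t. exp (a * t + b)) has_real_derivative a * exp (a * t + b)) (at t)"
  for a b t :: real
  by (auto intro!: derivative_eq_intros)

lemma C2_derivs_exp_affine:
  assumes "C2_derivs U f D B"
  shows "C2_derivs U (\<lambda>x. exp (a * f x + b)) (\<lambda>x v. a * exp (a * f x + b) * D x v)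
    (\<lambda>x v w. a * exp (a * f x + b) * B x v w + a\<^sup>2 * exp (a * f x + b) * D x w * D x v)"
proof (rule C2_derivs_compose_real[OF assms, where I = UNIV])
  show "((\<lambda>t. a * exp (a * t + b)) has_real_derivative a\<^sup>2 * exp (a * t + b)) (at t)" for t
    using DERIV_cmult[OF has_real_derivative_exp_affine, of a a b t] by (simp add: power2_eq_square mult.assoc)
qed (auto intro!: has_real_derivative_exp_affine continuous_intros)

lemma levi_of_exp_affine:
  "levi_of (\<lambda>v w. a * c * b v w + a\<^sup>2 * c * l w * l v) X = a * c * levi_of b X + a\<^sup>2 * c * grad2_of l X"
  by (simp add: levi_of_def grad2_of_def power2_eq_square algebra_simps add_divide_distrib)

text \<open>With \<open>c = exp (f - 1)\<close>, the Levi form of the exponential is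
  \<open>c\<close> times the sum of the Levi form and the squared gradient of \<open>f\<close>,
  while its own squared gradient carries \<open>c\<^sup>2\<close>. As \<open>c \<le> 1\<close>,
  condition (i) follows.\<close>

lemma property_P_imp_P_tilde:
  fixes K :: "(complex^'n) set"
  assumes "property_P K"
  shows "property_P_tilde K"
  unfolding property_P_tilde_iff
proof (intro conjI allI impI)
  have cK: "compact K" and P: "\<And>M. M > 0 \<Longrightarrow> \<exists>U f D B. K \<subseteq> U \<and> C2_derivs U f D B \<and>
    (\<forall>z\<in>U. 0 \<le> f z \<and> f z \<le> 1) \<and> (\<forall>z\<in>K. \<forall>X. M * (norm X)\<^sup>2 \<le> levi_of (B z) X)"
    using assms unfolding property_P_iff by auto
  show "compact K" by (rule cK)
  fix M :: real assume M: "M > 0"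
  \<comment> \<open>Passing from \<open>K\<close> to a neighbourhood lowers \<open>4 * M\<close> to
    \<open>3 * M\<close>; the remaining factor 3 pays for \<open>c \<ge> exp (-1) \<ge> 1/3\<close>
    in condition (ii).\<close>
  then have "4 * M > 0" by simp
  from P[OF this] obtain U f D B where f: "K \<subseteq> U" "C2_derivs U f D B" "\<forall>z\<in>U. 0 \<le> f z \<and> f z \<le> 1"
     "\<forall>z\<in>K. \<forall>X. 4 * M * (norm X)\<^sup>2 \<le> levi_of (B z) X" by blast
  define V where "V = {z \<in> U. \<forall>X\<in>sphere 0 1. 3 * M < levi_of (B z) X}"
  have V: "open V" "V \<subseteq> U"
    using open_sphere_condition[OF C2_derivsD(1)[OF f(2)] continuous_on_levi_of[OF f(2)], of "3 * M"]
    by (auto simp: V_def)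
  have KV: "K \<subseteq> V"
  proof
    fix z assume z: "z \<in> K"
    have "3 * M < levi_of (B z) X" if "norm X = 1" for X
    proof -
      have "4 * M * (norm X)\<^sup>2 \<le> levi_of (B z) X" using f(4) z by blast
      then show ?thesis using that M by simp
    qed
    then show "z \<in> V" using f(1) z by (auto simp: V_def)
  qed
  define E where "E z = exp (1 * f z + (-1))" for z
  have E: "C2_derivs V E (\<lambda>x v. 1 * exp (1 * f x + (-1)) * D x v)
     (\<lambda>x v w. 1 * exp (1 * f x + (-1)) * B x v w + 1\<^sup>2 * exp (1 * f x + (-1)) * D x w * D x v)"
    unfolding E_def by (rule C2_derivs_subset[OF C2_derivs_exp_affine[OF f(2)] V])
  have "grad2_of (\<lambda>v. 1 * exp (1 * f z + (-1)) * D z v) X \<le>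
      levi_of (\<lambda>v w. 1 * exp (1 * f z + (-1)) * B z v w + 1\<^sup>2 * exp (1 * f z + (-1)) * D z w * D z v) X \<and>
      M * (norm X)\<^sup>2 \<le>
      levi_of (\<lambda>v w. 1 * exp (1 * f z + (-1)) * B z v w + 1\<^sup>2 * exp (1 * f z + (-1)) * D z w * D z v) X"
    if z: "z \<in> V" for z X
  proof -
    define c where "c = exp (1 * f z + (-1))"
    have zU: "z \<in> U" using z V by auto
    have c: "0 < c" "c \<le> 1" "1/3 \<le> c"
    proof -
      show "0 < c" "c \<le> 1" using f(3) zU by (auto simp: c_def)
      have "1/3 \<le> exp (-1::real)" using exp_le by (simp add: exp_minus field_simps)
      also have "\<dots> \<le> c" using f(3) zU by (auto simp: c_def)
      finally show "1/3 \<le> c" .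
    qed
    have L: "3 * M * (norm X)\<^sup>2 \<le> levi_of (B z) X"
      by (rule levi_of_ge_from_sphere[OF f(2) zU]) (use z in \<open>auto simp: V_def less_imp_le\<close>)
    then have L0: "0 \<le> levi_of (B z) X" using M by (meson order_trans mult_nonneg_nonneg zero_le_numeral less_imp_le zero_le_power2)
    have g: "grad2_of (\<lambda>v. 1 * c * D z v) X = c\<^sup>2 * grad2_of (D z) X"
      by (simp add: grad2_of_def power_mult_distrib algebra_simps)
    have "c * c * grad2_of (D z) X \<le> 1 * c * grad2_of (D z) X"
      using c grad2_of_nonneg by (intro mult_right_mono) auto
    then have 1: "c\<^sup>2 * grad2_of (D z) X \<le> 1 * c * levi_of (B z) X + 1\<^sup>2 * c * grad2_of (D z) X"
      using mult_nonneg_nonneg[OF less_imp_le[OF c(1)] L0] by (simp add: power2_eq_square)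
    have "1/3 * (3 * M * (norm X)\<^sup>2) \<le> c * levi_of (B z) X"
      using c L L0 M by (intro mult_mono) auto
    moreover have "0 \<le> c * grad2_of (D z) X" using c grad2_of_nonneg by (intro mult_nonneg_nonneg) auto
    ultimately have 2: "M * (norm X)\<^sup>2 \<le> 1 * c * levi_of (B z) X + 1\<^sup>2 * c * grad2_of (D z) X"
      by simp
    show ?thesis
      using 1 2 unfolding c_def[symmetric] levi_of_exp_affine g by blast
  qed
  then show "\<exists>U f D B. K \<subseteq> U \<and> C2_derivs U f D B \<and>
    (\<forall>z\<in>U. \<forall>X. grad2_of (D z) X \<le> levi_of (B z) X \<and> M * (norm X)\<^sup>2 \<le> levi_of (B z) X)"
    using KV E by blast
qed

text \<open>Taylor expansion at four points of a curved disc with tangent vector \<open>X\<close>.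
  The linear terms in \<open>X\<close> cancel, the directions \<open>1\<close> and
  \<open>\<i>\<close> with their negatives assemble the Levi form, and the second-order
  displacements \<open>E d\<close> enter only through the first derivative.\<close>

lemma C2_derivs_disc_stencil:
  fixes f :: "complex^'n \<Rightarrow> real"
  assumes C: "C2_derivs U f D B" and K: "compact K" "K \<subseteq> U" and A: "A \<ge> 0" and \<eta>: "\<eta> > 0"
  shows "\<exists>h0>0. \<forall>h p X E. 0 < h \<longrightarrow> h < h0 \<longrightarrow> p \<in> K \<longrightarrow> norm X \<le> A \<longrightarrow> (\<forall>d\<in>dirs. norm (E d) \<le> A * h\<^sup>2) \<longrightarrow>
    (\<forall>d\<in>dirs. p + (of_real h * d) *s X + E d \<in> U) \<and>
    \<bar>(\<Sum>d\<in>dirs. f (p + (of_real h * d) *s X + E d)) - 4 * f p - D p (\<Sum>d\<in>dirs. E d) - 4 * h\<^sup>2 * levi_of (B p) X\<bar> \<le> \<eta> * h\<^sup>2"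
proof -
  define e1 where "e1 = \<eta> / (8 * (A + 1)\<^sup>2)"
  have A1: "A + 1 > 0" using A by simp
  have e1: "e1 > 0" "e1 * (A + 1)\<^sup>2 \<le> \<eta> / 8" using \<eta> A1 by (simp_all add: e1_def)
  obtain \<delta> where d: "\<delta> > 0" "\<And>p v. p \<in> K \<Longrightarrow> norm v < \<delta> \<Longrightarrow> p + v \<in> U"
    "\<And>p v. p \<in> K \<Longrightarrow> norm v < \<delta> \<Longrightarrow> \<bar>f (p + v) - f p - D p v - B p v v / 2\<bar> \<le> e1 * (norm v)\<^sup>2"
    by (rule C2_derivs_uniform_Taylor[OF C K e1(1)]) (rule that)
  have "uniformly_continuous_on (K \<times> cball 0 (A + 1)) (\<lambda>p. B (fst p) (snd p) (snd p))"
    by (intro compact_uniformly_continuous continuous_on_subset[OF C2_derivs_joint2[OF C]] compact_Times K compact_cball)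
      (use K in auto)
  moreover have "\<eta> / 8 > 0" using \<eta> by simp
  ultimately obtain e2 where e2: "e2 > 0" "\<And>x x'. x \<in> K \<times> cball 0 (A + 1) \<Longrightarrow> x' \<in> K \<times> cball 0 (A + 1) \<Longrightarrow> dist x' x < e2
     \<Longrightarrow> dist (B (fst x') (snd x') (snd x')) (B (fst x) (snd x) (snd x)) < \<eta> / 8"
    unfolding uniformly_continuous_on_def by meson
  define h0 where "h0 = Min {1 / (A + 1), \<delta> / (A + 1), e2 / (A + 1)}"
  have h0: "h0 > 0" using A1 d e2 by (simp add: h0_def)
  show ?thesis
  proof (intro exI[of _ h0] conjI allI impI h0)
    fix h :: real and p X :: "complex^'n" and E :: "complex \<Rightarrow> complex^'n"
    assume h: "0 < h" "h < h0" and p: "p \<in> K" and X: "norm X \<le> A" and E: "\<forall>d\<in>dirs. norm (E d) \<le> A * h\<^sup>2"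
    have h1: "h * (A + 1) < 1" "h * (A + 1) < \<delta>" "h * (A + 1) < e2"
      using h A1 by (simp_all add: h0_def pos_less_divide_eq)
    have hA: "h * A \<le> 1" using h1 h by (simp add: algebra_simps)
    have pU: "p \<in> U" using p K by auto
    note l1 = C2_derivs_linear1[OF C pU] and l2 = C2_derivs_linear2[OF C pU] and l3 = C2_derivs_linear3[OF C pU]
    \<comment> \<open>The displacement divided by \<open>h\<close>. It differs from
      \<open>d *s X\<close> only by a term of order \<open>h\<close>, so the Hessian may be
      evaluated at \<open>d *s X\<close> instead.\<close>
    define y where "y d = d *s X + E d /\<^sub>R h" for d
    have v: "(of_real h * d) *s X + E d = h *\<^sub>R y d" for d
      using h by (simp add: y_def vec_eq_iff scaleR_conv_of_real[where 'a = complex] algebra_simps)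
    have ndX: "norm (d *s X) = norm X" if "d \<in> dirs" for d
      by (simp add: norm_vec_def L2_set_def norm_mult norm_dirs[OF that])
    have nE: "norm (E d /\<^sub>R h) \<le> A * h" if "d \<in> dirs" for d
      using E[rule_format, OF that] h by (simp add: field_simps power2_eq_square)
    have ny: "norm (y d) \<le> A + 1" if "d \<in> dirs" for d
      using norm_triangle_ineq[of "d *s X" "E d /\<^sub>R h"] ndX[OF that] nE[OF that] X hA
      by (simp add: y_def mult.commute)
    have nv: "norm (h *\<^sub>R y d) \<le> h * (A + 1)" if "d \<in> dirs" for d
      using ny[OF that] h by (simp add: mult_left_mono)
    show "\<forall>d\<in>dirs. p + (of_real h * d) *s X + E d \<in> U"
    proof
      fix d assume dd: "d \<in> dirs"
      have "p + h *\<^sub>R y d \<in> U" by (rule d(2)[OF p]) (use nv[OF dd] h1 in simp)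
      then show "p + (of_real h * d) *s X + E d \<in> U" by (simp only: v add.assoc)
    qed
    have t: "\<bar>f (p + h *\<^sub>R y d) - f p - D p (h *\<^sub>R y d) - h\<^sup>2 * B p (d *s X) (d *s X) / 2\<bar> \<le> \<eta> / 4 * h\<^sup>2"
      if dd: "d \<in> dirs" for d
    proof -
      have "\<bar>f (p + h *\<^sub>R y d) - f p - D p (h *\<^sub>R y d) - B p (h *\<^sub>R y d) (h *\<^sub>R y d) / 2\<bar> \<le> e1 * (norm (h *\<^sub>R y d))\<^sup>2"
        by (rule d(3)[OF p]) (use nv[OF dd] h1 in simp)
      also have "\<dots> \<le> e1 * (h * (A + 1))\<^sup>2"
        using nv[OF dd] e1 by (intro mult_left_mono power_mono) auto
      also have "\<dots> = e1 * (A + 1)\<^sup>2 * h\<^sup>2" by (simp add: power_mult_distrib)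
      also have "\<dots> \<le> \<eta> / 8 * h\<^sup>2" by (intro mult_right_mono e1) simp
      finally have 1: "\<bar>f (p + h *\<^sub>R y d) - f p - D p (h *\<^sub>R y d) - B p (h *\<^sub>R y d) (h *\<^sub>R y d) / 2\<bar> \<le> \<eta> / 8 * h\<^sup>2" .
      have "dist (p, y d) (p, d *s X) < e2"
      proof -
        have "dist (p, y d) (p, d *s X) = norm (E d /\<^sub>R h)" by (simp add: dist_Pair_Pair dist_norm y_def)
        also have "\<dots> \<le> A * h" by (rule nE[OF dd])
        also have "\<dots> < e2" using h1 h by (simp add: algebra_simps)
        finally show ?thesis .
      qed
      then have "dist (B p (y d) (y d)) (B p (d *s X) (d *s X)) < \<eta> / 8"
        using e2(2)[of "(p, d *s X)" "(p, y d)"] p X ny[OF dd] ndX[OF dd] by simp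
      then have "h\<^sup>2 * \<bar>B p (y d) (y d) - B p (d *s X) (d *s X)\<bar> \<le> h\<^sup>2 * (\<eta> / 8)"
        by (intro mult_left_mono) (auto simp: dist_real_def)
      moreover have "\<bar>B p (h *\<^sub>R y d) (h *\<^sub>R y d) - h\<^sup>2 * B p (d *s X) (d *s X)\<bar> = h\<^sup>2 * \<bar>B p (y d) (y d) - B p (d *s X) (d *s X)\<bar>"
        by (simp add: linear_scale[OF l2] linear_scale[OF l3] power2_eq_square abs_mult[symmetric] algebra_simps
            del: abs_mult_self_eq)
          (simp add: abs_mult right_diff_distrib[symmetric])
      ultimately have "\<bar>B p (h *\<^sub>R y d) (h *\<^sub>R y d) - h\<^sup>2 * B p (d *s X) (d *s X)\<bar> \<le> \<eta> / 8 * h\<^sup>2"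
        by (simp add: mult.commute)
      with 1 show ?thesis by (simp only: abs_le_iff) linarith
    qed
    have sD: "(\<Sum>d\<in>dirs. D p (h *\<^sub>R y d)) = D p (\<Sum>d\<in>dirs. E d)"
    proof -
      have "(\<Sum>d\<in>dirs. D p (h *\<^sub>R y d)) = D p (\<Sum>d\<in>dirs. h *\<^sub>R y d)" by (simp add: linear_sum[OF l1])
      also have "(\<Sum>d\<in>dirs. h *\<^sub>R y d) = (\<Sum>d\<in>dirs. E d)"
        unfolding v[symmetric] by (simp add: sum_dirs vec_eq_iff algebra_simps)
      finally show ?thesis .
    qed
    have sB: "(\<Sum>d\<in>dirs. h\<^sup>2 * B p (d *s X) (d *s X) / 2) = 4 * h\<^sup>2 * levi_of (B p) X"
    proof -
      have "(- c) *s X = - (c *s X)" for c by (simp add: vec_eq_iff)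
      moreover have "1 *s X = X" by (simp add: vec_eq_iff)
      ultimately show ?thesis
        by (simp add: sum_dirs levi_of_def linear_neg[OF l2] linear_neg[OF l3])
          (simp add: algebra_simps)
    qed
    have "(\<Sum>d\<in>dirs. f (p + (of_real h * d) *s X + E d)) - 4 * f p - D p (\<Sum>d\<in>dirs. E d) - 4 * h\<^sup>2 * levi_of (B p) X
       = (\<Sum>d\<in>dirs. f (p + h *\<^sub>R y d) - f p - D p (h *\<^sub>R y d) - h\<^sup>2 * B p (d *s X) (d *s X) / 2)"
      unfolding add.assoc v sum_subtractf sD sB by (simp add: sum_dirs)
    also have "\<bar>\<dots>\<bar> \<le> (\<Sum>d\<in>dirs. \<eta> / 4 * h\<^sup>2)"
      by (rule order_trans[OF sum_abs sum_mono[OF t]])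
    also have "\<dots> = \<eta> * h\<^sup>2" by (simp only: sum_dirs)
    finally show "\<bar>(\<Sum>d\<in>dirs. f (p + (of_real h * d) *s X + E d)) - 4 * f p - D p (\<Sum>d\<in>dirs. E d) - 4 * h\<^sup>2 * levi_of (B p) X\<bar> \<le> \<eta> * h\<^sup>2" .
  qed
qed

subsection \<open>Stencils along holomorphic discs\<close>

definition pt :: "complex \<Rightarrow> complex \<Rightarrow> complex^2"
  where "pt z w = (\<chi> i. if i = 1 then z else w)"

lemma pt_nth [simp]: "pt z w $ 1 = z" "pt z w $ 2 = w"
  by (simp_all add: pt_def)

lemma pt_add: "pt a b + pt c d = pt (a + c) (b + d)"
  and pt_smult: "k *s pt a b = pt (k * a) (k * b)"
  and pt_scaleR: "r *\<^sub>R pt a b = pt (r *\<^sub>R a) (r *\<^sub>R b)"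
  and pt_diff: "pt a b - pt c d = pt (a - c) (b - d)"
  by (simp_all add: vec_eq_iff forall_2)

lemma norm_pt: "(norm (pt a b))\<^sup>2 = (norm a)\<^sup>2 + (norm b)\<^sup>2"
  by (simp add: norm_vec_def L2_set_def sum_2)

lemma norm_pt_le: "norm (pt a b) \<le> norm a + norm b"
  by (simp add: norm_vec_def L2_set_def sum_2 sqrt_sum_squares_le_sum)

text \<open>Both \<open>d\<close> and its square sum to zero over \<open>dirs\<close>, so the
  holomorphic terms of first and second order cancel, including the square of the linear one. Up to
  order \<open>h^3\<close> only the sum of the corrections \<open>e\<close> survives.\<close>

lemma exp_stencil:
  assumes A: "A \<ge> 0" and h: "0 < h" "h \<le> 1" "3 * A * h \<le> 1"
    and a: "norm a \<le> A" "norm b \<le> A" and e: "\<And>d. d \<in> dirs \<Longrightarrow> norm (e d) \<le> A * h\<^sup>2"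
  defines "s \<equiv> \<lambda>d. a * (of_real h * d) + b * (of_real h * d)\<^sup>2 + e d"
  shows "d \<in> dirs \<Longrightarrow> norm (exp (s d) - 1 - a * (of_real h * d)) \<le> (2 * A + 16 * A^2 + 164 * A^3) * h\<^sup>2"
    and "norm ((\<Sum>d\<in>dirs. exp (s d) - 1 - a * (of_real h * d)) - (\<Sum>d\<in>dirs. e d)) \<le> (2 * A + 16 * A^2 + 164 * A^3) * h^3"
proof -
  define t where "t d = a * (of_real h * d)" for d
  define q where "q d = b * (of_real h * d)\<^sup>2 + e d" for d
  define R where "R d = exp (s d) - 1 - s d - (s d)\<^sup>2 / 2 + (t d * q d + (q d)\<^sup>2 / 2)" for d
  have sd: "s d = t d + q d" for d by (simp add: s_def t_def q_def)
  have id: "exp (s d) - 1 - a * (of_real h * d) = q d + (t d)\<^sup>2 / 2 + R d" for d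
    by (simp add: R_def sd t_def power2_eq_square field_simps)
  have t: "norm (t d) \<le> A * h" and q: "norm (q d) \<le> 2 * A * h\<^sup>2" and R: "norm (R d) \<le> (4 * A^2 + 41 * A^3) * h^3"
    if d: "d \<in> dirs" for d
  proof -
    show t: "norm (t d) \<le> A * h"
      using a h norm_dirs[OF d] by (simp add: t_def norm_mult mult_right_mono)
    have "norm (b * (of_real h * d)\<^sup>2) \<le> A * h\<^sup>2"
      using a h norm_dirs[OF d] by (simp add: norm_mult norm_power mult_right_mono)
    then show q: "norm (q d) \<le> 2 * A * h\<^sup>2"
      unfolding q_def using norm_triangle_ineq[of "b * (of_real h * d)\<^sup>2" "e d"] e[OF d] by simp
    have hh: "h\<^sup>2 \<le> h" using h by (simp add: power2_eq_square)
    have s: "norm (s d) \<le> 3 * A * h"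
    proof -
      have "norm (s d) \<le> A * h + 2 * A * h\<^sup>2" unfolding sd using norm_triangle_ineq[of "t d" "q d"] t q by simp
      also have "2 * A * h\<^sup>2 \<le> 2 * A * h" using A hh by (intro mult_left_mono) auto
      finally show ?thesis by simp
    qed
    have "norm (exp (s d) - (\<Sum>k\<le>2. (s d) ^ k / fact k)) \<le> exp \<bar>Re (s d)\<bar> * norm (s d) ^ Suc 2 / fact 2"
      by (rule Taylor_exp)
    also have "(\<Sum>k\<le>2. (s d) ^ k / fact k) = 1 + s d + (s d)\<^sup>2 / 2"
      by (simp add: numeral_2_eq_2)
    finally have "norm (exp (s d) - 1 - s d - (s d)\<^sup>2 / 2) \<le> exp \<bar>Re (s d)\<bar> * norm (s d) ^ 3 / 2"
      by (simp add: diff_diff_eq numeral_3_eq_3)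
    also have "\<dots> \<le> 3 * (3 * A * h) ^ 3 / 2"
    proof -
      have "\<bar>Re (s d)\<bar> \<le> 1" using abs_Re_le_cmod[of "s d"] s h by linarith
      then have "exp \<bar>Re (s d)\<bar> \<le> exp 1" by simp
      then have "exp \<bar>Re (s d)\<bar> \<le> 3" using exp_le by linarith
      then show ?thesis using s by (intro divide_right_mono mult_mono power_mono) auto
    qed
    \<comment> \<open>The factor is \<open>3 * 27 / 2 = 40.5\<close>.\<close>
    also have "\<dots> \<le> 41 * A^3 * h^3" using A h by (simp add: power_mult_distrib)
    finally have 1: "norm (exp (s d) - 1 - s d - (s d)\<^sup>2 / 2) \<le> 41 * A^3 * h^3" .
    have 2: "norm (t d * q d) \<le> 2 * A^2 * h^3"
    proof -
      have "norm (t d * q d) \<le> (A * h) * (2 * A * h\<^sup>2)"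
        unfolding norm_mult using A h by (intro mult_mono t q) auto
      then show ?thesis by (simp add: power2_eq_square power3_eq_cube ac_simps)
    qed
    have 3: "norm ((q d)\<^sup>2 / 2) \<le> 2 * A^2 * h^3"
    proof -
      have "norm ((q d)\<^sup>2 / 2) \<le> (2 * A * h\<^sup>2)\<^sup>2 / 2"
        unfolding norm_divide norm_power using q by (simp add: power_mono)
      also have "\<dots> = 2 * A^2 * (h^3 * h)" by (simp add: power_mult_distrib power2_eq_square power3_eq_cube)
      also have "\<dots> \<le> 2 * A^2 * (h^3 * 1)" using A h by (intro mult_left_mono) auto
      finally show ?thesis by simp
    qed
    have "norm (R d) \<le> norm (exp (s d) - 1 - s d - (s d)\<^sup>2 / 2) + (norm (t d * q d) + norm ((q d)\<^sup>2 / 2))"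
      unfolding R_def by (intro order_trans[OF norm_triangle_ineq] add_mono order_refl norm_triangle_ineq)
    then show "norm (R d) \<le> (4 * A^2 + 41 * A^3) * h^3" using 1 2 3 by (simp add: algebra_simps)
  qed
  have h3: "h^3 \<le> h\<^sup>2" using h by (simp add: power_decreasing)
  have C: "4 * A^2 + 41 * A^3 \<ge> 0" using A by simp
  show "norm (exp (s d) - 1 - a * (of_real h * d)) \<le> (2 * A + 16 * A^2 + 164 * A^3) * h\<^sup>2" if d: "d \<in> dirs"
  proof -
    have "norm ((t d)\<^sup>2 / 2) \<le> (A * h)\<^sup>2 / 2"
      unfolding norm_divide norm_power using t[OF d] by (simp add: power_mono)
    then have "norm (q d + (t d)\<^sup>2 / 2 + R d) \<le> 2 * A * h\<^sup>2 + (A * h)\<^sup>2 / 2 + (4 * A^2 + 41 * A^3) * h^3"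
      by (intro order_trans[OF norm_triangle_ineq] add_mono q R d)
    also have "\<dots> \<le> 2 * A * h\<^sup>2 + A^2 * h\<^sup>2 + (4 * A^2 + 41 * A^3) * h\<^sup>2"
      using C A by (intro add_mono mult_left_mono h3) (auto simp: power_mult_distrib)
    also have "\<dots> = (2 * A + 5 * A^2 + 41 * A^3) * h\<^sup>2" by (simp add: algebra_simps)
    also have "\<dots> \<le> (2 * A + 16 * A^2 + 164 * A^3) * h\<^sup>2" using A by (intro mult_right_mono) auto
    finally show ?thesis unfolding id .
  qed
  have "(\<Sum>d\<in>dirs. exp (s d) - 1 - a * (of_real h * d)) - (\<Sum>d\<in>dirs. e d) = (\<Sum>d\<in>dirs. R d)"
    unfolding id sum.distrib by (simp add: sum_dirs t_def q_def power2_eq_square field_simps)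
  also have "norm \<dots> \<le> (\<Sum>d\<in>dirs. (4 * A^2 + 41 * A^3) * h^3)"
    by (intro order_trans[OF norm_sum] sum_mono R)
  also have "\<dots> = (16 * A^2 + 164 * A^3) * h^3" by (simp add: algebra_simps)
  also have "\<dots> \<le> (2 * A + 16 * A^2 + 164 * A^3) * h^3" using A h by (intro mult_right_mono) auto
  finally show "norm ((\<Sum>d\<in>dirs. exp (s d) - 1 - a * (of_real h * d)) - (\<Sum>d\<in>dirs. e d)) \<le> (2 * A + 16 * A^2 + 164 * A^3) * h^3" .
qed

lemma C2_derivs_bound1:
  fixes f :: "'a::euclidean_space \<Rightarrow> real"
  assumes C: "C2_derivs U f D B" and K: "compact K" "K \<subseteq> U"
  obtains c where "c \<ge> 0" "\<And>p v. p \<in> K \<Longrightarrow> \<bar>D p v\<bar> \<le> c * norm v"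
proof -
  have "compact ((\<lambda>p. D (fst p) (snd p)) ` (K \<times> sphere (0::'a) 1))"
    by (intro compact_continuous_image continuous_on_subset[OF C2_derivs_joint1[OF C]] compact_Times K compact_sphere)
      (use K in auto)
  then have "bounded ((\<lambda>p. D (fst p) (snd p)) ` (K \<times> sphere (0::'a) 1))" by (rule compact_imp_bounded)
  then obtain c where c: "\<forall>x\<in>(\<lambda>p. D (fst p) (snd p)) ` (K \<times> sphere (0::'a) 1). norm x \<le> c"
    unfolding bounded_iff by (elim exE)
  show ?thesis
  proof (rule that[of "max 0 c"])
    fix p v assume p: "p \<in> K"
    then have l: "linear (D p)" using C2_derivs_linear1[OF C] K by auto
    show "\<bar>D p v\<bar> \<le> max 0 c * norm v"
    proof (cases "v = 0")
      case True
      then show ?thesis using linear_0[OF l] by simp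
    next
      case False
      have "norm (D p (v /\<^sub>R norm v)) \<le> c"
        by (rule c[rule_format, OF image_eqI[of _ _ "(p, v /\<^sub>R norm v)"]]) (use False p in auto)
      moreover have "D p v = norm v * D p (v /\<^sub>R norm v)"
        using False by (simp add: linear_scale[OF l])
      ultimately have "\<bar>D p v\<bar> \<le> c * norm v"
      proof -
        have "\<bar>D p v\<bar> = \<bar>norm v * D p (v /\<^sub>R norm v)\<bar>" using \<open>D p v = norm v * D p (v /\<^sub>R norm v)\<close> by simp
        also have "\<dots> = norm v * norm (D p (v /\<^sub>R norm v))" by (simp only: abs_mult abs_norm_cancel real_norm_def)
        also have "\<dots> \<le> norm v * c" using \<open>norm (D p (v /\<^sub>R norm v)) \<le> c\<close> by (intro mult_left_mono) auto
        finally show ?thesis by (simp add: mult.commute)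
      qed
      also have "\<dots> \<le> max 0 c * norm v" by (intro mult_right_mono) auto
      finally show ?thesis .
    qed
  qed simp
qed

text \<open>The disc stencil along the holomorphic disc with second coordinate \<open>w\<close>
  times the exponential of a quadratic polynomial; its tangent at the centre is
  \<open>pt 1 (a * w)\<close>. The corrections \<open>e\<close> allow the four points to be moved
  onto the boundary or slightly off it, at a first-order cost in the direction
  \<open>pt 0 w\<close>, up to a complex factor.\<close>

lemma C2_derivs_hartogs_stencil:
  fixes f :: "complex^2 \<Rightarrow> real"
  assumes C: "C2_derivs U f D B" and K: "compact K" "K \<subseteq> U" and A: "A \<ge> 0" and \<eta>: "\<eta> > 0"
  shows "\<exists>h0>0. \<forall>h z w a b e. 0 < h \<longrightarrow> h < h0 \<longrightarrow> pt z w \<in> K \<longrightarrow> norm w \<le> A \<longrightarrow> norm a \<le> A \<longrightarrow> norm b \<le> A \<longrightarrow>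
    (\<forall>d\<in>dirs. norm (e d) \<le> A * h\<^sup>2) \<longrightarrow>
    (\<forall>d\<in>dirs. pt (z + of_real h * d) (w * exp (a * (of_real h * d) + b * (of_real h * d)\<^sup>2 + e d)) \<in> U) \<and>
    \<bar>(\<Sum>d\<in>dirs. f (pt (z + of_real h * d) (w * exp (a * (of_real h * d) + b * (of_real h * d)\<^sup>2 + e d))))
       - 4 * f (pt z w) - D (pt z w) (pt 0 (w * (\<Sum>d\<in>dirs. e d))) - 4 * h\<^sup>2 * levi_of (B (pt z w)) (pt 1 (a * w))\<bar> \<le> \<eta> * h\<^sup>2"
proof -
  define c where "c = 2 * A + 16 * A^2 + 164 * A^3"
  have c: "c \<ge> 0" using A by (simp add: c_def)
  obtain cD where cD: "cD \<ge> 0" "\<And>p v. p \<in> K \<Longrightarrow> \<bar>D p v\<bar> \<le> cD * norm v"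
    by (rule C2_derivs_bound1[OF C K]) (rule that)
  define A' where "A' = 1 + A\<^sup>2 + A * c"
  have A': "A' \<ge> 0" using A c by (simp add: A'_def)
  have \<eta>2: "\<eta>/2 > 0" using \<eta> by simp
  obtain h1 where h1': "h1 > 0 \<and> (\<forall>h p X E. 0 < h \<longrightarrow> h < h1 \<longrightarrow> p \<in> K \<longrightarrow> norm X \<le> A' \<longrightarrow> (\<forall>d\<in>dirs. norm (E d) \<le> A' * h\<^sup>2) \<longrightarrow>
    (\<forall>d\<in>dirs. p + (of_real h * d) *s X + E d \<in> U) \<and>
    \<bar>(\<Sum>d\<in>dirs. f (p + (of_real h * d) *s X + E d)) - 4 * f p - D p (\<Sum>d\<in>dirs. E d) - 4 * h\<^sup>2 * levi_of (B p) X\<bar> \<le> \<eta>/2 * h\<^sup>2)"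
    using C2_derivs_disc_stencil[OF C K A' \<eta>2] by (elim exE)
  note h1 = conjunct1[OF h1'] conjunct2[OF h1', rule_format]
  define k where "k = cD * A * c"
  have k: "k \<ge> 0" using cD A c by (simp add: k_def)
  define h0 where "h0 = Min {h1, 1, 1 / (3 * A + 1), \<eta> / (2 * (k + 1))}"
  have h0: "h0 > 0" using h1 A k \<eta> by (simp add: h0_def)
  show ?thesis
  proof (intro exI[of _ h0] conjI allI impI h0)
    fix h :: real and z w a b :: complex and e :: "complex \<Rightarrow> complex"
    assume h: "0 < h" "h < h0" and p: "pt z w \<in> K" and w: "norm w \<le> A" and a: "norm a \<le> A" "norm b \<le> A"
      and e: "\<forall>d\<in>dirs. norm (e d) \<le> A * h\<^sup>2"
    have hs: "h < h1" "h \<le> 1" "h * (3 * A + 1) \<le> 1" "k * h \<le> \<eta> / 2"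
    proof -
      have l: "h < 1 / (3 * A + 1)" "h < \<eta> / (2 * (k + 1))" using h by (simp_all add: h0_def)
      show "h < h1" "h \<le> 1" using h by (simp_all add: h0_def)
      show "h * (3 * A + 1) \<le> 1" using l(1) A by (simp add: field_simps)
      have "(k + 1) * h < \<eta> / 2" using l(2) k by (simp add: field_simps)
      then show "k * h \<le> \<eta> / 2" using h by (simp add: algebra_simps)
    qed
    have h3: "3 * A * h \<le> 1" using hs(3) h by (simp add: algebra_simps)
    define s where "s d = a * (of_real h * d) + b * (of_real h * d)\<^sup>2 + e d" for d
    define g where "g d = exp (s d) - 1 - a * (of_real h * d)" for d
    have es: "\<And>d. d \<in> dirs \<Longrightarrow> norm (g d) \<le> c * h\<^sup>2"
      "norm ((\<Sum>d\<in>dirs. g d) - (\<Sum>d\<in>dirs. e d)) \<le> c * h^3"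
      unfolding g_def s_def c_def
      by (rule exp_stencil[where e = e, OF A h(1) hs(2) h3 a], use e in simp, assumption)
        (rule exp_stencil(2)[where e = e, OF A h(1) hs(2) h3 a], use e in simp)
    define X where "X = pt 1 (a * w)"
    define E where "E d = pt 0 (w * g d)" for d
    have point: "pt (z + of_real h * d) (w * exp (s d)) = pt z w + (of_real h * d) *s X + E d" for d
      by (simp add: X_def E_def g_def pt_smult pt_add algebra_simps)
    have nX: "norm X \<le> A'"
    proof -
      have "norm X \<le> norm (1::complex) + norm (a * w)" unfolding X_def by (rule norm_pt_le)
      also have "\<dots> \<le> 1 + A * A" unfolding norm_mult using a w A by (intro add_mono mult_mono) auto
      also have "\<dots> \<le> A'" using A c by (simp add: A'_def power2_eq_square)
      finally show ?thesis .
    qed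
    have nE: "norm (E d) \<le> A' * h\<^sup>2" if d: "d \<in> dirs" for d
    proof -
      have "norm (E d) \<le> norm (0::complex) + norm (w * g d)" unfolding E_def by (rule norm_pt_le)
      also have "\<dots> \<le> A * (c * h\<^sup>2)"
        unfolding norm_mult using w A c es(1)[OF d] by (simp add: mult_mono)
      also have "\<dots> \<le> A' * h\<^sup>2" unfolding mult.assoc[symmetric]
        by (intro mult_right_mono) (simp_all add: A'_def)
      finally show ?thesis .
    qed
    have main: "(\<forall>d\<in>dirs. pt z w + (of_real h * d) *s X + E d \<in> U) \<and>
      \<bar>(\<Sum>d\<in>dirs. f (pt z w + (of_real h * d) *s X + E d)) - 4 * f (pt z w) - D (pt z w) (\<Sum>d\<in>dirs. E d)
        - 4 * h\<^sup>2 * levi_of (B (pt z w)) X\<bar> \<le> \<eta>/2 * h\<^sup>2"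
      by (rule h1(2)[OF h(1) hs(1) p nX]) (rule nE)
    have pU: "pt z w \<in> U" using p K by auto
    note l1 = C2_derivs_linear1[OF C pU]
    show "(\<forall>d\<in>dirs. pt (z + of_real h * d) (w * exp (a * (of_real h * d) + b * (of_real h * d)\<^sup>2 + e d)) \<in> U)"
      using main unfolding s_def[symmetric] point by blast
    have sE: "(\<Sum>d\<in>dirs. E d) = pt 0 (w * (\<Sum>d\<in>dirs. g d))"
      by (simp add: sum_dirs E_def pt_add algebra_simps)
    have "\<bar>D (pt z w) (\<Sum>d\<in>dirs. E d) - D (pt z w) (pt 0 (w * (\<Sum>d\<in>dirs. e d)))\<bar> \<le> \<eta>/2 * h\<^sup>2"
    proof -
      have "D (pt z w) (\<Sum>d\<in>dirs. E d) - D (pt z w) (pt 0 (w * (\<Sum>d\<in>dirs. e d)))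
        = D (pt z w) (pt 0 (w * ((\<Sum>d\<in>dirs. g d) - (\<Sum>d\<in>dirs. e d))))"
        unfolding sE linear_diff[OF l1, symmetric] pt_diff by (simp add: algebra_simps)
      also have "\<bar>\<dots>\<bar> \<le> cD * norm (pt 0 (w * ((\<Sum>d\<in>dirs. g d) - (\<Sum>d\<in>dirs. e d))))"
        by (rule cD(2)[OF p])
      also have "\<dots> \<le> cD * (A * (c * h^3))"
      proof (rule mult_left_mono[OF _ cD(1)])
        have "norm (pt 0 (w * ((\<Sum>d\<in>dirs. g d) - (\<Sum>d\<in>dirs. e d)))) \<le> norm (0::complex) + norm (w * ((\<Sum>d\<in>dirs. g d) - (\<Sum>d\<in>dirs. e d)))"
          by (rule norm_pt_le)
        also have "\<dots> \<le> A * (c * h^3)"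
          using w A c h es(2) by (simp add: norm_mult mult_mono)
        finally show "norm (pt 0 (w * ((\<Sum>d\<in>dirs. g d) - (\<Sum>d\<in>dirs. e d)))) \<le> A * (c * h^3)" .
      qed
      also have "\<dots> = k * h * h\<^sup>2" by (simp add: k_def power2_eq_square power3_eq_cube)
      also have "\<dots> \<le> \<eta>/2 * h\<^sup>2" by (intro mult_right_mono hs(4)) auto
      finally show ?thesis .
    qed
    moreover have "\<bar>(\<Sum>d\<in>dirs. f (pt (z + of_real h * d) (w * exp (s d)))) - 4 * f (pt z w) - D (pt z w) (\<Sum>d\<in>dirs. E d)
        - 4 * h\<^sup>2 * levi_of (B (pt z w)) X\<bar> \<le> \<eta>/2 * h\<^sup>2"
      using main unfolding point by blast
    ultimately have "\<bar>(\<Sum>d\<in>dirs. f (pt (z + of_real h * d) (w * exp (s d)))) - 4 * f (pt z w)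
        - D (pt z w) (pt 0 (w * (\<Sum>d\<in>dirs. e d))) - 4 * h\<^sup>2 * levi_of (B (pt z w)) X\<bar> \<le> \<eta> * h\<^sup>2"
      by (simp only: abs_le_iff) linarith
    then show "\<bar>(\<Sum>d\<in>dirs. f (pt (z + of_real h * d) (w * exp (a * (of_real h * d) + b * (of_real h * d)\<^sup>2 + e d))))
       - 4 * f (pt z w) - D (pt z w) (pt 0 (w * (\<Sum>d\<in>dirs. e d))) - 4 * h\<^sup>2 * levi_of (B (pt z w)) (pt 1 (a * w))\<bar> \<le> \<eta> * h\<^sup>2"
      by (simp only: s_def X_def)
  qed
qed

subsection \<open>Hartogs domains and their defining functions\<close>

text \<open>A trace does not depend on the orthogonal frame. This identifies the Levi form in one
  variable with a quarter of the Laplacian.\<close>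

lemma lap_rotation_invariant:
  assumes "\<And>v. linear (b v)" "\<And>w. linear (\<lambda>v. b v w)"
  shows "b c c + b (\<i> * c) (\<i> * c) = (norm c)\<^sup>2 * lap b"
proof -
  have e: "b (of_real x + \<i> * of_real y) (of_real x + \<i> * of_real y) = x\<^sup>2 * b 1 1 + x * y * (b 1 \<i> + b \<i> 1) + y\<^sup>2 * b \<i> \<i>" for x y
  proof -
    have "of_real x + \<i> * of_real y = x *\<^sub>R 1 + y *\<^sub>R \<i>" by (simp add: complex_eq_iff)
    then show ?thesis
      by (simp only: linear_add[OF assms(1)] linear_scale[OF assms(1)] linear_add[OF assms(2)] linear_scale[OF assms(2)])
        (simp add: power2_eq_square algebra_simps)
  qed
  have "c = of_real (Re c) + \<i> * of_real (Im c)" "\<i> * c = of_real (- Im c) + \<i> * of_real (Re c)"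
    by (simp_all add: complex_eq_iff)
  then have "b c c + b (\<i> * c) (\<i> * c) = b (of_real (Re c) + \<i> * of_real (Im c)) (of_real (Re c) + \<i> * of_real (Im c))
      + b (of_real (- Im c) + \<i> * of_real (Re c)) (of_real (- Im c) + \<i> * of_real (Re c))" by metis
  then show ?thesis unfolding e cmod_power2 lap_def by (simp add: algebra_simps)
qed

lemma grad_rotation_invariant:
  fixes l :: "complex \<Rightarrow> real"
  assumes l: "linear l"
  shows "(l c)\<^sup>2 + (l (\<i> * c))\<^sup>2 = (norm c)\<^sup>2 * ((l 1)\<^sup>2 + (l \<i>)\<^sup>2)"
proof -
  have c: "c = Re c *\<^sub>R 1 + Im c *\<^sub>R \<i>" "\<i> * c = (- Im c) *\<^sub>R 1 + Re c *\<^sub>R \<i>"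
    by (simp_all add: complex_eq_iff)
  have "l c = Re c * l 1 + Im c * l \<i>" "l (\<i> * c) = - Im c * l 1 + Re c * l \<i>"
    by (subst c(1), simp add: linear_add[OF l] linear_scale[OF l])
      (subst c(2), simp only: linear_add[OF l] linear_scale[OF l] real_scaleR_def)
  then show ?thesis unfolding cmod_power2 by (simp only:) (simp add: power2_eq_square algebra_simps)
qed

section \<open>Comparison of local defining functions\<close>

definition C2_defines :: "'a::euclidean_space set \<Rightarrow> 'a set \<Rightarrow> ('a \<Rightarrow> real) \<Rightarrow> ('a \<Rightarrow> 'a \<Rightarrow> real) \<Rightarrow> ('a \<Rightarrow> 'a \<Rightarrow> 'a \<Rightarrow> real) \<Rightarrow> bool"
  where "C2_defines S V r D B \<longleftrightarrow> C2_derivs V r D B \<and> S \<inter> V = {x\<in>V. r x < 0} \<and> (\<forall>x\<in>V. \<exists>v. D x v \<noteq> 0)"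

lemma local_defining_function_C2:
  assumes "local_defining_function S p V r" "Ck_on 2 V r"
  obtains D B where "p \<in> V" "C2_defines S V r D B"
proof -
  have V: "open V" "p \<in> V" "S \<inter> V = {x\<in>V. r x < 0}" "\<forall>x\<in>V. \<exists>v. frechet_derivative r (at x) v \<noteq> 0"
    using assms(1) by (auto simp: local_defining_function_def)
  show ?thesis
    by (rule that[OF V(2)], unfold C2_defines_def, rule conjI[OF Ck_on_2_imp_C2_derivs[OF V(1) assms(2)] conjI[OF V(3,4)]])
qed

lemma C2_defines_zero:
  assumes S: "open S" and r: "C2_defines S V r D B" and x: "x \<in> V" "x \<in> frontier S"
  shows "r x = 0"
proof (rule antisym)
  have C: "C2_derivs V r D B" and neg: "S \<inter> V = {x\<in>V. r x < 0}" using r unfolding C2_defines_def by blast+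
  have V: "open V" by (rule C2_derivsD(1)[OF C])
  have "x \<notin> S" using x(2) S by (simp add: frontier_def interior_open)
  then have "\<not> r x < 0" using neg x(1) by blast
  then show "0 \<le> r x" by simp
  show "r x \<le> 0"
  proof (rule ccontr)
    assume "\<not> r x \<le> 0"
    define W where "W = V \<inter> r -` {0<..}"
    have "open W" unfolding W_def
      by (rule continuous_open_preimage[OF C2_derivs_continuous0[OF C] V]) simp
    moreover have "x \<in> W" using x \<open>\<not> r x \<le> 0\<close> by (auto simp: W_def)
    moreover have "x \<in> closure S" using x(2) by (simp add: frontier_def)
    ultimately have "S \<inter> W \<noteq> {}" using open_Int_closure_eq_empty[of W S] by (auto simp: Int_commute)
    then obtain y where "y \<in> S \<inter> V" "0 < r y" unfolding W_def by blast
    then show False unfolding neg by simp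
  qed
qed

text \<open>A direction in which the second function decreases enters \<open>S\<close>, so the first
  cannot increase along it. An open half-space of one differential thus lies in a closed half-space
  of the other, and two such nonzero functionals are positive multiples of each other.\<close>

lemma C2_defines_proportional:
  fixes x :: "'a::euclidean_space"
  assumes S: "open S" and 1: "C2_defines S V1 r1 D1 B1" and 2: "C2_defines S V2 r2 D2 B2"
    and x: "x \<in> V1" "x \<in> V2" "x \<in> frontier S"
  obtains c where "c > 0" "\<And>v. D1 x v = c * D2 x v"
proof -
  have C: "C2_derivs V1 r1 D1 B1" "C2_derivs V2 r2 D2 B2" and neg: "S \<inter> V1 = {x\<in>V1. r1 x < 0}" "S \<inter> V2 = {x\<in>V2. r2 x < 0}"
    and nz: "\<exists>v. D1 x v \<noteq> 0" "\<exists>v. D2 x v \<noteq> 0"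
    using 1 2 x unfolding C2_defines_def by blast+
  note l1 = C2_derivs_linear1[OF C(1) x(1)] and l2 = C2_derivs_linear1[OF C(2) x(2)]
  have z: "r1 x = 0" "r2 x = 0" using C2_defines_zero[OF S 1 x(1,3)] C2_defines_zero[OF S 2 x(2,3)] by auto
  have half: "D1 x v \<le> 0" if v: "D2 x v < 0" for v
  proof (rule ccontr)
    assume "\<not> D1 x v \<le> 0"
    have "DERIV (\<lambda>t. r2 (x + t *\<^sub>R v)) 0 :> D2 x v" "DERIV (\<lambda>t. r1 (x + t *\<^sub>R v)) 0 :> D1 x v"
      using C2_derivs_line(1)[OF C(2), of x 0 v] C2_derivs_line(1)[OF C(1), of x 0 v] x by auto
    from DERIV_neg_dec_right[OF this(1) v] DERIV_pos_inc_right[OF this(2)] \<open>\<not> D1 x v \<le> 0\<close>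
    obtain d1 d2 where d: "d1 > 0" "d2 > 0" "\<And>h. 0 < h \<Longrightarrow> h < d1 \<Longrightarrow> r2 (x + h *\<^sub>R v) < 0"
       "\<And>h. 0 < h \<Longrightarrow> h < d2 \<Longrightarrow> r1 (x + h *\<^sub>R v) > 0"
      using z by (auto simp: not_le)
    have "open (V1 \<inter> V2)" using C2_derivsD(1)[OF C(1)] C2_derivsD(1)[OF C(2)] by auto
    then obtain d3 where d3: "d3 > 0" "ball x d3 \<subseteq> V1 \<inter> V2" using x open_contains_ball by blast
    define e3 where "e3 = d3 / (norm v + 1)"
    define h where "h = min (min d1 d2) e3 / 2"
    have p: "e3 > 0" using d3 by (simp add: e3_def add_nonneg_pos)
    have h: "0 < h" "h < d1" "h < d2" "h < e3"
      using d(1,2) p by (auto simp: h_def)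
    have "h * (norm v + 1) < d3" using h(4) by (simp add: e3_def pos_less_divide_eq add_nonneg_pos)
    then have "norm (h *\<^sub>R v) < d3" using h by (simp add: algebra_simps)
    then have "x + h *\<^sub>R v \<in> V1 \<inter> V2" using d3(2) by (auto simp: dist_norm subset_iff)
    moreover from this have "x + h *\<^sub>R v \<in> S" using d(3)[OF h(1,2)] neg(2) by blast
    ultimately have "r1 (x + h *\<^sub>R v) < 0" using neg(1) by blast
    then show False using d(4)[OF h(1,3)] by simp
  qed
  obtain v0 where v0: "D2 x v0 = -1"
  proof -
    obtain v where "D2 x v \<noteq> 0" using nz by blast
    then have "D2 x ((- 1 / D2 x v) *\<^sub>R v) = -1" by (simp only: linear_scale[OF l2]) simp
    then show ?thesis using that by blast
  qed
  define c where "c = - D1 x v0"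
  have zero: "D1 x u = 0" if u: "D2 x u = 0" for u
  proof (rule ccontr)
    assume ne: "D1 x u \<noteq> 0"
    \<comment> \<open>Adding \<open>s\<close> times \<open>u\<close> to \<open>v0\<close> raises
      \<open>D1 x\<close> to 1 and leaves \<open>D2 x\<close> at \<open>-1\<close>, against
      \<open>half\<close>.\<close>
    define s where "s = (1 - D1 x v0) / D1 x u"
    have "D2 x (s *\<^sub>R u + v0) = -1" using u v0 by (simp add: linear_add[OF l2] linear_scale[OF l2])
    then have "D1 x (s *\<^sub>R u + v0) \<le> 0" by (intro half) simp
    then show False using ne by (simp add: s_def linear_add[OF l1] linear_scale[OF l1])
  qed
  have pr: "D1 x v = c * D2 x v" for v
  proof -
    have "D1 x (v + D2 x v *\<^sub>R v0) = 0"
      by (rule zero) (simp add: linear_add[OF l2] linear_scale[OF l2] v0)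
    then show ?thesis by (simp add: linear_add[OF l1] linear_scale[OF l1] c_def algebra_simps)
  qed
  have "c \<ge> 0" using half[of v0] v0 by (simp add: c_def)
  moreover have "c \<noteq> 0" using nz(1) pr by auto
  ultimately show ?thesis using that[of c] pr by simp
qed

text \<open>On the compact set where \<open>a \<le> m\<close> the penalty \<open>b\<close> is
  positive, hence bounded away from zero, and a large multiple of it outweighs the minimum of
  \<open>a\<close>. This is how the coefficients of a defining function and of its square are
  found.\<close>

lemma penalty_constant:
  fixes a b :: "'a::topological_space \<Rightarrow> real"
  assumes S: "compact S" and a: "continuous_on S a" and b: "continuous_on S b" "\<And>s. s \<in> S \<Longrightarrow> 0 \<le> b s"
    and pos: "\<And>s. s \<in> S \<Longrightarrow> b s = 0 \<Longrightarrow> m < a s"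
  obtains A where "A \<ge> 0" "\<And>s. s \<in> S \<Longrightarrow> m < a s + A * b s"
proof -
  define S1 where "S1 = S \<inter> {s \<in> S. a s \<in> {..m}}"
  have S1: "compact S1"
  proof -
    have "closedin (top_of_set S) (S \<inter> a -` {..m})" using a by (intro continuous_closedin_preimage) auto
    then have "compact (S \<inter> a -` {..m})" using S closedin_compact by blast
    moreover have "S \<inter> a -` {..m} = S1" by (auto simp: S1_def)
    ultimately show ?thesis by simp
  qed
  show ?thesis
  proof (cases "S1 = {}")
    case True
    then have "m < a s + 0 * b s" if "s \<in> S" for s using that by (auto simp: S1_def)
    then show ?thesis using that[of 0] by simp
  next
    case False
    have sub: "S1 \<subseteq> S" by (auto simp: S1_def)
    obtain s1 where s1: "s1 \<in> S1" "\<And>s. s \<in> S1 \<Longrightarrow> b s1 \<le> b s"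
      using continuous_attains_inf[OF S1 False continuous_on_subset[OF b(1) sub]] by blast
    obtain s2 where s2: "s2 \<in> S1" "\<And>s. s \<in> S1 \<Longrightarrow> a s2 \<le> a s"
      using continuous_attains_inf[OF S1 False continuous_on_subset[OF a sub]] by blast
    have "b s1 \<noteq> 0" using pos[of s1] s1(1) by (auto simp: S1_def)
    then have \<beta>: "b s1 > 0" using b(2)[of s1] s1(1) by (auto simp: S1_def)
    define A where "A = (\<bar>m - a s2\<bar> + 1) / b s1"
    have A: "A \<ge> 0" using \<beta> by (simp add: A_def)
    have "m < a s + A * b s" if "s \<in> S" for s
    proof (cases "a s \<le> m")
      case True
      then have "s \<in> S1" using that by (simp add: S1_def)
      then have "A * b s1 \<le> A * b s" "a s2 \<le> a s" using s1 s2 A by (auto intro: mult_left_mono)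
      moreover have "A * b s1 = \<bar>m - a s2\<bar> + 1" using \<beta> by (simp add: A_def)
      ultimately show ?thesis by linarith
    next
      case False
      then show ?thesis using mult_nonneg_nonneg[OF A b(2)[OF that]] by linarith
    qed
    then show ?thesis using that A by blast
  qed
qed

section \<open>Boundary geometry of Hartogs domains\<close>

locale hartogs_C2 =
  fixes Dom :: "complex set" and \<phi> :: "complex \<Rightarrow> real" and D\<phi> B\<phi> and \<Omega> :: "(complex^2) set"
  assumes C\<phi>: "C2_derivs Dom \<phi> D\<phi> B\<phi>" and \<Omega>_eq: "\<Omega> = hartogs_domain Dom \<phi>" and bounded_\<Omega>: "bounded \<Omega>"
begin

lemma mem_\<Omega>: "p \<in> \<Omega> \<longleftrightarrow> p $ 1 \<in> Dom \<and> cmod (p $ 2) < exp (- \<phi> (p $ 1))"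
  by (simp add: \<Omega>_eq hartogs_domain_def)

lemma open_Dom: "open Dom" by (rule C2_derivsD(1)[OF C\<phi>])

lemma open_over_Dom: "open {p :: complex^2. p $ 1 \<in> Dom}"
  using open_vimage[OF open_Dom, of "\<lambda>p :: complex^2. p $ 1"]
  by (simp add: vimage_def continuous_on_component)

lemma continuous_on_gap: "continuous_on {p :: complex^2. p $ 1 \<in> Dom} (\<lambda>p. exp (- \<phi> (p $ 1)) - cmod (p $ 2))"
  by (intro continuous_intros continuous_on_compose2[OF C2_derivs_continuous0[OF C\<phi>]] continuous_on_component) auto

lemma open_\<Omega>: "open \<Omega>"
proof -
  have "open ({p :: complex^2. p $ 1 \<in> Dom} \<inter> (\<lambda>p. exp (- \<phi> (p $ 1)) - cmod (p $ 2)) -` {0<..})"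
    by (intro continuous_open_preimage continuous_on_gap open_over_Dom open_greaterThan)
  moreover have "{p :: complex^2. p $ 1 \<in> Dom} \<inter> (\<lambda>p. exp (- \<phi> (p $ 1)) - cmod (p $ 2)) -` {0<..} = \<Omega>"
    by (auto simp: mem_\<Omega>)
  ultimately show ?thesis by simp
qed

lemma frontier_notin: "p \<in> frontier \<Omega> \<Longrightarrow> p \<notin> \<Omega>"
  using open_\<Omega> by (simp add: frontier_def interior_open)

lemma compact_frontier: "compact (frontier \<Omega>)"
  using bounded_\<Omega> bounded_subset[OF bounded_closure[OF bounded_\<Omega>], of "frontier \<Omega>"]
  by (simp add: compact_eq_bounded_closed frontier_def closed_Diff)

lemma frontier_norm:
  assumes p: "p \<in> frontier \<Omega>" "p $ 1 \<in> Dom"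
  shows "cmod (p $ 2) = exp (- \<phi> (p $ 1))"
proof (rule antisym)
  show "exp (- \<phi> (p $ 1)) \<le> cmod (p $ 2)" using frontier_notin[OF p(1)] p(2) by (simp add: mem_\<Omega>)
  show "cmod (p $ 2) \<le> exp (- \<phi> (p $ 1))"
  proof (rule ccontr)
    assume n: "\<not> cmod (p $ 2) \<le> exp (- \<phi> (p $ 1))"
    define W where "W = {p :: complex^2. p $ 1 \<in> Dom} \<inter> (\<lambda>p. exp (- \<phi> (p $ 1)) - cmod (p $ 2)) -` {..<0}"
    have "open W" unfolding W_def
      by (intro continuous_open_preimage continuous_on_gap open_over_Dom open_lessThan)
    moreover have "p \<in> W" using n p by (simp add: W_def)
    moreover have "p \<in> closure \<Omega>" using p by (simp add: frontier_def)
    ultimately have "W \<inter> \<Omega> \<noteq> {}" using open_Int_closure_eq_empty[of W \<Omega>] by auto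
    then show False by (auto simp: W_def mem_\<Omega>)
  qed
qed

lemma frontierI:
  assumes z: "z \<in> Dom" and w: "cmod w = exp (- \<phi> z)"
  shows "pt z w \<in> frontier \<Omega>"
proof -
  have "pt z w \<in> closure \<Omega>"
  proof (rule closure_approachable[THEN iffD2, rule_format])
    fix e :: real assume e: "e > 0"
    have w0: "cmod w > 0" using w by simp
    define t where "t = min (1/2) (e / (2 * cmod w))"
    have t: "0 < t" "t \<le> 1/2" "t * cmod w < e"
    proof -
      show "0 < t" "t \<le> 1/2" using e w0 by (auto simp: t_def)
      have "t * cmod w \<le> e / (2 * cmod w) * cmod w" using w0 by (intro mult_right_mono) (auto simp: t_def)
      then show "t * cmod w < e" using e w0 by simp
    qed
    have "pt z ((1 - of_real t) * w) \<in> \<Omega>"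
    proof -
      have "cmod (1 - complex_of_real t) = 1 - t"
        using t norm_of_real[of "1 - t", where 'a = complex] by simp
      then show ?thesis using z w w0 t by (simp add: mem_\<Omega> norm_mult)
    qed
    moreover have "dist (pt z ((1 - of_real t) * w)) (pt z w) < e"
    proof -
      have "dist (pt z ((1 - of_real t) * w)) (pt z w) = norm (pt 0 (- of_real t * w))"
        unfolding dist_norm pt_diff by (simp add: algebra_simps)
      also have "\<dots> \<le> norm (0::complex) + norm (- of_real t * w)" by (rule norm_pt_le)
      also have "\<dots> < e" using t by (simp add: norm_mult)
      finally show ?thesis .
    qed
    ultimately show "\<exists>y\<in>\<Omega>. dist y (pt z w) < e" by blast
  qed
  moreover have "pt z w \<notin> \<Omega>" using w by (simp add: mem_\<Omega>)
  ultimately show ?thesis using open_\<Omega> by (simp add: frontier_def interior_open)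
qed

definition a\<phi> :: "complex \<Rightarrow> complex" where "a\<phi> z = Complex (- D\<phi> z 1) (D\<phi> z \<i>)"
text \<open>The real part of minus the second derivative of \<open>\<phi>\<close> in
  \<open>z\<close>. The squares of the stencil displacements are real, so an imaginary part, the
  mixed derivative, would not change the modulus of the second coordinate at the stencil
  points.\<close>

definition b\<phi> :: "complex \<Rightarrow> complex" where "b\<phi> z = of_real (- (B\<phi> z 1 1 - B\<phi> z \<i> \<i>) / 4)"

text \<open>Since \<open>a\<phi> z = -2 \<partial>\<phi>/\<partial>z\<close>, the disc \<open>\<zeta> \<mapsto> (z + \<zeta>, w exp (a\<phi> z \<zeta> + b\<phi> z \<zeta>\<^sup>2))\<close> osculates the boundary: at the points
  of the stencil it leaves it only by the Laplacian of \<open>\<phi>\<close>.\<close>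

lemma \<phi>_expansion:
  assumes K: "compact K" "K \<subseteq> Dom" and \<eta>: "\<eta> > 0"
  obtains h0 where "h0 > 0" "\<And>h z d. 0 < h \<Longrightarrow> h < h0 \<Longrightarrow> z \<in> K \<Longrightarrow> d \<in> dirs \<Longrightarrow> z + of_real h * d \<in> Dom"
    "\<And>h z d. 0 < h \<Longrightarrow> h < h0 \<Longrightarrow> z \<in> K \<Longrightarrow> d \<in> dirs \<Longrightarrow>
      \<bar>\<phi> (z + of_real h * d) - \<phi> z + Re (a\<phi> z * (of_real h * d) + b\<phi> z * (of_real h * d)\<^sup>2) - lap (B\<phi> z) / 4 * h\<^sup>2\<bar> \<le> \<eta> * h\<^sup>2"
proof -
  obtain \<delta> where d: "\<delta> > 0" "\<And>p v. p \<in> K \<Longrightarrow> norm v < \<delta> \<Longrightarrow> p + v \<in> Dom"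
    "\<And>p v. p \<in> K \<Longrightarrow> norm v < \<delta> \<Longrightarrow> \<bar>\<phi> (p + v) - \<phi> p - D\<phi> p v - B\<phi> p v v / 2\<bar> \<le> \<eta> * (norm v)\<^sup>2"
    by (rule C2_derivs_uniform_Taylor[OF C\<phi> K \<eta>]) (rule that)
  show ?thesis
  proof (rule that[OF d(1)])
    fix h z d assume h: "0 < h" "h < \<delta>" and z: "z \<in> K" and dd: "d \<in> dirs"
    have n: "norm (of_real h * d) = h" using h norm_dirs[OF dd] by (simp add: norm_mult)
    show "z + of_real h * d \<in> Dom" by (rule d(2)[OF z]) (use n h in simp)
    have zD: "z \<in> Dom" using z K by auto
    note l1 = C2_derivs_linear1[OF C\<phi> zD] and l2 = C2_derivs_linear2[OF C\<phi> zD] and l3 = C2_derivs_linear3[OF C\<phi> zD]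
    have sc: "D\<phi> z (of_real h * d) = h * D\<phi> z d" "B\<phi> z (of_real h * d) (of_real h * d) = h\<^sup>2 * B\<phi> z d d"
      using linear_scale[OF l1, of h d] linear_scale[OF l2, of _ h d] linear_scale[OF l3, of h d]
      by (simp_all add: scaleR_conv_of_real power2_eq_square)
    have e1: "Re (a\<phi> z * (of_real h * d)) = - D\<phi> z (of_real h * d)"
      using dd unfolding sc a\<phi>_def by (auto simp: dirs_def linear_neg[OF l1])
    have e2: "Re (b\<phi> z * (of_real h * d)\<^sup>2) = lap (B\<phi> z) / 4 * h\<^sup>2 - B\<phi> z (of_real h * d) (of_real h * d) / 2"
      using dd unfolding sc b\<phi>_def lap_def
      by (auto simp: dirs_def linear_neg[OF l2] linear_neg[OF l3] power2_eq_square field_simps)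
    have "\<bar>\<phi> (z + of_real h * d) - \<phi> z - D\<phi> z (of_real h * d) - B\<phi> z (of_real h * d) (of_real h * d) / 2\<bar> \<le> \<eta> * h\<^sup>2"
      using d(3)[OF z, of "of_real h * d"] n h by simp
    moreover have "\<phi> (z + of_real h * d) - \<phi> z + Re (a\<phi> z * (of_real h * d) + b\<phi> z * (of_real h * d)\<^sup>2) - lap (B\<phi> z) / 4 * h\<^sup>2
      = \<phi> (z + of_real h * d) - \<phi> z - D\<phi> z (of_real h * d) - B\<phi> z (of_real h * d) (of_real h * d) / 2"
      by (simp only: plus_complex.simps e1 e2)
    ultimately show "\<bar>\<phi> (z + of_real h * d) - \<phi> z + Re (a\<phi> z * (of_real h * d) + b\<phi> z * (of_real h * d)\<^sup>2) - lap (B\<phi> z) / 4 * h\<^sup>2\<bar> \<le> \<eta> * h\<^sup>2"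
      by simp
  qed
qed

definition \<rho>0 :: "complex^2 \<Rightarrow> real"
  where "\<rho>0 q = (q $ 2) \<bullet> (q $ 2) - exp (-2 * \<phi> (q $ 1))"
definition D\<rho>0 :: "complex^2 \<Rightarrow> complex^2 \<Rightarrow> real"
  where "D\<rho>0 q v = 2 * (q $ 2 \<bullet> v $ 2) + 2 * exp (-2 * \<phi> (q $ 1)) * D\<phi> (q $ 1) (v $ 1)"
definition B\<rho>0 :: "complex^2 \<Rightarrow> complex^2 \<Rightarrow> complex^2 \<Rightarrow> real"
  where "B\<rho>0 q v w = 2 * (w $ 2 \<bullet> v $ 2) + 2 * exp (-2 * \<phi> (q $ 1)) * B\<phi> (q $ 1) (v $ 1) (w $ 1)
     - 4 * exp (-2 * \<phi> (q $ 1)) * D\<phi> (q $ 1) (w $ 1) * D\<phi> (q $ 1) (v $ 1)"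

text \<open>Removing \<open>w = 0\<close> keeps the differential of \<open>\<rho>0\<close> from
  vanishing. No boundary point over \<open>Dom\<close> is lost, as there the modulus of
  \<open>w\<close> is an exponential.\<close>

definition V0 :: "(complex^2) set" where "V0 = {q. q $ 1 \<in> Dom \<and> q $ 2 \<noteq> 0}"

lemma \<rho>0_defines: "C2_defines \<Omega> V0 \<rho>0 D\<rho>0 B\<rho>0"
  unfolding C2_defines_def
proof (intro conjI)
  have oV: "open V0"
  proof -
    have "open {q :: complex^2. q $ 2 \<in> - {0}}"
      using open_vimage[of "- {0}" "\<lambda>q :: complex^2. q $ 2"] by (simp add: vimage_def continuous_on_component open_Compl)
    moreover have "V0 = {q. q $ 1 \<in> Dom} \<inter> {q. q $ 2 \<in> - {0}}" by (auto simp: V0_def)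
    ultimately show ?thesis using open_over_Dom by auto
  qed
  have L: "bounded_linear (\<lambda>q :: complex^2. q $ i)" for i by (rule bounded_linear_vec_nth)
  note A = C2_derivs_compose_affine[OF C2_derivs_inner_self[where 'a = complex] L, of 2 0]
  note E = C2_derivs_compose_affine[OF C2_derivs_exp_affine[OF C\<phi>, of "-2" 0] L, of 1 0]
  have A': "C2_derivs V0 (\<lambda>x :: complex^2. x $ 2 \<bullet> x $ 2) (\<lambda>x v. 2 * (x $ 2 \<bullet> v $ 2)) (\<lambda>x v w. 2 * (w $ 2 \<bullet> v $ 2))"
    by (rule C2_derivs_cong[OF C2_derivs_subset[OF A oV]]) simp_all
  have "V0 \<subseteq> {x. x $ 1 + 0 \<in> Dom}" by (auto simp: V0_def)
  note E' = C2_derivs_cmult[OF C2_derivs_subset[OF E oV this], of "-1"]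
  show "C2_derivs V0 \<rho>0 D\<rho>0 B\<rho>0"
    by (rule C2_derivs_cong[OF C2_derivs_add[OF A' E']]) (auto simp: \<rho>0_def D\<rho>0_def B\<rho>0_def)
  show "\<Omega> \<inter> V0 = {x \<in> V0. \<rho>0 x < 0}"
  proof -
    have "cmod w < exp (- \<phi> z) \<longleftrightarrow> w \<bullet> w - exp (-2 * \<phi> z) < 0" for w z
    proof -
      have "exp (-2 * \<phi> z) = (exp (- \<phi> z))\<^sup>2" by (simp add: exp_double[symmetric])
      then have "w \<bullet> w - exp (-2 * \<phi> z) < 0 \<longleftrightarrow> (cmod w)\<^sup>2 < (exp (- \<phi> z))\<^sup>2" by (simp add: dot_square_norm)
      also have "\<dots> \<longleftrightarrow> cmod w < exp (- \<phi> z)"        using power2_less_imp_less[of "cmod w" "exp (- \<phi> z)"] power_strict_mono[of "cmod w" "exp (- \<phi> z)" 2] by auto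
      finally show ?thesis by simp
    qed
    then show ?thesis by (auto simp: mem_\<Omega> V0_def \<rho>0_def)
  qed
  show "\<forall>x\<in>V0. \<exists>v. D\<rho>0 x v \<noteq> 0"
  proof
    fix x assume x: "x \<in> V0"
    have "linear (D\<phi> (x $ 1))" using C2_derivs_linear1[OF C\<phi>] x by (simp add: V0_def)
    then have "D\<rho>0 x (pt 0 (x $ 2)) = 2 * (x $ 2 \<bullet> x $ 2)" by (simp add: D\<rho>0_def linear_0)
    then show "\<exists>v. D\<rho>0 x v \<noteq> 0" using x by (intro exI[of _ "pt 0 (x $ 2)"]) (simp add: V0_def)
  qed
qed

lemma frontier_V0: "q \<in> frontier \<Omega> \<Longrightarrow> q $ 1 \<in> Dom \<Longrightarrow> q \<in> V0"
  using frontier_norm[of q] by (auto simp: V0_def)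

text \<open>Tangency determines the modulus of \<open>X $ 2\<close> from \<open>X $ 1\<close>, and
  the contribution of \<open>X $ 2\<close> cancels exactly the gradient terms of
  \<open>\<phi>\<close>. Only the Laplacian remains, and \<open>X $ 1 = 0\<close> would force
  \<open>X = 0\<close>.\<close>

lemma levi_\<rho>0_tangential:
  assumes q: "q \<in> frontier \<Omega>" "q $ 1 \<in> Dom" and t: "D\<rho>0 q X = 0" "D\<rho>0 q (\<i> *s X) = 0"
  shows "levi_of (B\<rho>0 q) X = exp (-2 * \<phi> (q $ 1)) / 2 * lap (B\<phi> (q $ 1)) * (norm (X $ 1))\<^sup>2"
    and "X \<noteq> 0 \<Longrightarrow> X $ 1 \<noteq> 0"
proof -
  define E where "E = exp (-2 * \<phi> (q $ 1))"
  have E: "E > 0" by (simp add: E_def)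
  have nq: "(norm (q $ 2))\<^sup>2 = E"
    unfolding frontier_norm[OF q] E_def by (simp add: exp_double[symmetric])
  note l1 = C2_derivs_linear1[OF C\<phi> q(2)] and l2 = C2_derivs_linear2[OF C\<phi> q(2)] and l3 = C2_derivs_linear3[OF C\<phi> q(2)]
  define G where "G = (D\<phi> (q $ 1) 1)\<^sup>2 + (D\<phi> (q $ 1) \<i>)\<^sup>2"
  have g: "(D\<phi> (q $ 1) (X $ 1))\<^sup>2 + (D\<phi> (q $ 1) (\<i> * X $ 1))\<^sup>2 = (norm (X $ 1))\<^sup>2 * G"
    unfolding G_def by (rule grad_rotation_invariant[OF l1])
  have t': "q $ 2 \<bullet> X $ 2 = - E * D\<phi> (q $ 1) (X $ 1)" "q $ 2 \<bullet> (\<i> * X $ 2) = - E * D\<phi> (q $ 1) (\<i> * X $ 1)"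
    using t by (simp_all add: D\<rho>0_def E_def)
  have "linear (\<lambda>c. q $ 2 \<bullet> c)" by (simp add: linear_iff inner_add_right)
  then have "(q $ 2 \<bullet> X $ 2)\<^sup>2 + (q $ 2 \<bullet> (\<i> * X $ 2))\<^sup>2 = (norm (X $ 2))\<^sup>2 * ((q $ 2 \<bullet> 1)\<^sup>2 + (q $ 2 \<bullet> \<i>)\<^sup>2)"
    by (rule grad_rotation_invariant)
  also have "(q $ 2 \<bullet> 1)\<^sup>2 + (q $ 2 \<bullet> \<i>)\<^sup>2 = E"
    unfolding nq[symmetric] cmod_power2 by (simp add: inner_complex_def)
  finally have "E\<^sup>2 * ((norm (X $ 1))\<^sup>2 * G) = (norm (X $ 2))\<^sup>2 * E"
    unfolding t' g[symmetric] by (simp add: power_mult_distrib algebra_simps)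
  then have X2: "(norm (X $ 2))\<^sup>2 = E * ((norm (X $ 1))\<^sup>2 * G)" using E by (simp add: power2_eq_square)
  have b: "B\<phi> (q $ 1) (X $ 1) (X $ 1) + B\<phi> (q $ 1) (\<i> * X $ 1) (\<i> * X $ 1) = (norm (X $ 1))\<^sup>2 * lap (B\<phi> (q $ 1))"
    by (rule lap_rotation_invariant[OF l2 l3])
  have "4 * levi_of (B\<rho>0 q) X = 4 * (norm (X $ 2))\<^sup>2
     + 2 * E * (B\<phi> (q $ 1) (X $ 1) (X $ 1) + B\<phi> (q $ 1) (\<i> * X $ 1) (\<i> * X $ 1))
     - 4 * E * ((D\<phi> (q $ 1) (X $ 1))\<^sup>2 + (D\<phi> (q $ 1) (\<i> * X $ 1))\<^sup>2)"
  proof -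
    have "4 * levi_of (B\<rho>0 q) X = B\<rho>0 q X X + B\<rho>0 q (\<i> *s X) (\<i> *s X)" by (simp add: levi_of_def)
    then show ?thesis
      unfolding B\<rho>0_def E_def[symmetric] vector_smult_component dot_square_norm norm_mult
      by (simp add: power2_eq_square algebra_simps)
  qed
  then show "levi_of (B\<rho>0 q) X = exp (-2 * \<phi> (q $ 1)) / 2 * lap (B\<phi> (q $ 1)) * (norm (X $ 1))\<^sup>2"
    unfolding b g X2 E_def[symmetric] by simp
  show "X $ 1 \<noteq> 0" if "X \<noteq> 0"
  proof
    assume "X $ 1 = 0"
    then have "X $ 2 = 0" using X2 by simp
    then show False using \<open>X $ 1 = 0\<close> that by (simp add: vec_eq_iff forall_2)
  qed
qed

text \<open>The tangent vector of the osculating disc is complex tangential to the boundary.\<close>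

lemma tangent_a\<phi>:
  assumes q: "q \<in> frontier \<Omega>" "q $ 1 \<in> Dom"
  shows "D\<rho>0 q (pt 1 (a\<phi> (q $ 1) * q $ 2)) = 0" "D\<rho>0 q (\<i> *s pt 1 (a\<phi> (q $ 1) * q $ 2)) = 0"
proof -
  have "(norm (q $ 2))\<^sup>2 = exp (-2 * \<phi> (q $ 1))"
    unfolding frontier_norm[OF q] by (simp add: exp_double[symmetric])
  then have nq: "Re (q $ 2) * Re (q $ 2) + Im (q $ 2) * Im (q $ 2) = exp (-2 * \<phi> (q $ 1))"
    unfolding cmod_power2 by (simp add: power2_eq_square)
  show "D\<rho>0 q (pt 1 (a\<phi> (q $ 1) * q $ 2)) = 0"
    unfolding D\<rho>0_def nq[symmetric] a\<phi>_def by (simp add: inner_complex_def algebra_simps)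
  show "D\<rho>0 q (\<i> *s pt 1 (a\<phi> (q $ 1) * q $ 2)) = 0"
    unfolding D\<rho>0_def nq[symmetric] a\<phi>_def by (simp add: inner_complex_def algebra_simps)
qed

text \<open>Pseudoconvexity speaks of some C2 defining function \<open>r\<close>; a disc argument
  avoids comparing its Hessian with that of \<open>\<rho>0\<close>. If the Laplacian were negative,
  the osculating disc pushed outward by \<open>exp (\<tau> * h\<^sup>2)\<close> would still have its
  four stencil points in \<open>\<Omega>\<close>, so \<open>r\<close> would have a negative sum
  there. But the push contributes \<open>4 * \<tau> * k * h\<^sup>2\<close>, the Levi term is
  nonnegative, and the error takes at most half of the push.\<close>

lemma pseudoconvex_imp_subharmonic:
  assumes z: "z \<in> Dom" and psc: "pseudoconvex_at \<Omega> (pt z (of_real (exp (- \<phi> z))))"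
  shows "lap (B\<phi> z) \<ge> 0"
proof (rule ccontr)
  assume neg: "\<not> lap (B\<phi> z) \<ge> 0"
  define w where "w = complex_of_real (exp (- \<phi> z))"
  define p where "p = pt z w"
  have nw: "cmod w = exp (- \<phi> z)" by (simp add: w_def)
  have pF: "p \<in> frontier \<Omega>" unfolding p_def by (rule frontierI[OF z nw])
  have pz: "p $ 1 = z" "p $ 2 = w" by (simp_all add: p_def)
  obtain V r where "local_defining_function \<Omega> p V r" "Ck_on 2 V r" and
    ps: "\<forall>X. del_pairing r p X = 0 \<longrightarrow> 0 \<le> levi_form r p X"
    using psc unfolding pseudoconvex_at_def p_def w_def by blast
  then obtain D B where pV: "p \<in> V" and def: "C2_defines \<Omega> V r D B"
    using local_defining_function_C2 by metis
  have C: "C2_derivs V r D B" and rneg: "\<Omega> \<inter> V = {x\<in>V. r x < 0}" using def by (auto simp: C2_defines_def)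
  have pV0: "p \<in> V0" by (rule frontier_V0[OF pF]) (simp add: pz z)
  obtain c where c: "c > 0" "\<And>v. D p v = c * D\<rho>0 p v"
    by (rule C2_defines_proportional[OF open_\<Omega> def \<rho>0_defines pV pV0 pF]) (rule that)
  define X where "X = pt 1 (a\<phi> z * w)"
  have "D p X = 0" "D p (\<i> *s X) = 0"
    using tangent_a\<phi>[OF pF] z unfolding c(2) X_def by (simp_all add: pz)
  then have LX: "0 \<le> levi_of (B p) X"
    using ps C2_derivs_del_pairing_eq_0_iff[OF C pV] C2_derivs_levi_form[OF C pV] by simp
  have r0: "r p = 0" by (rule C2_defines_zero[OF open_\<Omega> def pV pF])
  note lD = C2_derivs_linear1[OF C pV]
  \<comment> \<open>The expansion of \<open>\<phi>\<close> leaves a margin of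
    \<open>2 * \<tau> * h\<^sup>2\<close>: one half is used for the push, and a quarter covers the
    Taylor error.\<close>
  define \<tau> where "\<tau> = - lap (B\<phi> z) / 8"
  have \<tau>: "\<tau> > 0" using neg by (simp add: \<tau>_def)
  define k where "k = D p (pt 0 w)"
  have k: "k > 0"
  proof -
    have "D\<rho>0 p (pt 0 w) = 2 * (w \<bullet> w)"
      using C2_derivs_linear1[OF C\<phi> z] by (simp add: D\<rho>0_def pz linear_0)
    moreover have "w \<noteq> 0" by (simp add: w_def)
    ultimately show ?thesis using c by (simp add: k_def)
  qed
  define A where "A = Max {cmod w, cmod (a\<phi> z), cmod (b\<phi> z), \<tau>}"
  have A: "cmod w \<le> A" "cmod (a\<phi> z) \<le> A" "cmod (b\<phi> z) \<le> A" "\<tau> \<le> A" by (simp_all add: A_def)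
  have A0: "A \<ge> 0" using A(1) norm_ge_zero order_trans by blast
  have pos: "2 * \<tau> * k > 0" using \<tau> k by simp
  obtain h1 where h1: "h1 > 0 \<and> (\<forall>h z w a b e. 0 < h \<longrightarrow> h < h1 \<longrightarrow> pt z w \<in> {p} \<longrightarrow> norm w \<le> A \<longrightarrow> norm a \<le> A \<longrightarrow> norm b \<le> A \<longrightarrow>
    (\<forall>d\<in>dirs. norm (e d) \<le> A * h\<^sup>2) \<longrightarrow>
    (\<forall>d\<in>dirs. pt (z + of_real h * d) (w * exp (a * (of_real h * d) + b * (of_real h * d)\<^sup>2 + e d)) \<in> V) \<and>
    \<bar>(\<Sum>d\<in>dirs. r (pt (z + of_real h * d) (w * exp (a * (of_real h * d) + b * (of_real h * d)\<^sup>2 + e d))))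
       - 4 * r (pt z w) - D (pt z w) (pt 0 (w * (\<Sum>d\<in>dirs. e d))) - 4 * h\<^sup>2 * levi_of (B (pt z w)) (pt 1 (a * w))\<bar> \<le> 2 * \<tau> * k * h\<^sup>2)"
    using C2_derivs_hartogs_stencil[OF C _ _ A0 pos, of "{p}"] pV by auto
  have "\<tau> / 2 > 0" using \<tau> by simp
  then obtain h2 where h2: "h2 > 0" "\<And>h y d. 0 < h \<Longrightarrow> h < h2 \<Longrightarrow> y \<in> {z} \<Longrightarrow> d \<in> dirs \<Longrightarrow> y + of_real h * d \<in> Dom"
    "\<And>h y d. 0 < h \<Longrightarrow> h < h2 \<Longrightarrow> y \<in> {z} \<Longrightarrow> d \<in> dirs \<Longrightarrow>
      \<bar>\<phi> (y + of_real h * d) - \<phi> y + Re (a\<phi> y * (of_real h * d) + b\<phi> y * (of_real h * d)\<^sup>2) - lap (B\<phi> y) / 4 * h\<^sup>2\<bar> \<le> \<tau> / 2 * h\<^sup>2"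
    by (rule \<phi>_expansion[of "{z}", rotated 2]) (use z in \<open>simp_all\<close>)
  define h where "h = min h1 h2 / 2"
  have h: "0 < h" "h < h1" "h < h2" using h1 h2(1) by (auto simp: h_def)
  define e where "e = (\<lambda>d :: complex. complex_of_real (\<tau> * h\<^sup>2))"
  define P where "P d = pt (z + of_real h * d) (w * exp (a\<phi> z * (of_real h * d) + b\<phi> z * (of_real h * d)\<^sup>2 + e d))" for d
  have "(\<forall>d\<in>dirs. P d \<in> V) \<and> \<bar>(\<Sum>d\<in>dirs. r (P d)) - 4 * r p - D p (pt 0 (w * (\<Sum>d\<in>dirs. e d))) - 4 * h\<^sup>2 * levi_of (B p) X\<bar> \<le> 2 * \<tau> * k * h\<^sup>2"
    unfolding P_def p_def X_def
    by (rule h1[THEN conjunct2, rule_format])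
      (use h A \<tau> in \<open>auto simp: e_def p_def norm_mult norm_power mult_right_mono simp del: of_real_mult of_real_power\<close>)
  then have PV: "\<And>d. d \<in> dirs \<Longrightarrow> P d \<in> V" and
    est: "\<bar>(\<Sum>d\<in>dirs. r (P d)) - 4 * r p - D p (pt 0 (w * (\<Sum>d\<in>dirs. e d))) - 4 * h\<^sup>2 * levi_of (B p) X\<bar> \<le> 2 * \<tau> * k * h\<^sup>2"
    by auto
  have "r (P d) < 0" if d: "d \<in> dirs" for d
  proof -
    define s where "s = a\<phi> z * (of_real h * d) + b\<phi> z * (of_real h * d)\<^sup>2"
    have "\<bar>\<phi> (z + of_real h * d) - \<phi> z + Re s - lap (B\<phi> z) / 4 * h\<^sup>2\<bar> \<le> \<tau> / 2 * h\<^sup>2"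
      unfolding s_def by (rule h2(3)[OF h(1,3) _ d]) simp
    moreover have "lap (B\<phi> z) / 4 * h\<^sup>2 = - 2 * \<tau> * h\<^sup>2" by (simp add: \<tau>_def)
    moreover have "0 < \<tau> * h\<^sup>2" using \<tau> h by simp
    ultimately have lt: "- \<phi> z + Re s + \<tau> * h\<^sup>2 < - \<phi> (z + of_real h * d)"
      by (simp only: abs_le_iff) linarith
    have "cmod (P d $ 2) = exp (- \<phi> z) * exp (Re s + \<tau> * h\<^sup>2)"
      by (simp add: P_def norm_mult nw e_def s_def)
    also have "\<dots> = exp (- \<phi> z + Re s + \<tau> * h\<^sup>2)" by (simp add: exp_add[symmetric] add.assoc)
    also have "\<dots> < exp (- \<phi> (z + of_real h * d))" using lt by simp
    finally have "P d \<in> \<Omega>" using h2(2)[OF h(1,3) _ d] by (simp add: mem_\<Omega> P_def)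
    then show ?thesis using rneg PV[OF d] by auto
  qed
  then have "(\<Sum>d\<in>dirs. r (P d)) < (\<Sum>d\<in>dirs. 0)"
    by (intro sum_strict_mono) (auto simp: dirs_def)
  then have "(\<Sum>d\<in>dirs. r (P d)) < 0" by simp
  moreover have "D p (pt 0 (w * (\<Sum>d\<in>dirs. e d))) = 4 * \<tau> * h\<^sup>2 * k"
  proof -
    have "pt 0 (w * (\<Sum>d\<in>dirs. e d)) = (4 * \<tau> * h\<^sup>2) *\<^sub>R pt 0 w"
      by (simp add: e_def pt_scaleR scaleR_conv_of_real[where 'a = complex] ac_simps)
    then show ?thesis by (simp add: linear_scale[OF lD] k_def)
  qed
  moreover have "0 \<le> 4 * h\<^sup>2 * levi_of (B p) X" using LX by simp
  moreover have "0 < \<tau> * k * h\<^sup>2" using \<tau> k h by simp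
  moreover have "4 * \<tau> * h\<^sup>2 * k = 4 * (\<tau> * k * h\<^sup>2)" "2 * \<tau> * k * h\<^sup>2 = 2 * (\<tau> * k * h\<^sup>2)" by simp_all
  ultimately show False using est r0 by (simp only: abs_le_iff) linarith
qed

end

lemma grad2_of_eq_0_iff: "grad2_of l X = 0 \<longleftrightarrow> l X = 0 \<and> l (\<i> *s X) = 0"
  by (auto simp: grad2_of_def sum_power2_eq_zero_iff)

lemma C2_defines_subset:
  assumes "C2_defines S V r D B" "open W" "W \<subseteq> V"
  shows "C2_defines S W r D B"
proof -
  have "C2_derivs W r D B" using assms C2_derivs_subset unfolding C2_defines_def by blast
  then show ?thesis using assms(1,3) unfolding C2_defines_def by blast
qed

context hartogs_C2
begin

text \<open>A boundary point over \<open>\<partial>D\<close> off the base would put a vertical disc around the base point into the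
  boundary, against strict pseudoconvexity there.\<close>

lemma frontier_base:
  assumes spsc: "\<And>p. p \<in> frontier \<Omega> \<Longrightarrow> p $ 2 = 0 \<Longrightarrow> strictly_pseudoconvex_at \<Omega> p"
    and q: "q \<in> frontier \<Omega>" "q $ 1 \<notin> Dom"
  shows "q $ 2 = 0"
proof (rule ccontr)
  assume w: "q $ 2 \<noteq> 0"
  define z where "z = q $ 1"
  \<comment> \<open>Scaling \<open>w\<close> by a factor of modulus at most one maps
    \<open>\<Omega>\<close>, hence its closure, into itself; points over \<open>z\<close> are not in
    \<open>\<Omega>\<close> because \<open>z\<close> is not in \<open>Dom\<close>.\<close>
  have disc: "pt z w' \<in> frontier \<Omega>" if w': "cmod w' \<le> cmod (q $ 2)" for w'
  proof -
    define c where "c = w' / q $ 2"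
    have c: "cmod c \<le> 1" using w' w by (simp add: c_def norm_divide)
    define f where "f = (\<lambda>y :: complex^2. pt (y $ 1) (y $ 2 * c))"
    have "continuous_on (closure \<Omega>) f"
      unfolding f_def pt_def
    proof (intro continuous_on_vec_lambda)
      fix i :: 2
      show "continuous_on (closure \<Omega>) (\<lambda>y :: complex^2. if i = 1 then y $ 1 else y $ 2 * c)"
        by (cases "i = 1") (auto intro!: continuous_intros continuous_on_component)
    qed
    moreover have "f ` \<Omega> \<subseteq> closure \<Omega>"
    proof -
      have "f y \<in> \<Omega>" if y: "y \<in> \<Omega>" for y
      proof -
        have "cmod (y $ 2 * c) \<le> cmod (y $ 2) * 1" unfolding norm_mult using c by (intro mult_left_mono) auto
        then show ?thesis using y by (simp add: mem_\<Omega> f_def)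
      qed
      then show ?thesis using closure_subset by blast
    qed
    ultimately have "f ` closure \<Omega> \<subseteq> closure \<Omega>" by (rule image_closure_subset[OF _ closed_closure])
    moreover have "q \<in> closure \<Omega>" using q by (simp add: frontier_def)
    ultimately have "f q \<in> closure \<Omega>" by blast
    moreover have "f q = pt z w'" using w by (simp add: f_def z_def c_def)
    moreover have "pt z w' \<notin> \<Omega>" using q by (simp add: mem_\<Omega> z_def)
    ultimately show ?thesis using open_\<Omega> by (simp add: frontier_def interior_open)
  qed
  define p where "p = pt z 0"
  have pF: "p \<in> frontier \<Omega>" unfolding p_def by (rule disc) simp
  have "strictly_pseudoconvex_at \<Omega> p" by (rule spsc[OF pF]) (simp add: p_def)
  then obtain V r where "local_defining_function \<Omega> p V r" "Ck_on 2 V r" and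
    ps: "\<forall>X. X \<noteq> 0 \<and> del_pairing r p X = 0 \<longrightarrow> 0 < levi_form r p X"
    unfolding strictly_pseudoconvex_at_def by blast
  then obtain D B where pV: "p \<in> V" and def: "C2_defines \<Omega> V r D B"
    using local_defining_function_C2 by metis
  have C: "C2_derivs V r D B" using def unfolding C2_defines_def by blast
  obtain e where e: "e > 0" "ball p e \<subseteq> V" using C2_derivsD(1)[OF C] pV open_contains_ball by blast
  define \<delta> where "\<delta> = min e (cmod (q $ 2))"
  have \<delta>: "\<delta> > 0" using e w by (simp add: \<delta>_def)
  \<comment> \<open>\<open>r\<close> vanishes on a real segment through \<open>p\<close> in every
    vertical direction, so two derivatives along it vanish. The directions \<open>1\<close> and
    \<open>\<i>\<close> together annihilate the pairing and the Levi form on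
    \<open>pt 0 1\<close>.\<close>
  have flat: "D p (pt 0 u) = 0 \<and> B p (pt 0 u) (pt 0 u) = 0" if u: "cmod u = 1" for u
  proof -
    have pt: "p + t *\<^sub>R pt 0 u = pt z (t *\<^sub>R u)" for t by (simp add: p_def pt_scaleR pt_add)
    have inV: "p + t *\<^sub>R pt 0 u \<in> V" if "\<bar>t\<bar> < \<delta>" for t
    proof -
      have "norm (t *\<^sub>R pt 0 u) \<le> norm (0 :: complex) + norm (t *\<^sub>R u)" unfolding pt_scaleR scaleR_zero_right by (rule norm_pt_le)
      also have "\<dots> < e" using that u by (simp add: \<delta>_def)
      finally have "p + t *\<^sub>R pt 0 u \<in> ball p e" by (simp add: dist_norm)
      then show ?thesis using e by blast
    qed
    have zero: "r (p + t *\<^sub>R pt 0 u) = 0" if "\<bar>t\<bar> < \<delta>" for t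
    proof (rule C2_defines_zero[OF open_\<Omega> def inV[OF that]])
      show "p + t *\<^sub>R pt 0 u \<in> frontier \<Omega>" unfolding pt by (rule disc) (use that u in \<open>simp add: \<delta>_def\<close>)
    qed
    have D0: "D (p + t *\<^sub>R pt 0 u) (pt 0 u) = 0" if t: "\<bar>t\<bar> < \<delta>" for t
    proof (rule DERIV_local_const[OF C2_derivs_line(1)[OF C inV[OF t]]])
      show "0 < \<delta> - \<bar>t\<bar>" using t by simp
      show "\<forall>y. \<bar>t - y\<bar> < \<delta> - \<bar>t\<bar> \<longrightarrow> r (p + t *\<^sub>R pt 0 u) = r (p + y *\<^sub>R pt 0 u)"
      proof (intro allI impI)
        fix y assume "\<bar>t - y\<bar> < \<delta> - \<bar>t\<bar>"
        then have "\<bar>y\<bar> < \<delta>" by linarith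
        then show "r (p + t *\<^sub>R pt 0 u) = r (p + y *\<^sub>R pt 0 u)" using zero t by simp
      qed
    qed
    have "B (p + 0 *\<^sub>R pt 0 u) (pt 0 u) (pt 0 u) = 0"
    proof (rule DERIV_local_const[OF C2_derivs_line(2)[OF C inV] \<delta>])
      show "\<bar>0\<bar> < \<delta>" using \<delta> by simp
      show "\<forall>y. \<bar>0 - y\<bar> < \<delta> \<longrightarrow> D (p + 0 *\<^sub>R pt 0 u) (pt 0 u) = D (p + y *\<^sub>R pt 0 u) (pt 0 u)"
        using D0 D0[of 0] \<delta> by simp
    qed
    then show ?thesis using D0[of 0] \<delta> by simp
  qed
  have i1: "\<i> *s pt 0 1 = pt 0 \<i>" by (simp add: pt_smult)
  have "del_pairing r p (pt 0 1) = 0"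
    using flat[of 1] flat[of \<i>] by (simp add: C2_derivs_del_pairing_eq_0_iff[OF C pV] i1)
  moreover have "levi_form r p (pt 0 1) = 0"
    using flat[of 1] flat[of \<i>] by (simp add: C2_derivs_levi_form[OF C pV] levi_of_def i1)
  moreover have "pt 0 1 \<noteq> 0" by (simp add: vec_eq_iff forall_2)
  ultimately show False using ps by force
qed

text \<open>The conclusion drawn from a vanishing Levi form is independent of the defining function, so it
  survives patching.\<close>

definition psc_defining :: "(complex^2) set \<Rightarrow> (complex^2 \<Rightarrow> real) \<Rightarrow> (complex^2 \<Rightarrow> complex^2 \<Rightarrow> real) \<Rightarrow>
    (complex^2 \<Rightarrow> complex^2 \<Rightarrow> complex^2 \<Rightarrow> real) \<Rightarrow> bool"
  where "psc_defining V r D B \<longleftrightarrow> C2_defines \<Omega> V r D B \<and>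
    (\<forall>q\<in>V \<inter> frontier \<Omega>. \<forall>X. X \<noteq> 0 \<longrightarrow> D q X = 0 \<longrightarrow> D q (\<i> *s X) = 0 \<longrightarrow> 0 \<le> levi_of (B q) X \<and>
       (levi_of (B q) X = 0 \<longrightarrow> q $ 1 \<in> Dom \<and> lap (B\<phi> (q $ 1)) = 0 \<and> X $ 1 \<noteq> 0))"

text \<open>Over \<open>Dom\<close> the function \<open>\<rho>0\<close> serves, with the sign of its
  Levi form given by the Laplacian. The other boundary points lie on the base, where strictness
  makes the Levi form plus a multiple of the squared gradient positive on unit vectors. This is an
  open condition, so near such a point there are no null vectors at all.\<close>

lemma psc_defining_exists:
  assumes psc: "pseudoconvex \<Omega>"
    and spsc: "\<And>p. p \<in> frontier \<Omega> \<Longrightarrow> p $ 2 = 0 \<Longrightarrow> strictly_pseudoconvex_at \<Omega> p"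
    and p: "p \<in> frontier \<Omega>"
  shows "\<exists>V r D B. p \<in> V \<and> psc_defining V r D B"
proof (cases "p $ 1 \<in> Dom")
  case True
  have "psc_defining V0 \<rho>0 D\<rho>0 B\<rho>0"
    unfolding psc_defining_def
  proof (intro conjI[OF \<rho>0_defines] ballI allI impI)
    fix q X assume q: "q \<in> V0 \<inter> frontier \<Omega>" and X: "X \<noteq> 0" "D\<rho>0 q X = 0" "D\<rho>0 q (\<i> *s X) = 0"
    have qD: "q \<in> frontier \<Omega>" "q $ 1 \<in> Dom" using q by (auto simp: V0_def)
    have "lap (B\<phi> (q $ 1)) \<ge> 0"
    proof (rule pseudoconvex_imp_subharmonic[OF qD(2)])
      have "pt (q $ 1) (of_real (exp (- \<phi> (q $ 1)))) \<in> frontier \<Omega>" by (rule frontierI[OF qD(2)]) simp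
      then show "pseudoconvex_at \<Omega> (pt (q $ 1) (of_real (exp (- \<phi> (q $ 1)))))" using psc by (simp add: pseudoconvex_def)
    qed
    then have "0 \<le> exp (-2 * \<phi> (q $ 1)) / 2 * lap (B\<phi> (q $ 1)) * (norm (X $ 1))\<^sup>2" by simp
    then show "0 \<le> levi_of (B\<rho>0 q) X \<and>
       (levi_of (B\<rho>0 q) X = 0 \<longrightarrow> q $ 1 \<in> Dom \<and> lap (B\<phi> (q $ 1)) = 0 \<and> X $ 1 \<noteq> 0)"
      using levi_\<rho>0_tangential(2)[OF qD X(2,3,1)] qD unfolding levi_\<rho>0_tangential(1)[OF qD X(2,3)]
      by simp
  qed
  then show ?thesis using frontier_V0[OF p True] by blast
next
  case False
  have "strictly_pseudoconvex_at \<Omega> p" by (rule spsc[OF p frontier_base[OF spsc p False]])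
  then obtain V r where "local_defining_function \<Omega> p V r" "Ck_on 2 V r" and
    ps: "\<forall>X. X \<noteq> 0 \<and> del_pairing r p X = 0 \<longrightarrow> 0 < levi_form r p X"
    unfolding strictly_pseudoconvex_at_def by blast
  then obtain D B where pV: "p \<in> V" and def: "C2_defines \<Omega> V r D B"
    using local_defining_function_C2 by metis
  have C: "C2_derivs V r D B" using def unfolding C2_defines_def by blast
  define L where "L = (\<lambda>x. levi_of (B (fst x)) (snd x))"
  define G where "G = (\<lambda>x. grad2_of (D (fst x)) (snd x))"
  have cL: "continuous_on (V \<times> UNIV) L" and cG: "continuous_on (V \<times> UNIV) G"
    unfolding L_def G_def by (rule continuous_on_levi_of[OF C] continuous_on_grad2_of[OF C])+
  have "compact ({p} \<times> sphere (0 :: complex^2) 1)" by (intro compact_Times compact_sphere) simp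
  moreover have "continuous_on ({p} \<times> sphere 0 1) L" "continuous_on ({p} \<times> sphere 0 1) G"
    by (rule continuous_on_subset[OF cL] continuous_on_subset[OF cG], use pV in auto)+
  moreover have "0 \<le> G x" for x by (simp add: G_def grad2_of_nonneg)
  moreover have "0 < L x" if x: "x \<in> {p} \<times> sphere 0 1" "G x = 0" for x
  proof -
    obtain X where X: "x = (p, X)" "norm X = 1" using x(1) by auto
    have "del_pairing r p X = 0"
      using x(2) by (simp add: X(1) G_def grad2_of_eq_0_iff C2_derivs_del_pairing_eq_0_iff[OF C pV])
    moreover have "X \<noteq> 0" using X(2) by auto
    ultimately show ?thesis using ps C2_derivs_levi_form[OF C pV] by (auto simp: L_def X(1))
  qed
  ultimately obtain N where N: "N \<ge> 0" "\<And>x. x \<in> {p} \<times> sphere 0 1 \<Longrightarrow> 0 < L x + N * G x"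
    using penalty_constant[of "{p} \<times> sphere (0 :: complex^2) 1" L G 0] by metis
  define W where "W = {z \<in> V. \<forall>X\<in>sphere 0 1. 0 < L (z, X) + N * G (z, X)}"
  have W: "open W" "W \<subseteq> V" "p \<in> W"
  proof -
    show "open W" unfolding W_def
      by (rule open_sphere_condition[OF C2_derivsD(1)[OF C], of "\<lambda>x. L x + N * G x" 0])
        (intro continuous_intros cL cG)
    show "W \<subseteq> V" by (auto simp: W_def)
    show "p \<in> W" using pV N(2) by (auto simp: W_def)
  qed
  have "psc_defining W r D B"
    unfolding psc_defining_def
  proof (intro conjI[OF C2_defines_subset[OF def W(1,2)]] ballI allI impI)
    fix q X assume q: "q \<in> W \<inter> frontier \<Omega>" and X: "X \<noteq> 0" "D q X = 0" "D q (\<i> *s X) = 0"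
    have qV: "q \<in> V" using q W by auto
    define Y where "Y = X /\<^sub>R norm X"
    have Y: "norm Y = 1" "X = norm X *\<^sub>R Y" using X(1) by (auto simp: Y_def)
    have "grad2_of (D q) X = 0" using X by (simp add: grad2_of_eq_0_iff)
    then have "grad2_of (D q) Y = 0"
      using grad2_of_scale[OF C2_derivs_linear1[OF C qV], of "inverse (norm X)" X] by (simp add: Y_def)
    moreover have "0 < L (q, Y) + N * G (q, Y)" using q Y(1) by (auto simp: W_def)
    ultimately have "0 < levi_of (B q) Y" by (simp add: L_def G_def)
    then have "0 < (norm X)\<^sup>2 * levi_of (B q) Y" using X by simp
    also have "\<dots> = levi_of (B q) X" using levi_of_scale[OF C qV, of "norm X" Y] Y(2) by simp
    finally show "0 \<le> levi_of (B q) X \<and>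
       (levi_of (B q) X = 0 \<longrightarrow> q $ 1 \<in> Dom \<and> lap (B\<phi> (q $ 1)) = 0 \<and> X $ 1 \<noteq> 0)" by simp
  qed
  then show ?thesis using W(3) by blast
qed

text \<open>A cut-off sum of local defining functions. On the boundary they all vanish and their
  differentials are positive multiples of one another, so they share their complex tangent vectors;
  on these the terms with derivatives of the cut-offs drop out and the Levi forms add up with
  nonnegative weights.\<close>

lemma global_defining:
  assumes psc: "pseudoconvex \<Omega>"
    and spsc: "\<And>p. p \<in> frontier \<Omega> \<Longrightarrow> p $ 2 = 0 \<Longrightarrow> strictly_pseudoconvex_at \<Omega> p"
  obtains r D B where "C2_derivs UNIV r D B" "\<And>q. q \<in> frontier \<Omega> \<Longrightarrow> r q = 0"
    "\<And>q X. q \<in> frontier \<Omega> \<Longrightarrow> X \<noteq> 0 \<Longrightarrow> D q X = 0 \<Longrightarrow> D q (\<i> *s X) = 0 \<Longrightarrow> 0 \<le> levi_of (B q) X"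
    "\<And>q X. q \<in> frontier \<Omega> \<Longrightarrow> X \<noteq> 0 \<Longrightarrow> D q X = 0 \<Longrightarrow> D q (\<i> *s X) = 0 \<Longrightarrow> levi_of (B q) X = 0 \<Longrightarrow>
       q $ 1 \<in> Dom \<and> lap (B\<phi> (q $ 1)) = 0 \<and> X $ 1 \<noteq> 0"
proof -
  have "\<forall>p\<in>frontier \<Omega>. \<exists>V r D B. p \<in> V \<and> psc_defining V r D B"
    using psc_defining_exists[OF psc spsc] by blast
  then obtain V r D B where pV: "\<And>p. p \<in> frontier \<Omega> \<Longrightarrow> p \<in> V p"
    and gd: "\<And>p. p \<in> frontier \<Omega> \<Longrightarrow> psc_defining (V p) (r p) (D p) (B p)"
    by metis
  have def: "C2_defines \<Omega> (V p) (r p) (D p) (B p)" if "p \<in> frontier \<Omega>" for p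
    using gd[OF that] unfolding psc_defining_def by blast
  have C: "C2_derivs (V p) (r p) (D p) (B p)" if "p \<in> frontier \<Omega>" for p
    using def[OF that] unfolding C2_defines_def by blast
  have "\<forall>p\<in>frontier \<Omega>. \<exists>e>0. cball p e \<subseteq> V p"
    using pV C2_derivsD(1)[OF C] open_contains_cball by blast
  then obtain e where e: "\<And>p. p \<in> frontier \<Omega> \<Longrightarrow> e p > 0" "\<And>p. p \<in> frontier \<Omega> \<Longrightarrow> cball p (e p) \<subseteq> V p"
    by metis
  obtain F where F: "finite F" "F \<subseteq> frontier \<Omega>" "frontier \<Omega> \<subseteq> (\<Union>p\<in>F. ball p (e p))"
  proof (rule compactE_image[OF compact_frontier, of "frontier \<Omega>" "\<lambda>p. ball p (e p)"])
    show "frontier \<Omega> \<subseteq> (\<Union>p\<in>frontier \<Omega>. ball p (e p))" using e(1) by auto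
  qed (use that in auto)
  define s where "s p = (\<lambda>x. (1 / e p) *\<^sub>R x + (- (1 / e p) *\<^sub>R p))" for p :: "complex^2"
  define \<beta> where "\<beta> p x = bump 3 (s p x)" for p x
  define \<beta>1 where "\<beta>1 p x v = bump1 3 (s p x) ((1 / e p) *\<^sub>R v)" for p x v
  define \<beta>2 where "\<beta>2 p x v w = bump2 3 (s p x) ((1 / e p) *\<^sub>R v) ((1 / e p) *\<^sub>R w)" for p x v w
  have C\<beta>: "C2_derivs UNIV (\<beta> p) (\<beta>1 p) (\<beta>2 p)" for p
    using C2_derivs_compose_affine[OF C2_derivs_bump[of 3] bounded_linear_scaleR_right[of "1 / e p"], of "- (1 / e p) *\<^sub>R p"]
    by (simp add: \<beta>_def[abs_def] \<beta>1_def[abs_def] \<beta>2_def[abs_def] s_def)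
  have ns: "norm (s p x) = dist p x / e p" if "p \<in> frontier \<Omega>" for p x
  proof -
    have "s p x = (1 / e p) *\<^sub>R (x - p)" by (simp add: s_def algebra_simps)
    then show ?thesis using e(1)[OF that] by (simp add: dist_norm norm_minus_commute)
  qed
  define f where "f p x = (if x \<in> V p then \<beta> p x * r p x else 0)" for p x
  define f1 where "f1 p x v = (if x \<in> V p then \<beta> p x * D p x v + \<beta>1 p x v * r p x else 0)" for p x v
  define f2 where "f2 p x v w = (if x \<in> V p then \<beta> p x * B p x v w + \<beta>1 p x w * D p x v
      + (\<beta>1 p x v * D p x w + \<beta>2 p x v w * r p x) else 0)" for p x v w
  have Cf: "C2_derivs UNIV (f p) (f1 p) (f2 p)" if p: "p \<in> frontier \<Omega>" for p
  proof -
    have out: "norm (s p x) \<ge> 1" if "x \<in> V p - cball p (e p)" for x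
      using that e(1)[OF p] by (simp add: ns[OF p])
    have "C2_derivs (V p) (\<lambda>x. \<beta> p x * r p x) (\<lambda>x v. \<beta> p x * D p x v + \<beta>1 p x v * r p x)
      (\<lambda>x v w. \<beta> p x * B p x v w + \<beta>1 p x w * D p x v + (\<beta>1 p x v * D p x w + \<beta>2 p x v w * r p x))"
      by (rule C2_derivs_mult[OF C2_derivs_subset[OF C\<beta> C2_derivsD(1)[OF C[OF p]]] C[OF p]]) simp
    from C2_derivs_extend_zero[OF this closed_cball e(2)[OF p]]
    show ?thesis
      unfolding f_def[abs_def] f1_def[abs_def] f2_def[abs_def]
      using bump_eq_0[OF out] bump1_eq_0[OF out] bump2_eq_0[OF out]
      by (simp add: \<beta>_def \<beta>1_def \<beta>2_def)
  qed
  define R where "R x = (\<Sum>p\<in>F. f p x)" for x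
  define R1 where "R1 x v = (\<Sum>p\<in>F. f1 p x v)" for x v
  define R2 where "R2 x v w = (\<Sum>p\<in>F. f2 p x v w)" for x v w
  have CR: "C2_derivs UNIV R R1 R2"
    unfolding R_def[abs_def] R1_def[abs_def] R2_def[abs_def]
    by (rule C2_derivs_sum[OF F(1) open_UNIV]) (use Cf F(2) in blast)
  have r0: "r p q = 0" if "p \<in> F" "q \<in> frontier \<Omega>" "q \<in> V p" for p q
    by (rule C2_defines_zero[OF open_\<Omega> def]) (use that F in auto)
  have R0: "R q = 0" if "q \<in> frontier \<Omega>" for q
    unfolding R_def f_def using r0[OF _ that] by (intro sum.neutral) auto
  have key: "0 \<le> levi_of (R2 q) X \<and> (levi_of (R2 q) X = 0 \<longrightarrow> q $ 1 \<in> Dom \<and> lap (B\<phi> (q $ 1)) = 0 \<and> X $ 1 \<noteq> 0)"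
    if q: "q \<in> frontier \<Omega>" and X: "X \<noteq> 0" "R1 q X = 0" "R1 q (\<i> *s X) = 0" for q X
  proof -
    obtain p0 where p0: "p0 \<in> F" "q \<in> ball p0 (e p0)" using F(3) q by blast
    have p0F: "p0 \<in> frontier \<Omega>" using p0 F by auto
    have q0: "q \<in> V p0" using e(2)[OF p0F] p0(2) by (auto simp: subset_iff)
    have \<beta>0: "\<beta> p0 q > 0"
      unfolding \<beta>_def by (rule bump_pos) (use p0(2) e(1)[OF p0F] in \<open>simp add: ns[OF p0F]\<close>)
    have \<beta>nn: "\<beta> p q \<ge> 0" for p by (simp add: \<beta>_def bump_bounds)
    have "\<exists>c>0. \<forall>v. D p q v = c * D p0 q v" if p: "p \<in> F" "q \<in> V p" for p
    proof -
      have "p \<in> frontier \<Omega>" using p F by auto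
      from C2_defines_proportional[OF open_\<Omega> def[OF this] def[OF p0F] p(2) q0 q] show ?thesis by metis
    qed
    then obtain c where c: "\<And>p. p \<in> F \<Longrightarrow> q \<in> V p \<Longrightarrow> c p > 0"
       "\<And>p v. p \<in> F \<Longrightarrow> q \<in> V p \<Longrightarrow> D p q v = c p * D p0 q v"
      by metis
    \<comment> \<open>The differential of the sum is \<open>k\<close> times \<open>D p0 q\<close>,
      and \<open>k\<close> is positive since \<open>q\<close> lies in the open ball where the
      cut-off of \<open>p0\<close> is positive.\<close>
    have D0: "D p0 q v = 0" if v: "R1 q v = 0" for v
    proof -
      define k where "k = (\<Sum>p\<in>F. if q \<in> V p then \<beta> p q * c p else 0)"
      have "R1 q v = (\<Sum>p\<in>F. (if q \<in> V p then \<beta> p q * c p else 0) * D p0 q v)"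
        unfolding R1_def f1_def using r0[OF _ q] c(2) by (intro sum.cong refl) simp
      then have "R1 q v = k * D p0 q v" by (simp only: k_def sum_distrib_right)
      moreover have "k > 0"
      proof -
        have "0 < (if q \<in> V p0 then \<beta> p0 q * c p0 else 0)" using q0 \<beta>0 c(1)[OF p0(1) q0] by simp
        also have "\<dots> \<le> k" unfolding k_def
          using c(1) \<beta>nn by (intro member_le_sum[OF p0(1) _ F(1)]) (auto intro!: mult_nonneg_nonneg intro: less_imp_le)
        finally show ?thesis .
      qed
      ultimately show ?thesis using v by simp
    qed
    have Dp: "D p q X = 0" "D p q (\<i> *s X) = 0" if "p \<in> F" "q \<in> V p" for p
      using c(2)[OF that] D0[OF X(2)] D0[OF X(3)] by simp_all
    have lev: "0 \<le> levi_of (B p q) X" if "p \<in> F" "q \<in> V p" for p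
      using gd[of p] that F(2) q X(1) Dp[OF that] unfolding psc_defining_def by blast
    define l where "l p = (if q \<in> V p then \<beta> p q * levi_of (B p q) X else 0)" for p
    have l: "0 \<le> l p" if "p \<in> F" for p using lev[OF that] \<beta>nn by (auto simp: l_def)
    have "levi_of (R2 q) X = (\<Sum>p\<in>F. levi_of (f2 p q) X)"
      by (simp add: levi_of_def R2_def sum.distrib[symmetric] sum_divide_distrib)
    also have "\<dots> = (\<Sum>p\<in>F. l p)"
    proof (rule sum.cong[OF refl])
      fix p assume p: "p \<in> F"
      show "levi_of (f2 p q) X = l p"
      proof (cases "q \<in> V p")
        case True
        then show ?thesis using Dp[OF p True] r0[OF p q True]
          by (simp add: l_def levi_of_def f2_def algebra_simps)
      next
        case False
        then show ?thesis by (simp add: l_def levi_of_def f2_def)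
      qed
    qed
    finally have lR: "levi_of (R2 q) X = (\<Sum>p\<in>F. l p)" .
    have "levi_of (B p0 q) X = 0" if "levi_of (R2 q) X = 0"
    proof -
      have "l p0 = 0" using that unfolding lR using sum_nonneg_eq_0_iff[OF F(1) l] p0(1) by simp
      then show ?thesis using q0 \<beta>0 by (simp add: l_def)
    qed
    moreover have "levi_of (B p0 q) X = 0 \<longrightarrow> q $ 1 \<in> Dom \<and> lap (B\<phi> (q $ 1)) = 0 \<and> X $ 1 \<noteq> 0"
      using gd[OF p0F] q0 q X(1) Dp[OF p0(1) q0] unfolding psc_defining_def by blast
    moreover have "0 \<le> levi_of (R2 q) X" unfolding lR using l by (rule sum_nonneg)
    ultimately show ?thesis by blast
  qed
  show ?thesis by (rule that[OF CR R0]) (use key in blast)+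
qed

end

subsection \<open>Averaging over rotations\<close>

lemma integral_periodic_shift:
  fixes f :: "real \<Rightarrow> real"
  assumes f: "continuous_on UNIV f" and per: "\<And>x. f (x + p) = f x" and p: "p > 0"
  shows "integral {0..p} (\<lambda>x. f (x + c)) = integral {0..p} f"
proof -
  have per_nat: "f (x + real n * p) = f x" for x and n :: nat
  proof (induction n)
    case (Suc n)
    have "f (x + real (Suc n) * p) = f ((x + real n * p) + p)" by (simp add: algebra_simps)
    then show ?case using per Suc by simp
  qed simp
  have per_int: "f (x + of_int n * p) = f x" for x and n :: int
  proof (cases n)
    case (nonneg k)
    then show ?thesis using per_nat by simp
  next
    case (neg k)
    have "of_int n = - real (Suc k)" using neg by simp
    then have "x = (x + of_int n * p) + real (Suc k) * p" by (simp only: mult_minus_left)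
    then have "f x = f ((x + of_int n * p) + real (Suc k) * p)" by (rule arg_cong)
    then show ?thesis by (simp only: per_nat)
  qed
  define c' where "c' = c - of_int \<lfloor>c / p\<rfloor> * p"
  have c': "0 \<le> c'" "c' \<le> p"
  proof -
    have "of_int \<lfloor>c / p\<rfloor> * p \<le> c / p * p" using p by (intro mult_right_mono) auto
    then show "0 \<le> c'" using p by (simp add: c'_def)
    have "c / p * p \<le> (of_int \<lfloor>c / p\<rfloor> + 1) * p" using p by (intro mult_right_mono) linarith+
    then show "c' \<le> p" using p by (simp add: c'_def algebra_simps)
  qed
  have int: "f integrable_on {a..b}" for a b
    by (intro integrable_continuous_real continuous_on_subset[OF f]) auto
  have "(\<lambda>x. f (x + c)) = f \<circ> (+) c'"
  proof
    fix x
    have "f (x + c) = f ((x + c') + of_int \<lfloor>c / p\<rfloor> * p)" by (simp add: c'_def)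
    then show "f (x + c) = (f \<circ> (+) c') x" by (simp add: per_int add.commute)
  qed
  then have "integral {0..p} (\<lambda>x. f (x + c)) = integral {0 + c'..p + c'} f"
    by (simp only: integral_shift_Icc_real)
  also have "\<dots> = integral {c'..p} f + integral {p..p + c'} f"
    using c' int Henstock_Kurzweil_Integration.integral_combine[of c' p "p + c'" f] by simp
  also have "integral {p..p + c'} f = integral {0..c'} f"
  proof -
    have "integral {0 + p..c' + p} f = integral {0..c'} (f \<circ> (+) p)" by (simp only: integral_shift_Icc_real)
    moreover have "f \<circ> (+) p = f" using per by (simp add: fun_eq_iff add.commute)
    ultimately show ?thesis by (simp add: add.commute)
  qed
  also have "integral {c'..p} f + integral {0..c'} f = integral {0..p} f"
    using c' int Henstock_Kurzweil_Integration.integral_combine[of 0 c' p f] by simp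
  finally show ?thesis .
qed

context hartogs_C2
begin

definition bdry :: "complex \<Rightarrow> real \<Rightarrow> complex^2"
  where "bdry z \<theta> = pt z (of_real (exp (- \<phi> z)) * cis \<theta>)"

lemma bdry_frontier: "z \<in> Dom \<Longrightarrow> bdry z \<theta> \<in> frontier \<Omega>"
  unfolding bdry_def by (rule frontierI) (simp_all add: norm_mult)

lemma continuous_on_bdry: "continuous_on S (bdry z)"
  unfolding bdry_def pt_def
proof (intro continuous_on_vec_lambda)
  fix i :: 2
  show "continuous_on S (\<lambda>\<theta>. if i = 1 then z else of_real (exp (- \<phi> z)) * cis \<theta>)"
    by (cases "i = 1") (auto intro!: continuous_intros)
qed

lemma bounded_coefficients:
  assumes K: "compact K" "K \<subseteq> Dom"
  obtains A where "A \<ge> 1" "\<And>z. z \<in> K \<Longrightarrow> exp (- \<phi> z) \<le> A" "\<And>z. z \<in> K \<Longrightarrow> norm (a\<phi> z) \<le> A" "\<And>z. z \<in> K \<Longrightarrow> norm (b\<phi> z) \<le> A"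
proof -
  have c: "continuous_on K (\<lambda>z. exp (- \<phi> z))" "continuous_on K a\<phi>" "continuous_on K b\<phi>"
    unfolding a\<phi>_def b\<phi>_def complex_eq
    by (intro continuous_intros continuous_on_subset[OF C2_derivs_continuous0[OF C\<phi>] K(2)]
        continuous_on_subset[OF C2_derivs_continuous1[OF C\<phi>] K(2)] continuous_on_subset[OF C2_derivsD(4)[OF C\<phi>] K(2)]; simp)+
  have bd: "\<exists>A. \<forall>z\<in>K. norm (f z) \<le> A" if "continuous_on K f" for f :: "complex \<Rightarrow> 'x::real_normed_vector"
    using compact_imp_bounded[OF compact_continuous_image[OF that K(1)]] by (auto simp: bounded_iff)
  obtain A1 where A1: "\<forall>z\<in>K. norm (exp (- \<phi> z)) \<le> A1" using bd[OF c(1)] by blast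
  obtain A2 where A2: "\<forall>z\<in>K. norm (a\<phi> z) \<le> A2" using bd[OF c(2)] by blast
  obtain A3 where A3: "\<forall>z\<in>K. norm (b\<phi> z) \<le> A3" using bd[OF c(3)] by blast
  show ?thesis
    by (rule that[of "Max {1, A1, A2, A3}"]) (use A1 A2 A3 in \<open>auto simp: le_max_iff_disj\<close>)
qed

text \<open>Along an osculating disc centred at a boundary point, \<open>exp (- g / 2)\<close>
  satisfies the supersolution inequality in stencil form. Where the Laplacian of
  \<open>\<phi>\<close> is small, the four points can be moved onto the boundary at small cost; they
  then differ from \<open>bdry\<close> at the same angle by phases, which the average over the angle
  removes. The average depends on \<open>z\<close> alone.\<close>

lemma averaged_supersolution:
  assumes Pt: "property_P_tilde (frontier \<Omega>)" and K: "compact K" "K \<subseteq> Dom"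
    and flat: "\<And>z. z \<in> K \<Longrightarrow> lap (B\<phi> z) = 0" and M: "M > 0"
  shows "\<exists>W u h0. compact W \<and> K \<subseteq> interior W \<and> h0 > 0 \<and> (\<forall>x. 0 \<le> u x) \<and> (\<forall>x\<in>W. 0 < u x) \<and>
    (\<forall>h x. 0 < h \<and> h < h0 \<and> x \<in> W \<longrightarrow> stencil h u x \<le> (4 - M * h\<^sup>2) * u x)"
proof -
  define F where "F = frontier \<Omega>"
  \<comment> \<open>Twice the required constant: half is spent on the Taylor error and on moving the
    stencil points, together at most \<open>M * m * h\<^sup>2\<close>.\<close>
  have "2 * M > 0" using M by simp
  then obtain U g D B where FU: "F \<subseteq> U" and Cg: "C2_derivs U g D B" and
    g: "\<forall>z\<in>U. \<forall>X. grad2_of (D z) X \<le> levi_of (B z) X \<and> 2 * M * (norm X)\<^sup>2 \<le> levi_of (B z) X"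
    using Pt unfolding property_P_tilde_iff F_def by blast
  define v where "v q = exp (- (1/2) * g q + 0)" for q
  define Dv where "Dv q X = - (1/2) * exp (- (1/2) * g q + 0) * D q X" for q X
  define Bv where "Bv q X Y = - (1/2) * exp (- (1/2) * g q + 0) * B q X Y
     + (- (1/2))\<^sup>2 * exp (- (1/2) * g q + 0) * D q Y * D q X" for q X Y
  have Cv: "C2_derivs U v Dv Bv"
    unfolding v_def[abs_def] Dv_def[abs_def] Bv_def[abs_def] by (rule C2_derivs_exp_affine[OF Cg])
  have vpos: "v q > 0" for q by (simp add: v_def)
  \<comment> \<open>The gradient condition costs only half of the negative term: the squared
    gradient minus twice the Levi form of \<open>g\<close> is at most minus the Levi form.\<close>
  have super: "4 * levi_of (Bv q) X \<le> - 2 * M * v q" if q: "q \<in> U" and X: "norm X \<ge> 1" for q X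
  proof -
    have "levi_of (Bv q) X = - (1/2) * v q * levi_of (B q) X + (- (1/2))\<^sup>2 * v q * grad2_of (D q) X"
      unfolding Bv_def[abs_def] v_def by (rule levi_of_exp_affine)
    then have "4 * levi_of (Bv q) X = v q * (grad2_of (D q) X - 2 * levi_of (B q) X)"
      by (simp add: power2_eq_square algebra_simps)
    also have "\<dots> \<le> v q * (- 2 * M)"
    proof (rule mult_left_mono)
      have "2 * M * 1 \<le> 2 * M * (norm X)\<^sup>2" using M X by (intro mult_left_mono) (auto simp: one_le_power)
      moreover have "grad2_of (D q) X \<le> levi_of (B q) X \<and> 2 * M * (norm X)\<^sup>2 \<le> levi_of (B q) X" using g q by blast
      ultimately show "grad2_of (D q) X - 2 * levi_of (B q) X \<le> - 2 * M" by linarith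
    qed (use vpos[of q] in simp)
    finally show ?thesis by (simp add: mult.commute)
  qed
  have cF: "compact F" unfolding F_def by (rule compact_frontier)
  have cont_v: "continuous_on F v" by (rule continuous_on_subset[OF C2_derivs_continuous0[OF Cv] FU])
  obtain m where m: "m > 0" "\<And>q. q \<in> F \<Longrightarrow> m \<le> v q"
  proof (cases "F = {}")
    case True
    then show ?thesis using that[of 1] by simp
  next
    case False
    obtain q0 where "q0 \<in> F" "\<forall>q\<in>F. v q0 \<le> v q"
      using continuous_attains_inf[OF cF False cont_v] by blast
    then show ?thesis using that[of "v q0"] vpos by blast
  qed
  obtain d where d: "d > 0" "compact {x + y |x y. x \<in> K \<and> y \<in> cball 0 d}"
    "\<And>x y. x \<in> K \<Longrightarrow> norm y \<le> d \<Longrightarrow> x + y \<in> Dom"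
    by (rule compact_thickening_subset_open[OF K(1) open_Dom K(2)]) (rule that)
  define K1 where "K1 = {x + y |x y. x \<in> K \<and> y \<in> cball 0 d}"
  have K1: "compact K1" "K1 \<subseteq> Dom" using d(2,3) by (auto simp: K1_def)
  obtain A where A: "A \<ge> 1" "\<And>z. z \<in> K1 \<Longrightarrow> exp (- \<phi> z) \<le> A" "\<And>z. z \<in> K1 \<Longrightarrow> norm (a\<phi> z) \<le> A" "\<And>z. z \<in> K1 \<Longrightarrow> norm (b\<phi> z) \<le> A"
    by (rule bounded_coefficients[OF K1]) (rule that)
  obtain cD where cD: "cD \<ge> 0" "\<And>p X. p \<in> F \<Longrightarrow> \<bar>Dv p X\<bar> \<le> cD * norm X"
    by (rule C2_derivs_bound1[OF Cv cF FU]) (rule that)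
  \<comment> \<open>Admissible size of the Laplacian of \<open>\<phi>\<close>. Each of the four
    points then moves by a relative amount of at most \<open>\<epsilon> / 2 * h\<^sup>2\<close>, and
    together these change the sum of \<open>v\<close> to first order by at most
    \<open>M * m / 2 * h\<^sup>2\<close>.\<close>
  define \<epsilon> where "\<epsilon> = min 1 (M * m / (4 * (cD * A + 1)))"
  have cDA: "cD * A + 1 > 0" using cD A by (simp add: add_nonneg_pos)
  have \<epsilon>: "\<epsilon> > 0" "\<epsilon> \<le> 1" "cD * A * (2 * \<epsilon>) \<le> M * m / 2"
  proof -
    show e: "\<epsilon> > 0" "\<epsilon> \<le> 1" using M m cDA by (auto simp: \<epsilon>_def)
    have "\<epsilon> \<le> M * m / (4 * (cD * A + 1))" by (simp add: \<epsilon>_def)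
    then have "\<epsilon> * (cD * A + 1) \<le> M * m / 4" using cDA by (simp add: field_simps)
    then show "cD * A * (2 * \<epsilon>) \<le> M * m / 2" using e by (simp add: algebra_simps)
  qed
  \<comment> \<open>The supersolution is needed on a neighbourhood of \<open>K\<close>. There the
    Laplacian of \<open>\<phi>\<close> need not vanish, but by continuity it is small.\<close>
  define W where "W = K1 \<inter> {z \<in> K1. \<bar>lap (B\<phi> z)\<bar> \<in> {..\<epsilon>}}"
  have cont_lap: "continuous_on S (\<lambda>z. \<bar>lap (B\<phi> z)\<bar>)" if "S \<subseteq> Dom" for S
    unfolding lap_def by (intro continuous_intros continuous_on_subset[OF C2_derivsD(4)[OF C\<phi>] that])
  have cW: "compact W"
  proof -
    have "closedin (top_of_set K1) (K1 \<inter> (\<lambda>z. \<bar>lap (B\<phi> z)\<bar>) -` {..\<epsilon>})"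
      by (intro continuous_closedin_preimage cont_lap K1) auto
    then have "compact (K1 \<inter> (\<lambda>z. \<bar>lap (B\<phi> z)\<bar>) -` {..\<epsilon>})" using K1(1) closedin_compact by blast
    moreover have "K1 \<inter> (\<lambda>z. \<bar>lap (B\<phi> z)\<bar>) -` {..\<epsilon>} = W" by (auto simp: W_def)
    ultimately show ?thesis by simp
  qed
  have KW: "K \<subseteq> interior W"
  proof -
    define T where "T = (\<Union>x\<in>K. ball x d) \<inter> (Dom \<inter> (\<lambda>z. \<bar>lap (B\<phi> z)\<bar>) -` {..<\<epsilon>})"
    have "open T" unfolding T_def
      by (intro open_Int open_UN ballI open_ball continuous_open_preimage cont_lap open_Dom open_lessThan order_refl)
    moreover have "T \<subseteq> W"
    proof
      fix y assume "y \<in> T"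
      then obtain x where x: "x \<in> K" "dist x y < d" "\<bar>lap (B\<phi> y)\<bar> < \<epsilon>" by (auto simp: T_def)
      then have "y \<in> K1"
        unfolding K1_def by (intro CollectI exI[of _ x] exI[of _ "y - x"]) (auto simp: dist_norm norm_minus_commute)
      then show "y \<in> W" using x by (simp add: W_def)
    qed
    moreover have "K \<subseteq> T" using K d \<epsilon> flat by (auto simp: T_def)
    ultimately show ?thesis by (meson interior_maximal subset_trans)
  qed
  have WD: "W \<subseteq> K1" "W \<subseteq> Dom" using K1 by (auto simp: W_def)
  define u where "u z = (if z \<in> Dom then integral {0..2*pi} (\<lambda>\<theta>. v (bdry z \<theta>)) else 0)" for z
  have cont: "continuous_on S (\<lambda>\<theta>. v (bdry z \<theta>))" if "z \<in> Dom" for z S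
    by (rule continuous_on_compose2[OF cont_v continuous_on_bdry]) (use bdry_frontier[OF that] in \<open>auto simp: F_def\<close>)
  have int: "(\<lambda>\<theta>. v (bdry z \<theta>)) integrable_on {0..2*pi}" if "z \<in> Dom" for z
    by (rule integrable_continuous_real[OF cont[OF that]])
  have um: "2 * pi * m \<le> u z" if z: "z \<in> Dom" for z
  proof -
    have "integral {0..2*pi} (\<lambda>\<theta>. m) \<le> integral {0..2*pi} (\<lambda>\<theta>. v (bdry z \<theta>))"
      by (intro integral_le int[OF z]) (use m bdry_frontier[OF z] in \<open>auto simp: F_def\<close>)
    then show ?thesis using z by (simp add: u_def)
  qed
  have shift: "integral {0..2*pi} (\<lambda>\<theta>. v (bdry z (\<theta> + \<tau>))) = u z" if z: "z \<in> Dom" for z \<tau>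
  proof -
    have "bdry z (\<theta> + 2 * pi) = bdry z \<theta>" for \<theta> by (simp add: bdry_def cis.code)
    then show ?thesis using integral_periodic_shift[OF cont[OF z], of "2 * pi" \<tau>] z by (simp add: u_def)
  qed
  have Mm: "M * m / 2 > 0" using M m by simp
  have A0: "A \<ge> 0" using A by simp
  obtain h1 where h1: "h1 > 0 \<and> (\<forall>h z w a b e. 0 < h \<longrightarrow> h < h1 \<longrightarrow> pt z w \<in> F \<longrightarrow> norm w \<le> A \<longrightarrow> norm a \<le> A \<longrightarrow> norm b \<le> A \<longrightarrow>
    (\<forall>d\<in>dirs. norm (e d) \<le> A * h\<^sup>2) \<longrightarrow>
    (\<forall>d\<in>dirs. pt (z + of_real h * d) (w * exp (a * (of_real h * d) + b * (of_real h * d)\<^sup>2 + e d)) \<in> U) \<and>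
    \<bar>(\<Sum>d\<in>dirs. v (pt (z + of_real h * d) (w * exp (a * (of_real h * d) + b * (of_real h * d)\<^sup>2 + e d))))
       - 4 * v (pt z w) - Dv (pt z w) (pt 0 (w * (\<Sum>d\<in>dirs. e d))) - 4 * h\<^sup>2 * levi_of (Bv (pt z w)) (pt 1 (a * w))\<bar> \<le> M * m / 2 * h\<^sup>2)"
    using C2_derivs_hartogs_stencil[OF Cv cF FU A0 Mm] by (elim exE)
  have "\<epsilon> / 4 > 0" using \<epsilon> by simp
  then obtain h2 where h2: "h2 > 0" "\<And>h z d. 0 < h \<Longrightarrow> h < h2 \<Longrightarrow> z \<in> K1 \<Longrightarrow> d \<in> dirs \<Longrightarrow> z + of_real h * d \<in> Dom"
    "\<And>h z d. 0 < h \<Longrightarrow> h < h2 \<Longrightarrow> z \<in> K1 \<Longrightarrow> d \<in> dirs \<Longrightarrow>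
      \<bar>\<phi> (z + of_real h * d) - \<phi> z + Re (a\<phi> z * (of_real h * d) + b\<phi> z * (of_real h * d)\<^sup>2) - lap (B\<phi> z) / 4 * h\<^sup>2\<bar> \<le> \<epsilon> / 4 * h\<^sup>2"
    by (rule \<phi>_expansion[OF K1]) (rule that)
  have est: "stencil h u z \<le> (4 - M * h\<^sup>2) * u z" if h: "0 < h" "h < min h1 h2" and z: "z \<in> W" for h z
  proof -
    have z1: "z \<in> K1" "z \<in> Dom" using z WD by auto
    have zd: "z + of_real h * d \<in> Dom" if "d \<in> dirs" for d using h2(2)[OF h(1) _ z1(1) that] h by simp
    define s where "s d = a\<phi> z * (of_real h * d) + b\<phi> z * (of_real h * d)\<^sup>2" for d
    \<comment> \<open>The real correction that makes the modulus of the second coordinate exactly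
      \<open>exp (- \<phi>)\<close> at the displaced base point. The phase \<open>Im (s d)\<close>
      is left over.\<close>
    define e where "e d = complex_of_real (- (\<phi> (z + of_real h * d) - \<phi> z + Re (s d)))" for d
    have ne: "norm (e d) \<le> \<epsilon> / 2 * h\<^sup>2" if dd: "d \<in> dirs" for d
    proof -
      have "\<bar>\<phi> (z + of_real h * d) - \<phi> z + Re (s d) - lap (B\<phi> z) / 4 * h\<^sup>2\<bar> \<le> \<epsilon> / 4 * h\<^sup>2"
        unfolding s_def by (rule h2(3)) (use h z1 dd in auto)
      moreover have "\<bar>lap (B\<phi> z) / 4 * h\<^sup>2\<bar> \<le> \<epsilon> / 4 * h\<^sup>2"
        using z by (simp add: W_def abs_mult mult_right_mono)
      ultimately have "\<bar>\<phi> (z + of_real h * d) - \<phi> z + Re (s d)\<bar> \<le> \<epsilon> / 4 * h\<^sup>2 + \<epsilon> / 4 * h\<^sup>2" by linarith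
      also have "\<dots> = \<epsilon> / 2 * h\<^sup>2" by simp
      finally show ?thesis unfolding e_def norm_of_real abs_minus_cancel .
    qed
    have point: "pt (z + of_real h * d) (of_real (exp (- \<phi> z)) * cis \<theta> * exp (s d + e d)) = bdry (z + of_real h * d) (\<theta> + Im (s d))" for d \<theta>
    proof -
      have "s d + e d = of_real (- \<phi> (z + of_real h * d) + \<phi> z) + \<i> * of_real (Im (s d))"
        by (simp add: e_def complex_eq_iff)
      then have "exp (s d + e d) = of_real (exp (- \<phi> (z + of_real h * d) + \<phi> z)) * cis (Im (s d))"
        by (simp only: exp_add[of "of_real _"] exp_of_real cis_conv_exp)
      then have "exp (s d + e d) = of_real (exp (- \<phi> (z + of_real h * d))) * of_real (exp (\<phi> z)) * cis (Im (s d))"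
        by (simp only: exp_add of_real_mult)
      moreover have "complex_of_real (exp (\<phi> z)) * of_real (exp (- \<phi> z)) = 1"
        by (simp only: of_real_mult[symmetric] exp_add[symmetric]) simp
      ultimately have "of_real (exp (- \<phi> z)) * cis \<theta> * exp (s d + e d)
          = of_real (exp (- \<phi> (z + of_real h * d))) * cis (\<theta> + Im (s d))"
        by (simp only: cis_mult[symmetric] mult.assoc mult.left_commute[of "of_real (exp (- \<phi> z))"]) simp
      then show ?thesis by (simp only: bdry_def)
    qed
    have pw: "(\<Sum>d\<in>dirs. v (bdry (z + of_real h * d) (\<theta> + Im (s d)))) \<le> (4 - 2 * M * h\<^sup>2) * v (bdry z \<theta>) + M * m * h\<^sup>2" for \<theta>
    proof -
      define w where "w = of_real (exp (- \<phi> z)) * cis \<theta>"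
      have b: "bdry z \<theta> = pt z w" by (simp add: bdry_def w_def)
      have wA: "norm w \<le> A" using A(2)[OF z1(1)] by (simp add: w_def norm_mult)
      have pF: "pt z w \<in> F" using bdry_frontier[OF z1(2)] by (simp add: b[symmetric] F_def)
      have "\<bar>(\<Sum>d\<in>dirs. v (pt (z + of_real h * d) (w * exp (a\<phi> z * (of_real h * d) + b\<phi> z * (of_real h * d)\<^sup>2 + e d))))
       - 4 * v (pt z w) - Dv (pt z w) (pt 0 (w * (\<Sum>d\<in>dirs. e d))) - 4 * h\<^sup>2 * levi_of (Bv (pt z w)) (pt 1 (a\<phi> z * w))\<bar> \<le> M * m / 2 * h\<^sup>2"
      proof (rule h1[THEN conjunct2, rule_format, THEN conjunct2])
        fix d assume "d \<in> dirs"
        from ne[OF this] show "norm (e d) \<le> A * h\<^sup>2"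
        proof (rule order_trans)
          show "\<epsilon> / 2 * h\<^sup>2 \<le> A * h\<^sup>2" using \<epsilon> A(1) by (intro mult_right_mono) auto
        qed
      qed (use h pF wA A z1 in auto)
      then have "\<bar>(\<Sum>d\<in>dirs. v (bdry (z + of_real h * d) (\<theta> + Im (s d))))
       - 4 * v (pt z w) - Dv (pt z w) (pt 0 (w * (\<Sum>d\<in>dirs. e d))) - 4 * h\<^sup>2 * levi_of (Bv (pt z w)) (pt 1 (a\<phi> z * w))\<bar> \<le> M * m / 2 * h\<^sup>2"
        unfolding s_def[symmetric] unfolding w_def point .
      moreover have "4 * h\<^sup>2 * levi_of (Bv (pt z w)) (pt 1 (a\<phi> z * w)) \<le> - 2 * M * v (pt z w) * h\<^sup>2"
      proof -
        have "1 \<le> (norm (pt 1 (a\<phi> z * w)))\<^sup>2" unfolding norm_pt by simp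
        then have "1\<^sup>2 \<le> (norm (pt 1 (a\<phi> z * w)))\<^sup>2" by (simp only: one_power2)
        then have "1 \<le> norm (pt 1 (a\<phi> z * w))" by (rule power2_le_imp_le) (rule norm_ge_zero)
        from mult_right_mono[OF super[OF _ this, of "pt z w"], of "h\<^sup>2"] show ?thesis
          using pF FU by (simp add: algebra_simps subset_iff)
      qed
      moreover have "Dv (pt z w) (pt 0 (w * (\<Sum>d\<in>dirs. e d))) \<le> M * m / 2 * h\<^sup>2"
      proof -
        have "norm (pt 0 (w * (\<Sum>d\<in>dirs. e d))) \<le> norm (0::complex) + norm (w * (\<Sum>d\<in>dirs. e d))" by (rule norm_pt_le)
        also have "\<dots> = norm w * norm (\<Sum>d\<in>dirs. e d)" by (simp add: norm_mult)
        also have "\<dots> \<le> A * (\<Sum>d\<in>dirs. \<epsilon> / 2 * h\<^sup>2)"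
          using wA A0 by (intro mult_mono order_trans[OF norm_sum] sum_mono ne) auto
        also have "\<dots> = A * (2 * \<epsilon>) * h\<^sup>2" by simp
        finally have "cD * norm (pt 0 (w * (\<Sum>d\<in>dirs. e d))) \<le> cD * (A * (2 * \<epsilon>) * h\<^sup>2)"
          using cD by (intro mult_left_mono) auto
        also have "\<dots> = cD * A * (2 * \<epsilon>) * h\<^sup>2" by simp
        also have "\<dots> \<le> M * m / 2 * h\<^sup>2" by (intro mult_right_mono \<epsilon>(3)) auto
        finally show ?thesis using cD(2)[OF pF, of "pt 0 (w * (\<Sum>d\<in>dirs. e d))"] by linarith
      qed
      ultimately have "(\<Sum>d\<in>dirs. v (bdry (z + of_real h * d) (\<theta> + Im (s d)))) \<le> 4 * v (pt z w) + - 2 * M * v (pt z w) * h\<^sup>2 + (M * m / 2 * h\<^sup>2 + M * m / 2 * h\<^sup>2)"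
        by (simp only: abs_le_iff) linarith
      also have "\<dots> = (4 - 2 * M * h\<^sup>2) * v (bdry z \<theta>) + M * m * h\<^sup>2" by (simp add: b algebra_simps)
      finally show ?thesis .
    qed
    have intd: "(\<lambda>\<theta>. v (bdry (z + of_real h * d) (\<theta> + Im (s d)))) integrable_on {0..2*pi}" if "d \<in> dirs" for d
      by (intro integrable_continuous_real continuous_on_compose2[OF cont[OF zd[OF that], of UNIV]] continuous_intros) auto
    \<comment> \<open>The phase does not depend on the angle, so periodicity absorbs it in the
      integral.\<close>
    have "stencil h u z = (\<Sum>d\<in>dirs. integral {0..2*pi} (\<lambda>\<theta>. v (bdry (z + of_real h * d) (\<theta> + Im (s d)))))"
      unfolding stencil_def by (intro sum.cong refl) (simp add: shift zd)
    also have "\<dots> = integral {0..2*pi} (\<lambda>\<theta>. \<Sum>d\<in>dirs. v (bdry (z + of_real h * d) (\<theta> + Im (s d))))"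
      by (rule integral_sum[symmetric]) (use intd in auto)
    also have "\<dots> \<le> integral {0..2*pi} (\<lambda>\<theta>. (4 - 2 * M * h\<^sup>2) * v (bdry z \<theta>) + M * m * h\<^sup>2)"
    proof (rule integral_le)
      show "(\<lambda>\<theta>. \<Sum>d\<in>dirs. v (bdry (z + of_real h * d) (\<theta> + Im (s d)))) integrable_on {0..2*pi}"
        by (rule integrable_sum) (use intd in auto)
      show "(\<lambda>\<theta>. (4 - 2 * M * h\<^sup>2) * v (bdry z \<theta>) + M * m * h\<^sup>2) integrable_on {0..2*pi}"
        by (intro integrable_continuous_real continuous_intros cont z1)
    qed (rule pw)
    also have "\<dots> = (4 - 2 * M * h\<^sup>2) * u z + M * h\<^sup>2 * (2 * pi * m)"
    proof -
      have "integral {0..2*pi} (\<lambda>\<theta>. (4 - 2 * M * h\<^sup>2) * v (bdry z \<theta>) + M * m * h\<^sup>2)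
         = integral {0..2*pi} (\<lambda>\<theta>. (4 - 2 * M * h\<^sup>2) * v (bdry z \<theta>)) + integral {0..2*pi} (\<lambda>\<theta>. M * m * h\<^sup>2)"
        by (intro integral_add integrable_continuous_real continuous_intros cont z1)
      then show ?thesis using z1(2) by (simp add: u_def)
    qed
    \<comment> \<open>The lower bound \<open>m\<close> for \<open>v\<close> turns the additive error
      into a multiple of \<open>u z\<close>.\<close>
    also have "\<dots> \<le> (4 - 2 * M * h\<^sup>2) * u z + M * h\<^sup>2 * u z"
      using M um[OF z1(2)] by (intro add_left_mono mult_left_mono) auto
    also have "\<dots> = (4 - M * h\<^sup>2) * u z" by (simp add: algebra_simps)
    finally show ?thesis .
  qed
  have upos: "0 < u z" if "z \<in> Dom" for z
  proof -
    have "0 < 2 * pi * m" using m by simp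
    then show ?thesis using um[OF that] by linarith
  qed
  then have "0 \<le> u z" for z by (cases "z \<in> Dom") (auto simp: u_def less_imp_le)
  moreover have "min h1 h2 > 0" using h1 h2(1) by simp
  ultimately show ?thesis
    using cW KW est upos WD(2) by (intro exI[of _ W] exI[of _ u] exI[of _ "min h1 h2"]) blast
qed

text \<open>Three layers of unit vectors over the boundary: on Levi-null tangential ones the
  pulled-back \<open>l\<close> supplies the bound, on all tangential ones a multiple of
  \<open>r\<close> repairs it, and on all vectors a multiple of the square of \<open>r\<close> does.
  The compactness of each layer yields the constants through
  \<open>penalty_constant\<close>.\<close>

lemma property_P_tilde_imp_P:
  assumes psc: "pseudoconvex \<Omega>"
    and spsc: "\<And>p. p \<in> frontier \<Omega> \<Longrightarrow> p $ 2 = 0 \<Longrightarrow> strictly_pseudoconvex_at \<Omega> p"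
    and Pt: "property_P_tilde (frontier \<Omega>)"
  shows "property_P (frontier \<Omega>)"
  unfolding property_P_iff
proof (intro conjI allI impI compact_frontier)
  fix M :: real assume M: "M > 0"
  define F where "F = frontier \<Omega>"
  define S where "S = F \<times> sphere (0 :: complex^2) 1"
  have cF: "compact F" unfolding F_def by (rule compact_frontier)
  have cS: "compact S" unfolding S_def by (intro compact_Times cF compact_sphere)
  obtain r D B where Cr: "C2_derivs UNIV r D B" and r0: "\<And>q. q \<in> frontier \<Omega> \<Longrightarrow> r q = 0"
    and Lr: "\<And>q X. q \<in> frontier \<Omega> \<Longrightarrow> X \<noteq> 0 \<Longrightarrow> D q X = 0 \<Longrightarrow> D q (\<i> *s X) = 0 \<Longrightarrow> 0 \<le> levi_of (B q) X"
    and Lr0: "\<And>q X. q \<in> frontier \<Omega> \<Longrightarrow> X \<noteq> 0 \<Longrightarrow> D q X = 0 \<Longrightarrow> D q (\<i> *s X) = 0 \<Longrightarrow> levi_of (B q) X = 0 \<Longrightarrow>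
       q $ 1 \<in> Dom \<and> lap (B\<phi> (q $ 1)) = 0 \<and> X $ 1 \<noteq> 0"
    by (rule global_defining[OF psc], erule (1) spsc, rule that)
  define G where "G x = grad2_of (D (fst x)) (snd x)" for x
  define L where "L x = levi_of (B (fst x)) (snd x)" for x
  have cG: "continuous_on T G" and cL: "continuous_on T L" for T
    using continuous_on_subset[OF continuous_on_grad2_of[OF Cr]] continuous_on_subset[OF continuous_on_levi_of[OF Cr]]
    unfolding G_def[abs_def] L_def[abs_def] by auto
  define S1 where "S1 = S \<inter> G -` {0}"
  \<comment> \<open>The null vectors of the Levi form among complex tangential unit vectors. Their
    base points project to the compact set \<open>K\<close> on which \<open>\<phi>\<close> is
    harmonic, and their first components are bounded away from zero.\<close>
  define Z where "Z = S1 \<inter> L -` {0}"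
  have closed_pre: "compact (T \<inter> f -` {0})" if "compact T" "continuous_on T f" for T :: "((complex^2) \<times> (complex^2)) set" and f :: "_ \<Rightarrow> real"
    using continuous_closedin_preimage[OF that(2), of "{0}"] closedin_compact[OF that(1)] by auto
  have cS1: "compact S1" unfolding S1_def by (rule closed_pre[OF cS cG])
  have cZ: "compact Z" unfolding Z_def by (rule closed_pre[OF cS1 cL])
  have tang: "fst x \<in> frontier \<Omega>" "snd x \<noteq> 0" "D (fst x) (snd x) = 0" "D (fst x) (\<i> *s snd x) = 0" if "x \<in> S1" for x
    using that by (auto simp: S1_def S_def F_def G_def grad2_of_eq_0_iff)
  have Zx: "fst x $ 1 \<in> Dom" "lap (B\<phi> (fst x $ 1)) = 0" "snd x $ 1 \<noteq> 0" if "x \<in> Z" for x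
    using Lr0[OF tang, of x] that by (auto simp: Z_def L_def)
  define K where "K = (\<lambda>x. fst x $ 1) ` Z"
  have cK: "compact K" unfolding K_def
    by (intro compact_continuous_image cZ continuous_intros continuous_on_component)
  have KD: "K \<subseteq> Dom" "\<And>z. z \<in> K \<Longrightarrow> lap (B\<phi> z) = 0" using Zx by (auto simp: K_def)
  obtain c where c: "c > 0" "\<And>x. x \<in> Z \<Longrightarrow> c \<le> (norm (snd x $ 1))\<^sup>2"
  proof (cases "Z = {}")
    case True
    then show ?thesis using that[of 1] by simp
  next
    case False
    have "continuous_on Z (\<lambda>x. (norm (snd x $ 1))\<^sup>2)"
      by (intro continuous_intros continuous_on_component)
    then obtain x0 where "x0 \<in> Z" "\<forall>x\<in>Z. (norm (snd x0 $ 1))\<^sup>2 \<le> (norm (snd x $ 1))\<^sup>2"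
      using continuous_attains_inf[OF cZ False] by blast
    then show ?thesis using that[of "(norm (snd x0 $ 1))\<^sup>2"] Zx(3)[of x0] by simp
  qed
  \<comment> \<open>The Levi form of the pullback is a quarter of the Laplacian times the squared
    first component, so on \<open>Z\<close> it is at least
    \<open>c * N / 4 = 3 * M + 1\<close>.\<close>
  define N where "N = 4 * (3 * M + 1) / c"
  have N: "N > 0" using M c by (simp add: N_def)
  obtain l Dl Bl where Cl: "C2_derivs UNIV l Dl Bl" and l01: "\<And>z. 0 \<le> l z" "\<And>z. l z \<le> 1"
    and lN: "\<And>z. z \<in> K \<Longrightarrow> N \<le> lap (Bl z)"
  proof (rule laplacian_from_supersolutions[OF cK _ N])
    show "\<exists>W u h0. compact W \<and> K \<subseteq> interior W \<and> h0 > 0 \<and> (\<forall>x. 0 \<le> u x) \<and> (\<forall>x\<in>W. 0 < u x) \<and>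
      (\<forall>h x. 0 < h \<and> h < h0 \<and> x \<in> W \<longrightarrow> stencil h u x \<le> (4 - M' * h\<^sup>2) * u x)" if "M' > 0" for M'
      by (rule averaged_supersolution[OF Pt cK KD that])
  qed (rule that)
  define \<Lambda> where "\<Lambda> q = l (q $ 1 + 0)" for q :: "complex^2"
  define D\<Lambda> where "D\<Lambda> q X = Dl (q $ 1 + 0) (X $ 1)" for q X :: "complex^2"
  define B\<Lambda> where "B\<Lambda> q X Y = Bl (q $ 1 + 0) (X $ 1) (Y $ 1)" for q X Y :: "complex^2"
  have C\<Lambda>: "C2_derivs UNIV \<Lambda> D\<Lambda> B\<Lambda>"
    using C2_derivs_compose_affine[OF Cl bounded_linear_vec_nth[of 1], of 0]
    unfolding \<Lambda>_def[abs_def] D\<Lambda>_def[abs_def] B\<Lambda>_def[abs_def] by simp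
  have L\<Lambda>: "levi_of (B\<Lambda> q) X = (norm (X $ 1))\<^sup>2 * lap (Bl (q $ 1)) / 4" for q X
    using lap_rotation_invariant[of "Bl (q $ 1)" "X $ 1", OF C2_derivs_linear2[OF Cl] C2_derivs_linear3[OF Cl]]
    by (simp add: levi_of_def B\<Lambda>_def)
  define P where "P x = levi_of (B\<Lambda> (fst x)) (snd x)" for x
  have cP: "continuous_on T P" for T
    using continuous_on_subset[OF continuous_on_levi_of[OF C\<Lambda>]] unfolding P_def[abs_def] by auto
  obtain A where A: "A \<ge> 0" "\<And>x. x \<in> S1 \<Longrightarrow> 3 * M < P x + A * L x"
  proof (rule penalty_constant[OF cS1 cP cL])
    show "0 \<le> L x" if "x \<in> S1" for x using Lr[OF tang[OF that]] by (simp add: L_def)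
    show "3 * M < P x" if x: "x \<in> S1" "L x = 0" for x
    proof -
      have xZ: "x \<in> Z" using x by (simp add: Z_def)
      have "c * N \<le> (norm (snd x $ 1))\<^sup>2 * lap (Bl (fst x $ 1))"
        using c(1) N by (intro mult_mono c(2)[OF xZ] lN) (use xZ in \<open>auto simp: K_def\<close>)
      moreover have "c * N = 4 * (3 * M + 1)" using c(1) by (simp add: N_def)
      ultimately show ?thesis by (simp add: P_def L\<Lambda>)
    qed
  qed (rule that)
  obtain A' where A': "A' \<ge> 0" "\<And>x. x \<in> S \<Longrightarrow> 3 * M < (P x + A * L x) + A' * G x"
  proof (rule penalty_constant[OF cS _ cG])
    show "continuous_on S (\<lambda>x. P x + A * L x)" by (intro continuous_intros cP cL)
    show "0 \<le> G x" for x by (simp add: G_def grad2_of_nonneg)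
    show "3 * M < P x + A * L x" if "x \<in> S" "G x = 0" for x
      by (rule A(2)) (use that in \<open>simp add: S1_def\<close>)
  qed (rule that)
  \<comment> \<open>Where \<open>r\<close> vanishes, the Levi form of half the square of
    \<open>r\<close> is the squared gradient \<open>G\<close>; hence the coefficient
    \<open>A' / 2\<close>.\<close>
  define k where "k q = A * r q + A' / 2 * (r q * r q)" for q
  define U where "U = {q. \<bar>k q\<bar> < 1}"
  have ck: "continuous_on UNIV k"
    unfolding k_def by (intro continuous_intros C2_derivs_continuous0[OF Cr])
  have U: "open U"
  proof -
    have "open ((\<lambda>q. \<bar>k q\<bar>) -` {..<1})" by (intro open_vimage continuous_intros ck)
    then show ?thesis by (simp add: U_def vimage_def)
  qed
  have FU: "F \<subseteq> U" using r0 by (auto simp: F_def U_def k_def)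
  note Cf = C2_derivs_subset[OF C2_derivs_cmult[OF C2_derivs_add[OF C2_derivs_add[OF C\<Lambda> C2_derivs_const[OF open_UNIV, of 1]]
      C2_derivs_add[OF C2_derivs_cmult[OF Cr, of A] C2_derivs_cmult[OF C2_derivs_mult[OF Cr Cr], of "A' / 2"]]], of "1/3"] U subset_UNIV]
  \<comment> \<open>On \<open>U\<close> the correction \<open>k\<close> has modulus below one, so
    adding 1 and dividing by 3 puts the values between 0 and 1. The division is why the bounds above
    aim at \<open>3 * M\<close>.\<close>
  define f where "f q = 1/3 * (\<Lambda> q + 1 + (A * r q + A' / 2 * (r q * r q)))" for q
  define Bf where "Bf q X Y = 1/3 * (B\<Lambda> q X Y + 0 + (A * B q X Y
       + A' / 2 * (r q * B q X Y + D q Y * D q X + (D q X * D q Y + B q X Y * r q))))" for q X Y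
  have f01: "0 \<le> f q \<and> f q \<le> 1" if "q \<in> U" for q
    using that l01[of "q $ 1"] by (simp add: U_def k_def f_def \<Lambda>_def abs_less_iff)
  have lev: "M * (norm X)\<^sup>2 \<le> levi_of (Bf q) X" if q: "q \<in> F" for q X
  proof (rule levi_of_ge_from_sphere[OF Cf[folded f_def[abs_def] Bf_def[abs_def]]])
    show "q \<in> U" using q FU by auto
    fix X :: "complex^2" assume X: "norm X = 1"
    have "levi_of (Bf q) X = 1/3 * ((P (q, X) + A * L (q, X)) + A' * G (q, X))"
      using r0[of q] q
      by (simp add: F_def Bf_def levi_of_def P_def L_def G_def grad2_of_def power2_eq_square algebra_simps add_divide_distrib)
    moreover have "3 * M < (P (q, X) + A * L (q, X)) + A' * G (q, X)"
      by (rule A'(2)) (use q X in \<open>simp add: S_def\<close>)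
    ultimately show "M \<le> levi_of (Bf q) X" by simp
  qed
  show "\<exists>U f D B. frontier \<Omega> \<subseteq> U \<and> C2_derivs U f D B \<and> (\<forall>z\<in>U. 0 \<le> f z \<and> f z \<le> 1) \<and>
      (\<forall>z\<in>frontier \<Omega>. \<forall>X. M * (norm X)\<^sup>2 \<le> levi_of (B z) X)"
    using FU Cf[folded f_def[abs_def] Bf_def[abs_def]] f01 lev unfolding F_def by blast
qed

end

theorem lemma6:
  fixes D :: "complex set" and \<phi> :: "complex \<Rightarrow> real" and \<Omega> :: "(complex^2) set"
  assumes "open D" and "connected D" and "D \<noteq> {}" and "bounded D"
    and "Ck_on 2 D \<phi>"
    and "\<Omega> = hartogs_domain D \<phi>"
    and "bounded \<Omega>"
    and "complete_hartogs \<Omega>"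
    and "smooth_boundary \<Omega>"
    and "pseudoconvex \<Omega>"
    and "\<forall>p\<in>frontier \<Omega>. p $ 2 = 0 \<longrightarrow> strictly_pseudoconvex_at \<Omega> p"
  shows "property_P (frontier \<Omega>) \<longleftrightarrow> property_P_tilde (frontier \<Omega>)"
proof
  show "property_P (frontier \<Omega>) \<Longrightarrow> property_P_tilde (frontier \<Omega>)"
    by (rule property_P_imp_P_tilde)
  interpret hartogs_C2 D \<phi> "\<lambda>x. frechet_derivative \<phi> (at x)"
    "\<lambda>x v. frechet_derivative (\<lambda>y. frechet_derivative \<phi> (at y) v) (at x)" \<Omega>
    by unfold_locales (use assms Ck_on_2_imp_C2_derivs in auto)
  show "property_P_tilde (frontier \<Omega>) \<Longrightarrow> property_P (frontier \<Omega>)"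
    using property_P_tilde_imp_P assms by blast
qed

end
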